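(* Let $\varepsilon>0$. (i) For every integer $k\geq 4$ there is a constant $C_1=C_1(k,\varepsilon)>0$, depending only on $k$ and $\varepsilon$, such that the following holds for every nonzero integer $n$: if $a_1<a_2\leq b_1<b_2<\cdots<b_m$ are positive integers such that $a_ib_j+n$ is a perfect $k$-th power for all $1\leq i\leq 2$ and $1\leq j\leq m$, then $$m\leq C_1\,|n|^{\frac{\phi(k)}{(k-3)k}+\varepsilon}.$$ (ii) There is a constant $C_2=C_2(\varepsilon)>0$, depending only on $\varepsilon$, such that the following holds for every nonzero integer $n$: if $a_1<a_2<a_3\leq b_1<b_2<\cdots<b_m$ are positive integers such that $a_ib_j+n$ is a perfect cube for all $1\leq i\leq 3$ and $1\leq j\leq m$, then $$m\leq C_2\,|n|^{\frac{34}{27}+\varepsilon}.$$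
   Context: $\phi$ denotes Euler's totient function. A perfect $k$-th power is the $k$-th power of an integer. *)

theory Defs
  imports
    Complex_Main
    "HOL-Computational_Algebra.Nth_Powers"
    "HOL-Number_Theory.Totient"
begin

end

theory Submission
  imports
    "HOL-Number_Theory.Residues"
    "HOL-Computational_Algebra.Polynomial"
    Defs
begin

text \<open>Fix \<open>a\<^sub>1 < a\<^sub>2\<close>. A number \<open>b\<close> with \<open>a\<^sub>1 b + n = x\<^sup>k\<close> and \<open>a\<^sub>2 b + n = y\<^sup>k\<close> gives a point on the
Thue curve \<open>a\<^sub>2 x\<^sup>k - a\<^sub>1 y\<^sup>k = n (a\<^sub>2 - a\<^sub>1)\<close>. Both bounds follow from the stronger estimate that the number
of such \<open>b\<close> is at most \<open>C |n|\<^sup>\<epsilon>\<close>; it is obtained by treating separately the \<open>b\<close> below and above a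
threshold of the form \<open>\<theta> |n|^(6k)\<close>.

Below the threshold all data are bounded by a power of \<open>|n|\<close>. Dividing out \<open>gcd(a\<^sub>1, a\<^sub>2)\<close> and
\<open>gcd(x, y)\<close> (as many cases as there are divisors) leaves coprime solutions of
\<open>A x\<^sup>k - B y\<^sup>k = H\<close> with coprime \<open>A\<close> and \<open>B\<close>. If \<open>p^e\<close> exactly divides \<open>H\<close>, then, up to the power of \<open>p\<close> that
\<open>A\<close> or \<open>B\<close> forces into \<open>y\<close> or \<open>x\<close>, the ratio \<open>y/x\<close> is a \<open>k\<close>-th root of \<open>A/B\<close> modulo a power of \<open>p\<close>. The
solutions therefore fall into at most \<open>k^(2 \<omega>(H))\<close> classes, where \<open>\<omega>(H)\<close> is the number of primes
dividing \<open>H\<close> (lemma \<open>root_classes\<close>), and within one class the determinant \<open>D = x\<^sub>1 y\<^sub>2 - x\<^sub>2 y\<^sub>1\<close> is almost a multiple of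
\<open>H\<close>. As \<open>(x\<^sub>1 y\<^sub>2)\<^sup>k - (x\<^sub>2 y\<^sub>1)\<^sup>k\<close> is an explicit multiple of \<open>H\<close>, the solutions of a class grow so fast
(lemma \<open>same_class_gap\<close>) that only logarithmically many lie below the threshold. The bound \<open>O(|n|\<^sup>\<epsilon>)\<close>
for the number of divisors and of classes finishes this range (lemma \<open>count_up_to_bound\<close>).

Above the threshold the integers \<open>X = x\<^sub>1 y\<^sub>2\<close> and \<open>Y = x\<^sub>2 y\<^sub>1\<close> satisfy
\<open>X\<^sup>k - Y\<^sup>k = n (a\<^sub>2 - a\<^sub>1) (b\<^sub>2 - b\<^sub>1) \<noteq> 0\<close>, and \<open>|X - Y| \<ge> 1\<close> already forces
\<open>b\<^sub>2 \<ge> b\<^sub>1^(3/2)\<close> (lemmas \<open>growth_two\<close> and \<open>growth_three\<close>; for cubes the pair of coefficients is chosen among three,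
depending on the size of \<open>b\<^sub>1\<close>). On the other hand one sufficiently large solution
\<open>b\<^sub>0\<close> bounds all larger \<open>b\<close> polynomially, \<open>b \<le> b\<^sub>0^(10k+11)\<close> (lemma \<open>large_solution_bound\<close>): this is the Thue--Siegel
method, with explicit Pade approximants to the \<open>k\<close>-th root evaluated at
\<open>a\<^sub>2 (a\<^sub>1 b\<^sub>0 + n) / (a\<^sub>1 (a\<^sub>2 b\<^sub>0 + n))\<close>, a number close to \<open>1\<close>. Superlinear growth of the exponents
against a fixed exponent leaves a number of large \<open>b\<close> that is bounded in terms of \<open>k\<close> alone
(lemma \<open>no_long_growth_chain\<close>).\<close>

section \<open>Factorials and products along arithmetic progressions\<close>

text \<open>Removing the factors prime to \<open>p\<close> turns \<open>n!\<close> into \<open>p\<^sup>m m!\<close> with \<open>m = \<lfloor>n/p\<rfloor> \<le> n/2\<close>, so induction applies.\<close>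

lemma multiplicity_fact_le:
  fixes p :: nat
  assumes p: "prime p"
  shows "multiplicity p (fact n :: nat) \<le> n"
proof (induction n rule: less_induct)
  case (less n)
  show ?case
  proof (cases "n = 0")
    case False
    define m where "m = n div p"
    have p2: "p \<ge> 2" using p by (rule prime_ge_2_nat)
    define N where "N = {i\<in>{1..n}. \<not> p dvd i}"
    have M: "{i\<in>{1..n}. p dvd i} = (\<lambda>i. p * i) ` {1..m}"
    proof (intro equalityI subsetI)
      fix i assume "i \<in> {i\<in>{1..n}. p dvd i}"
      then obtain j where j: "i = p * j" "1 \<le> i" "i \<le> n" by (auto simp: dvd_def)
      moreover have "j \<le> m" unfolding m_def using j p2
        by (metis div_le_mono nonzero_mult_div_cancel_left not_numeral_le_zero)
      moreover have "j \<ge> 1" using j by (cases j) auto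
      ultimately show "i \<in> (\<lambda>i. p * i) ` {1..m}" by auto
    next
      fix i assume "i \<in> (\<lambda>i. p * i) ` {1..m}"
      then obtain j where j: "i = p * j" "1 \<le> j" "j \<le> m" using atLeastAtMost_iff by blast
      have "p * j \<le> p * m" using j by simp
      also have "\<dots> \<le> n" by (simp add: m_def)
      finally show "i \<in> {i\<in>{1..n}. p dvd i}" using j p2 by auto
    qed
    have split: "{1..n} = N \<union> {i\<in>{1..n}. p dvd i}" by (auto simp: N_def)
    have "(fact n :: nat) = \<Prod>{1..n}" by (simp add: fact_prod)
    also have "\<dots> = \<Prod>(N \<union> {i\<in>{1..n}. p dvd i})"
      by (rule arg_cong[OF split])
    also have "\<dots> = \<Prod>N * \<Prod>{i\<in>{1..n}. p dvd i}"
      by (rule prod.union_disjoint) (auto simp: N_def)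
    also have "\<Prod>{i\<in>{1..n}. p dvd i} = p ^ m * fact m"
      unfolding M using p2 by (subst prod.reindex) (auto simp: inj_on_def fact_prod prod.distrib)
    finally have f: "(fact n :: nat) = \<Prod>N * (p ^ m * fact m)" .
    have "\<not> p dvd \<Prod>N"
    proof
      assume "p dvd \<Prod>N"
      then obtain i where "i \<in> N" "p dvd i" using p by (subst (asm) prime_dvd_prod_iff) (auto simp: N_def)
      then show False by (auto simp: N_def)
    qed
    moreover have "\<Prod>N \<noteq> 0" by (auto simp: N_def)
    ultimately have "multiplicity p (fact n :: nat) = m + multiplicity p (fact m :: nat)"
      unfolding f using p p2
      by (subst prime_elem_multiplicity_mult_distrib)
        (auto simp: prime_elem_multiplicity_mult_distrib not_dvd_imp_multiplicity_0 prime_imp_prime_elem)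
    also have "\<dots> \<le> m + m"
      using less.IH[of m] False p2 by (simp add: m_def)
    also have "\<dots> \<le> n"
    proof -
      have "2 * m \<le> p * m" using p2 by simp
      also have "\<dots> \<le> n" by (simp add: m_def)
      finally show ?thesis by simp
    qed
    finally show ?thesis .
  qed auto
qed

text \<open>In other words, \<open>k^(2n)\<close> clears the denominator of the \<open>n\<close>-th binomial coefficient of \<open>-u/k\<close>. Primes
dividing \<open>k\<close> are absorbed by the factor \<open>k^n\<close>; modulo a power of any other prime \<open>k\<close> is invertible, and
the progression becomes a product of \<open>n\<close> consecutive integers.\<close>

lemma fact_dvd_power_mult_progression:
  fixes u k :: int and n :: nat
  assumes k: "k > 0"
  shows "fact n dvd k ^ n * (\<Prod>j<n. u + k * int j)"
proof (cases "k ^ n * (\<Prod>j<n. u + k * int j) = 0")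
  case False
  define X where "X = k ^ n * (\<Prod>j<n. u + k * int j)"
  have X: "X \<noteq> 0" using False by (simp add: X_def)
  show ?thesis unfolding X_def[symmetric]
  proof (rule multiplicity_le_imp_dvd)
    fix p :: int
    assume p: "prime p"
      define e where "e = multiplicity p (fact n :: int)"
      have e: "p ^ e dvd fact n" unfolding e_def by (rule multiplicity_dvd)
      have "p ^ e dvd X"
      proof (cases "p dvd k")
        case True
        have "e \<le> n"
        proof -
          obtain q where q: "p = int q" "prime q" using p
            by (metis prime_int_iff prime_nat_int_transfer zero_le_imp_eq_int prime_ge_0_int)
          have "int (q ^ e) dvd int (fact n)" using e by (simp add: q(1))
          then have "q ^ e dvd fact n" by (simp only: int_dvd_int_iff)
          then have "e \<le> multiplicity q (fact n :: nat)"
            using q(2) by (intro multiplicity_geI) auto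
          then show ?thesis using multiplicity_fact_le[OF q(2)] by (meson order_trans)
        qed
        then have "p ^ e dvd p ^ n" by (rule le_imp_power_dvd)
        also have "\<dots> dvd k ^ n" using True by (rule dvd_power_same)
        finally show ?thesis by (simp add: X_def)
      next
        case False
        then have "coprime (p ^ e) k" using p by (simp add: prime_imp_coprime)
        then obtain k' where k': "[k * k' = 1] (mod p ^ e)"
          using cong_solve_coprime_int coprime_commute by blast
        have "[(\<Prod>j<n. u + k * int j) = (\<Prod>j<n. k * (u * k' + int j))] (mod p ^ e)"
        proof (rule cong_prod)
          fix j
          have "[u * 1 + k * int j = u * (k * k') + k * int j] (mod p ^ e)"
            by (intro cong_add cong_mult cong_refl) (use k' in \<open>simp add: cong_sym\<close>)
          then show "[u + k * int j = k * (u * k' + int j)] (mod p ^ e)" by (simp add: algebra_simps)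
        qed
        also have "(\<Prod>j<n. k * (u * k' + int j)) = k ^ n * pochhammer (u * k') n"
          by (simp add: prod.distrib pochhammer_prod atLeast0LessThan)
        finally have *: "[(\<Prod>j<n. u + k * int j) = k ^ n * pochhammer (u * k') n] (mod p ^ e)" .
        have "p ^ e dvd k ^ n * pochhammer (u * k') n"
          using e fact_dvd_pochhammer[of n "u * k'"] by (meson dvd_mult dvd_trans)
        then have "p ^ e dvd (\<Prod>j<n. u + k * int j)"
          using * cong_dvd_iff by blast
        then show ?thesis by (simp add: X_def)
      qed
      then show "multiplicity p (fact n) \<le> multiplicity p X" unfolding e_def[symmetric] using X p
        by (intro multiplicity_geI) (auto simp: not_prime_unit)
  qed auto
next
  case True
  then show ?thesis by (simp only: dvd_0_right)
qed

section \<open>Pade approximation to the k-th root\<close>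

text \<open>The sum is the coefficient of the highest possible power in the Lagrange interpolation polynomial of \<open>p\<close> at
the nodes; that polynomial is \<open>p\<close> itself, whose degree is smaller.\<close>

lemma sum_divided_differences_eq_0:
  fixes t :: "'i \<Rightarrow> real" and p :: "real poly"
  assumes fin: "finite I" and inj: "inj_on t I" and deg: "degree p + 1 < card I"
  shows "(\<Sum>m\<in>I. poly p (t m) / (\<Prod>l\<in>I-{m}. t m - t l)) = 0"
proof -
  define N where "N m = (\<Prod>l\<in>I-{m}. [:- t l, 1:])" for m
  define q where "q = (\<Sum>m\<in>I. smult (poly p (t m) / (\<Prod>l\<in>I-{m}. t m - t l)) (N m))"
  have nz: "(\<Prod>l\<in>I-{m}. t m - t l) \<noteq> 0" if "m \<in> I" for m
    using that inj fin by (auto simp: inj_on_def)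
  have N_eval: "poly (N m) (t j) = (if j = m then (\<Prod>l\<in>I-{m}. t m - t l) else 0)"
    if "j \<in> I" "m \<in> I" for j m
    using that fin by (auto simp: N_def poly_prod)
  have degN: "degree (N m) = card I - 1" and leadN: "lead_coeff (N m) = 1" if "m \<in> I" for m
    unfolding N_def using that fin
    by (subst degree_prod_eq_sum_degree, auto simp: lead_coeff_prod)
  have "poly q x = poly p x" if "x \<in> t ` I" for x
  proof -
    obtain j where j: "j \<in> I" "x = t j" using \<open>x \<in> t ` I\<close> by auto
    have "poly q x = (\<Sum>m\<in>I. if j = m then poly p (t m) else 0)"
      unfolding q_def poly_sum poly_smult j(2)
      by (intro sum.cong refl) (use j N_eval nz in \<open>auto simp del: prod_zero_iff\<close>)
    then show ?thesis using j fin by simp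
  qed
  moreover have "degree q < card (t ` I)"
  proof -
    have "degree q \<le> card I - 1" unfolding q_def
      by (rule degree_sum_le[OF fin]) (metis degN degree_smult_le)
    then show ?thesis using deg inj by (simp add: card_image)
  qed
  moreover have "degree p < card (t ` I)" using deg inj by (simp add: card_image)
  ultimately have "q = p" by (intro poly_eqI_degree[of "t ` I"]) auto
  then have "coeff q (card I - 1) = 0" using deg by (intro coeff_eq_0) auto
  moreover have "coeff q (card I - 1) = (\<Sum>m\<in>I. poly p (t m) / (\<Prod>l\<in>I-{m}. t m - t l))"
  proof -
    have "coeff (N m) (card I - 1) = 1" if "m \<in> I" for m
      using degN[OF that] leadN[OF that] by simp
    then show ?thesis unfolding q_def coeff_sum by (intro sum.cong refl) simp
  qed
  ultimately show ?thesis by simp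
qed

text \<open>For \<open>\<sigma> = \<plusminus>1\<close> this is \<open>k^(r-i)\<close> times the binomial coefficient of \<open>r + \<sigma>/k\<close> over \<open>r - i\<close>.\<close>

definition prog_quot :: "int \<Rightarrow> nat \<Rightarrow> nat \<Rightarrow> nat \<Rightarrow> real" where
  "prog_quot \<sigma> k r i = (\<Prod>l\<in>{i<..r}. real k * real l + of_int \<sigma>) / fact (r - i)"

text \<open>Take the \<open>2r + 2\<close> nodes \<open>ki\<close> and \<open>ki + 1\<close> with \<open>i \<le> r\<close>. Up to a common factor and a sign, the coefficients
with indices \<open>i\<close> and \<open>r - i\<close> are the reciprocals of the products of the differences of \<open>ki\<close>, respectively
\<open>ki + 1\<close>, with all other nodes. The common factor clears all denominators and leaves
coefficients that are only exponentially large in \<open>r\<close>.\<close>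

definition pade_coeff :: "nat \<Rightarrow> nat \<Rightarrow> nat \<Rightarrow> real" where
  "pade_coeff k r i = real k ^ r * prog_quot (-1) k r i * prog_quot 1 k r (r - i)"

lemma prog_quot_bounds:
  assumes "k \<ge> 2" "\<bar>\<sigma>\<bar> \<le> 1" "i \<le> r"
  shows "0 < prog_quot \<sigma> k r i" "prog_quot \<sigma> k r i \<le> (2 * (real k + 1)) ^ r"
    "real k ^ (r - i) * prog_quot \<sigma> k r i \<in> \<int>"
proof -
  have s: "of_int \<sigma> \<ge> (-1::real)" "of_int \<sigma> \<le> (1::real)" using assms(2) by auto
  show "0 < prog_quot \<sigma> k r i" unfolding prog_quot_def
  proof (intro divide_pos_pos prod_pos)
    fix l assume "l \<in> {i<..r}"
    then have "real k * real l \<ge> 2 * 1" using assms(1) by (intro mult_mono) auto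
    then show "0 < real k * real l + of_int \<sigma>" using s by simp
  qed auto
  have "(\<Prod>l\<in>{i<..r}. real k * real l + of_int \<sigma>) \<le> (\<Prod>l\<in>{i<..r}. (real k + 1) * real l)"
  proof (rule prod_mono, safe)
    fix l assume l: "l \<in> {i<..r}"
    then have "real k * real l \<ge> 2 * 1" using assms(1) by (intro mult_mono) auto
    then show "0 \<le> real k * real l + of_int \<sigma>" using s by simp
    show "real k * real l + of_int \<sigma> \<le> (real k + 1) * real l" using s l by (simp add: algebra_simps)
  qed
  also have "\<dots> = (real k + 1) ^ (r - i) * (\<Prod>l\<in>{i<..r}. real l)" by (simp add: prod.distrib)
  also have "(\<Prod>l\<in>{i<..r}. real l) = fact r / fact i"
  proof -
    have "{1..r} = {1..i} \<union> {i<..r}" using assms(3) by auto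
    then have "(\<Prod>l\<in>{1..r}. real l) = (\<Prod>l\<in>{1..i}. real l) * (\<Prod>l\<in>{i<..r}. real l)"
      by (metis (no_types, lifting) prod.union_disjoint finite_atLeastAtMost finite_greaterThanAtMost ivl_disj_int_two(7) ivl_disj_int_two(8))
    then show ?thesis by (simp add: fact_prod)
  qed
  finally have "prog_quot \<sigma> k r i \<le> (real k + 1) ^ (r - i) * (fact r / fact i) / fact (r - i)"
    unfolding prog_quot_def by (intro divide_right_mono) auto
  also have "\<dots> = (real k + 1) ^ (r - i) * real (r choose i)"
    using assms(3) by (simp add: binomial_fact field_simps)
  also have "\<dots> \<le> (real k + 1) ^ r * 2 ^ r"
  proof (intro mult_mono power_increasing)
    have "r choose i \<le> 2 ^ r" by (rule binomial_le_pow2)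
    then show "real (r choose i) \<le> 2 ^ r" using of_nat_mono by fastforce
  qed auto
  finally show "prog_quot \<sigma> k r i \<le> (2 * (real k + 1)) ^ r" by (simp only: power_mult_distrib mult.commute)
  have "(\<Prod>l\<in>{i<..r}. real k * real l + of_int \<sigma>) =
     real_of_int (\<Prod>j<r-i. (int k * (int i + 1) + \<sigma>) + int k * int j)"
  proof -
    have *: "{i<..r} = (\<lambda>j. j + (i+1)) ` {..<r-i}"
    proof (intro equalityI subsetI)
      fix l assume "l \<in> {i<..r}"
      then have "l = (l - (i + 1)) + (i + 1)" "l - (i + 1) \<in> {..<r-i}" by auto
      then show "l \<in> (\<lambda>j. j + (i+1)) ` {..<r-i}" by (rule image_eqI)
    qed auto
    show ?thesis unfolding *
      by (subst prod.reindex) (auto simp: inj_on_def algebra_simps)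
  qed
  then have "real k ^ (r - i) * prog_quot \<sigma> k r i =
     real_of_int (int k ^ (r - i) * (\<Prod>j<r-i. (int k * (int i + 1) + \<sigma>) + int k * int j)) / real_of_int (fact (r - i))"
    by (simp add: prog_quot_def)
  moreover have "fact (r - i) dvd int k ^ (r - i) * (\<Prod>j<r-i. (int k * (int i + 1) + \<sigma>) + int k * int j)"
    using assms by (intro fact_dvd_power_mult_progression) auto
  ultimately show "real k ^ (r - i) * prog_quot \<sigma> k r i \<in> \<int>"
    by (metis Ints_of_int of_int_div)
qed

lemma pade_coeff_Ints:
  assumes "k \<ge> 2" "i \<le> r"
  shows "pade_coeff k r i \<in> \<int>"
proof -
  have "pade_coeff k r i = (real k ^ (r - i) * prog_quot (-1) k r i) *
          (real k ^ (r - (r - i)) * prog_quot 1 k r (r - i))"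
    using assms by (simp add: pade_coeff_def power_add[symmetric])
  then show ?thesis using assms by (simp only:) (intro Ints_mult prog_quot_bounds(3), auto)
qed

lemma pade_coeff_bounds:
  assumes "k \<ge> 2" "i \<le> r"
  shows "0 < pade_coeff k r i" "pade_coeff k r i \<le> (4 * (real k + 1) ^ 3) ^ r"
proof -
  note b = prog_quot_bounds[of k "-1" i r] prog_quot_bounds[of k 1 "r - i" r]
  show "0 < pade_coeff k r i" using assms b by (simp add: pade_coeff_def)
  have "pade_coeff k r i \<le> (real k + 1) ^ r * (2 * (real k + 1)) ^ r * (2 * (real k + 1)) ^ r"
    unfolding pade_coeff_def using assms b by (intro mult_mono power_mono) (auto intro: less_imp_le)
  also have "\<dots> = (4 * (real k + 1) ^ 3) ^ r"
    by (simp add: power_mult_distrib[symmetric] power3_eq_cube algebra_simps)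
  finally show "pade_coeff k r i \<le> (4 * (real k + 1) ^ 3) ^ r" .
qed

lemma prod_punctured_differences:
  fixes g :: "real \<Rightarrow> real"
  assumes "i \<le> r"
  shows "(\<Prod>j\<in>{..r}-{i}. g (real i - real j)) =
         (\<Prod>l\<in>{0<..i}. g (real l)) * (\<Prod>l\<in>{0<..r-i}. g (- real l))"
proof -
  have split: "{..r}-{i} = {..<i} \<union> {i<..r}" using assms by auto
  have lower: "(\<Prod>j\<in>{..<i}. g (real i - real j)) = (\<Prod>l\<in>{0<..i}. g (real l))"
    by (rule prod.reindex_bij_witness[of _ "\<lambda>l. i - l" "\<lambda>j. i - j"]) (simp_all add: of_nat_diff)
  have upper: "(\<Prod>j\<in>{i<..r}. g (real i - real j)) = (\<Prod>l\<in>{0<..r-i}. g (- real l))"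
    using assms
    by (intro prod.reindex_bij_witness[of _ "\<lambda>l. l + i" "\<lambda>j. j - i"]) (simp_all add: of_nat_diff le_diff_conv2)
  have disj: "{..<i} \<inter> {i<..r} = {}" by auto
  show ?thesis unfolding split
    by (subst prod.union_disjoint[OF _ _ disj]) (simp_all only: lower upper finite_lessThan finite_greaterThanAtMost)
qed

definition prog_prod :: "int \<Rightarrow> nat \<Rightarrow> nat \<Rightarrow> real" where
  "prog_prod \<sigma> k i = (\<Prod>l\<in>{0<..i}. real k * real l + of_int \<sigma>)"

lemma prog_prod_pos:
  assumes "k \<ge> 2" "\<bar>\<sigma>\<bar> \<le> 1"
  shows "prog_prod \<sigma> k i > 0"
  unfolding prog_prod_def
proof (rule prod_pos)
  fix l assume "l \<in> {0<..i}"
  then have "real k * real l \<ge> 2 * 1" using assms(1) by (intro mult_mono) auto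
  then show "0 < real k * real l + of_int \<sigma>" using assms(2) by auto
qed

lemma prog_quot_eq:
  assumes "k \<ge> 2" "\<bar>\<sigma>\<bar> \<le> 1" "i \<le> r"
  shows "prog_quot \<sigma> k r i = prog_prod \<sigma> k r / (prog_prod \<sigma> k i * fact (r - i))"
proof -
  have "{0<..r} = {0<..i} \<union> {i<..r}" using assms(3) by auto
  then have "prog_prod \<sigma> k r = prog_prod \<sigma> k i * (\<Prod>l\<in>{i<..r}. real k * real l + of_int \<sigma>)"
    unfolding prog_prod_def by (simp only:) (rule prod.union_disjoint, auto)
  then show ?thesis using prog_prod_pos[OF assms(1,2), of i] by (simp add: prog_quot_def)
qed

text \<open>The left-hand side is the product of the differences between one node and all the other ones; the
sign \<open>\<sigma>\<close> tells whether the node is \<open>ki + 1\<close> or \<open>ki\<close>.\<close>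

lemma node_product:
  fixes k r i :: nat and \<sigma> :: int
  assumes "i \<le> r" "\<sigma> = 1 \<or> \<sigma> = -1"
  shows "(\<Prod>j\<in>{..r}-{i}. real k * (real i - real j)) * (\<Prod>j\<le>r. real k * (real i - real j) + of_int \<sigma>)
       = of_int \<sigma> * (real k ^ r * fact i * fact (r - i) * prog_prod \<sigma> k i * prog_prod (-\<sigma>) k (r - i))"
proof -
  have neg: "(\<Prod>l\<in>{0<..n}. real k * (- real l) + c) = (-1) ^ n * (\<Prod>l\<in>{0<..n}. real k * real l - c)"
    for n and c :: real
  proof -
    have "(\<Prod>l\<in>{0<..n}. real k * (- real l) + c) = (\<Prod>l\<in>{0<..n}. (-1) * (real k * real l - c))"
      by (rule prod.cong) auto
    also have "\<dots> = (-1) ^ n * (\<Prod>l\<in>{0<..n}. real k * real l - c)" by (subst prod.distrib) simp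
    finally show ?thesis .
  qed
  have fct: "(\<Prod>l\<in>{0<..n}. real k * real l) = real k ^ n * fact n" for n
  proof -
    have "{0<..n} = {1..n}" by auto
    then show ?thesis by (simp add: prod.distrib fact_prod)
  qed
  have A: "(\<Prod>j\<in>{..r}-{i}. real k * (real i - real j)) = (-1) ^ (r - i) * real k ^ r * fact i * fact (r - i)"
    using prod_punctured_differences[OF assms(1), of "\<lambda>x. real k * x"] neg[of 0 "r-i"] fct[of i] fct[of "r-i"] assms(1)
    by (simp add: power_add[symmetric] flip: mult.assoc)
  have "(\<Prod>j\<le>r. real k * (real i - real j) + of_int \<sigma>)
      = of_int \<sigma> * (\<Prod>j\<in>{..r}-{i}. real k * (real i - real j) + of_int \<sigma>)"
    using assms(1) by (subst prod.remove[of "{..r}" i]) auto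
  also have "(\<Prod>j\<in>{..r}-{i}. real k * (real i - real j) + of_int \<sigma>) =
     prog_prod \<sigma> k i * ((-1) ^ (r - i) * prog_prod (-\<sigma>) k (r - i))"
    using prod_punctured_differences[OF assms(1), of "\<lambda>x. real k * x + of_int \<sigma>"] neg[of "of_int \<sigma>" "r-i"]
    by (simp add: prog_prod_def)
  finally have B: "(\<Prod>j\<le>r. real k * (real i - real j) + of_int \<sigma>)
     = of_int \<sigma> * (prog_prod \<sigma> k i * ((-1) ^ (r - i) * prog_prod (-\<sigma>) k (r - i)))" .
  have sq: "(-1::real) ^ (r - i) * (-1) ^ (r - i) = 1" by (simp flip: power_mult_distrib)
  have gather: "s * K * a * b * (\<tau> * (P * (s * Q))) = \<tau> * (K * a * b * P * Q)"
    if "s * s = 1" for s K a b \<tau> P Q :: real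
  proof -
    have "s * K * a * b * (\<tau> * (P * (s * Q))) = (s * s) * (\<tau> * (K * a * b * P * Q))" by (simp only: mult_ac)
    then show ?thesis using that by simp
  qed
  show ?thesis unfolding A B by (rule gather[OF sq])
qed

text \<open>A divided difference over \<open>2r + 2\<close> nodes annihilates polynomials of degree at most \<open>2r\<close>.\<close>

lemma pade_orthogonality:
  fixes q :: "real poly"
  assumes k: "k \<ge> 2" and deg: "degree q \<le> 2 * r"
  shows "(\<Sum>i\<le>r. pade_coeff k r (r - i) * poly q (real (k * i + 1)) - pade_coeff k r i * poly q (real (k * i))) = 0"
proof -
  define I where "I = {..r} \<times> {0,1::nat}"
  define t where "t = (\<lambda>(i,\<delta>). real k * real i + real \<delta>)"
  define L where "L = real k ^ (2 * r) * prog_prod (-1) k r * prog_prod 1 k r"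
  have inj: "inj_on t I"
  proof (rule inj_onI, safe)
    fix i \<delta> j \<gamma> assume h: "(i,\<delta>) \<in> I" "(j,\<gamma>) \<in> I" "t (i,\<delta>) = t (j,\<gamma>)"
    then have "real (k * i + \<delta>) = real (k * j + \<gamma>)" by (simp add: t_def)
    then have *: "k * i + \<delta> = k * j + \<gamma>" by linarith
    have "\<delta> < k" "\<gamma> < k" using h k by (auto simp: I_def)
    then have "(k * i + \<delta>) mod k = \<delta>" "(k * j + \<gamma>) mod k = \<gamma>" by simp_all
    then show 1: "\<delta> = \<gamma>" using arg_cong[OF *, of "\<lambda>x. x mod k"] by (simp only:)
    show "i = j" using * k unfolding 1 by simp
  qed
  have "degree q + 1 < card I" using deg by (simp add: I_def)
  then have s0: "(\<Sum>m\<in>I. poly q (t m) / (\<Prod>l\<in>I-{m}. t m - t l)) = 0"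
    by (intro sum_divided_differences_eq_0 inj) (auto simp: I_def)
  define F where "F m = poly q (t m) / (\<Prod>l\<in>I-{m}. t m - t l)" for m
  have "(\<Sum>m\<in>I. F m) = (\<Sum>i\<le>r. \<Sum>\<delta>\<in>{0,1}. F (i, \<delta>))"
    unfolding I_def by (subst sum.cartesian_product) (simp only: case_prod_eta)
  also have "\<dots> = (\<Sum>i\<le>r. F (i,0) + F (i,1))" by simp
  finally have 0: "(\<Sum>i\<le>r. F (i,0) + F (i,1)) = 0" using s0 unfolding F_def by (rule trans[OF sym])
  have d: "(\<Prod>l\<in>I-{(i,\<delta>)}. t (i,\<delta>) - t l) =
      (\<Prod>j\<in>{..r}-{i}. real k * (real i - real j)) * (\<Prod>j\<le>r. real k * (real i - real j) + of_int (2 * int \<delta> - 1))"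
    if "i \<le> r" "\<delta> \<in> {0,1}" for i \<delta>
  proof -
    have "I - {(i,\<delta>)} = (\<lambda>j. (j, \<delta>)) ` ({..r}-{i}) \<union> (\<lambda>j. (j, 1 - \<delta>)) ` {..r}"
      using that by (auto simp: I_def)
    then have "(\<Prod>l\<in>I-{(i,\<delta>)}. t (i,\<delta>) - t l) =
       (\<Prod>l\<in>(\<lambda>j. (j, \<delta>)) ` ({..r}-{i}). t (i,\<delta>) - t l) * (\<Prod>l\<in>(\<lambda>j. (j, 1 - \<delta>)) ` {..r}. t (i,\<delta>) - t l)"
      using that(2) by (simp only:) (rule prod.union_disjoint, auto)
    also have "(\<Prod>l\<in>(\<lambda>j. (j, \<delta>)) ` ({..r}-{i}). t (i,\<delta>) - t l) =
        (\<Prod>j\<in>{..r}-{i}. real k * (real i - real j))"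
      by (subst prod.reindex) (auto simp: inj_on_def t_def right_diff_distrib)
    also have "(\<Prod>l\<in>(\<lambda>j. (j, 1 - \<delta>)) ` {..r}. t (i,\<delta>) - t l) =
        (\<Prod>j\<le>r. real k * (real i - real j) + of_int (2 * int \<delta> - 1))"
      using that(2) by (subst prod.reindex) (auto simp: inj_on_def t_def right_diff_distrib intro!: prod.cong)
    finally show ?thesis .
  qed
  note W = prog_prod_pos[OF k, of 1] prog_prod_pos[OF k, of "-1"]
  have kr: "real k ^ (2 * r) = real k ^ r * real k ^ r" by (simp add: power_add[symmetric] mult_2)
  have aux: "K * K * P * Q / (K * a * b * u * v) = K * (P / (u * b)) * (Q / (v * a))"
    if "K \<noteq> 0" "a \<noteq> 0" "b \<noteq> 0" "u \<noteq> 0" "v \<noteq> 0" for K P Q a b u v :: real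
    using that by (simp add: field_simps)
  have L0: "L / (\<Prod>l\<in>I-{(i,0)}. t (i,0) - t l) = - pade_coeff k r i" if "i \<le> r" for i
  proof -
    have "(\<Prod>l\<in>I-{(i,0)}. t (i,0) - t l) = - (real k ^ r * fact i * fact (r - i) * prog_prod (-1) k i * prog_prod 1 k (r - i))"
      using node_product[of i r "-1" k] that by (subst d) (simp_all only: insert_iff HOL.simp_thms of_nat_0 of_nat_1, simp_all)
    moreover have "L / (real k ^ r * fact i * fact (r - i) * prog_prod (-1) k i * prog_prod 1 k (r - i))
        = pade_coeff k r i"
      unfolding L_def kr pade_coeff_def using that k W[of i] W[of "r-i"]
      by (subst aux) (auto simp: prog_quot_eq)
    ultimately show ?thesis by simp
  qed
  have L1: "L / (\<Prod>l\<in>I-{(i,1)}. t (i,1) - t l) = pade_coeff k r (r - i)" if "i \<le> r" for i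
  proof -
    have "(\<Prod>l\<in>I-{(i,1)}. t (i,1) - t l) = (real k ^ r * fact i * fact (r - i) * prog_prod 1 k i * prog_prod (-1) k (r - i))"
      using node_product[of i r "1" k] that by (subst d) (simp_all only: insert_iff HOL.simp_thms of_nat_0 of_nat_1, simp_all)
    moreover have "L / (real k ^ r * fact i * fact (r - i) * prog_prod 1 k i * prog_prod (-1) k (r - i))
        = pade_coeff k r (r - i)"
    proof -
      have "real k ^ r * fact i * fact (r - i) * prog_prod 1 k i * prog_prod (-1) k (r - i)
        = real k ^ r * fact (r - i) * fact i * prog_prod (-1) k (r - i) * prog_prod 1 k i" by simp
      then show ?thesis unfolding L_def kr pade_coeff_def using that k W[of i] W[of "r-i"]
        by (simp only:) (subst aux, auto simp: prog_quot_eq)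
    qed
    ultimately show ?thesis by simp
  qed
  have "0 = L * (\<Sum>i\<le>r. F (i,0) + F (i,1))" by (simp only: 0 mult_zero_right)
  also have "\<dots> = (\<Sum>i\<le>r. poly q (t (i,0)) * (L / (\<Prod>l\<in>I-{(i,0)}. t (i,0) - t l)) + poly q (t (i,1)) * (L / (\<Prod>l\<in>I-{(i,1)}. t (i,1) - t l)))"
    unfolding sum_distrib_left F_def by (intro sum.cong refl) (simp only: distrib_left times_divide_eq_right mult.commute)
  also have "\<dots> = (\<Sum>i\<le>r. pade_coeff k r (r - i) * poly q (real (k * i + 1)) - pade_coeff k r i * poly q (real (k * i)))"
    by (intro sum.cong refl) (simp only: L0 L1 atMost_iff, simp add: t_def algebra_simps)
  finally show ?thesis by simp
qed

lemma binomial_as_poly: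
  obtains q :: "real poly" where "degree q \<le> s" "\<And>m. poly q (real m) = real (m choose s)"
proof
  define q where "q = Polynomial.smult (1 / fact s) (\<Prod>j<s. [:- real j, 1:])"
  have "degree (\<Prod>j<s. [:- real j, 1:]) \<le> sum (degree \<circ> (\<lambda>j. [:- real j, 1:])) {..<s}"
    by (rule degree_prod_sum_le) auto
  then show "degree q \<le> s" unfolding q_def by (intro order_trans[OF degree_smult_le]) simp
  show "poly q (real m) = real (m choose s)" for m
    by (simp add: q_def poly_prod binomial_gbinomial gbinomial_prod_rev atLeast0LessThan)
qed

definition pade_P :: "nat \<Rightarrow> nat \<Rightarrow> real poly" where
  "pade_P k r = (\<Sum>i\<le>r. Polynomial.monom (pade_coeff k r i) i)"

definition pade_Q :: "nat \<Rightarrow> nat \<Rightarrow> real poly" where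
  "pade_Q k r = (\<Sum>i\<le>r. Polynomial.monom (pade_coeff k r (r - i)) i)"

text \<open>This is \<open>x Q(x\<^sup>k) - P(x\<^sup>k)\<close> for the two Pade polynomials \<open>P\<close> and \<open>Q\<close> above, see
\<open>pade_remainder_eq\<close>.\<close>

definition pade_remainder :: "nat \<Rightarrow> nat \<Rightarrow> real poly" where
  "pade_remainder k r = (\<Sum>i\<le>r. Polynomial.monom (pade_coeff k r (r - i)) (k * i + 1) - Polynomial.monom (pade_coeff k r i) (k * i))"

definition pade_taylor :: "nat \<Rightarrow> nat \<Rightarrow> nat \<Rightarrow> real" where
  "pade_taylor k r s = (\<Sum>i\<le>r. pade_coeff k r (r - i) * real ((k * i + 1) choose s) - pade_coeff k r i * real ((k * i) choose s))"

lemma pade_taylor_eq_0: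
  assumes "k \<ge> 2" "s \<le> 2 * r"
  shows "pade_taylor k r s = 0"
proof -
  obtain q :: "real poly" where q: "degree q \<le> s" "\<And>m. poly q (real m) = real (m choose s)"
    using binomial_as_poly by blast
  have "degree q \<le> 2 * r" using q(1) assms(2) by simp
  from pade_orthogonality[OF assms(1) this] show ?thesis
    unfolding pade_taylor_def q(2) .
qed

lemma smult_sum_right: "Polynomial.smult c (\<Sum>i\<in>A. f i) = (\<Sum>i\<in>A. Polynomial.smult c (f i))"
  by (induction A rule: infinite_finite_induct) (auto simp: smult_add_right)

lemma pcompose_power: "pcompose (p ^ n) q = pcompose p q ^ n" for p q :: "'a :: comm_semiring_1 poly"
  by (induction n) (auto simp: pcompose_mult pcompose_1)

lemma monom_taylor_at_1:
  fixes c :: real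
  assumes "m \<le> N"
  shows "Polynomial.monom c m = (\<Sum>s\<le>N. Polynomial.smult (c * real (m choose s)) ([:-1, 1:] ^ s))"
proof -
  have "Polynomial.monom c m = Polynomial.smult c (([:-1, 1:] + 1) ^ m)"
    by (simp add: monom_altdef one_pCons)
  also have "([:-1, 1:] + 1 :: real poly) ^ m = (\<Sum>s\<le>m. of_nat (m choose s) * [:-1, 1:] ^ s)"
    by (subst binomial_ring) simp
  also have "\<dots> = (\<Sum>s\<le>N. of_nat (m choose s) * [:-1, 1:] ^ s)"
    by (rule sum.mono_neutral_left) (use assms in auto)
  finally show ?thesis
    by (simp add: smult_sum_right of_nat_poly)
qed

lemma pade_remainder_taylor:
  assumes "k \<ge> 2"
  shows "pade_remainder k r = (\<Sum>s\<in>{2*r+1..k*r+1}. Polynomial.smult (pade_taylor k r s) ([:-1, 1:] ^ s))"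
proof -
  let ?t = "\<lambda>i s. pade_coeff k r (r - i) * real ((k * i + 1) choose s) - pade_coeff k r i * real ((k * i) choose s)"
  define N where "N = k * r + 1"
  have "pade_remainder k r = (\<Sum>i\<le>r. \<Sum>s\<le>N. Polynomial.smult
     (?t i s) ([:-1, 1:] ^ s))"
    unfolding pade_remainder_def
  proof (rule sum.cong[OF refl])
    fix i assume "i \<in> {..r}"
    then have "k * i \<le> k * r" by simp
    then have le: "k * i + 1 \<le> N" "k * i \<le> N" unfolding N_def by linarith+
    show "Polynomial.monom (pade_coeff k r (r - i)) (k * i + 1) - Polynomial.monom (pade_coeff k r i) (k * i) =
      (\<Sum>s\<le>N. Polynomial.smult
     (?t i s) ([:-1, 1:] ^ s))"
      unfolding monom_taylor_at_1[OF le(1)] monom_taylor_at_1[OF le(2)]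
      by (simp only: smult_diff_left sum_subtractf)
  qed
  also have "\<dots> = (\<Sum>s\<le>N. Polynomial.smult (pade_taylor k r s) ([:-1, 1:] ^ s))"
    unfolding pade_taylor_def smult_sum by (rule sum.swap)
  also have "\<dots> = (\<Sum>s\<in>{2*r+1..N}. Polynomial.smult (pade_taylor k r s) ([:-1, 1:] ^ s))"
    by (rule sum.mono_neutral_right) (auto simp: pade_taylor_eq_0[OF assms])
  finally show ?thesis by (simp add: N_def)
qed

text \<open>The remainder vanishes to order \<open>2r + 1\<close> at \<open>1\<close>, so that \<open>P(t)/Q(t)\<close> approximates the \<open>k\<close>-th root of
\<open>t\<close> to that order near \<open>t = 1\<close>.\<close>

lemma pade_remainder_dvd:
  assumes "k \<ge> 2"
  shows "[:-1, 1:] ^ (2 * r + 1) dvd pade_remainder k r"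
  unfolding pade_remainder_taylor[OF assms]
  by (intro dvd_sum dvd_smult le_imp_power_dvd) auto

text \<open>The low Taylor coefficients vanish, and each of the others is at most exponential in \<open>r\<close>.\<close>

lemma pade_remainder_bound:
  assumes k: "k \<ge> 2" and r: "r \<ge> 1" and x: "\<bar>x - 1\<bar> \<le> 1"
  shows "\<bar>poly (pade_remainder k r) x\<bar> \<le> (32 * (real k + 1) ^ 3 * 2 ^ k) ^ r * \<bar>x - 1\<bar> ^ (2 * r + 1)"
proof -
  let ?t = "\<lambda>i s. pade_coeff k r (r - i) * real ((k * i + 1) choose s) - pade_coeff k r i * real ((k * i) choose s)"
  define M where "M = (4 * (real k + 1) ^ 3) ^ r"
  let ?u = "\<lambda>i s. M * real ((k * i + 1) choose s) + M * real ((k * i) choose s)"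
  have M0: "M \<ge> 0" by (simp add: M_def)
  have bin: "(\<Sum>s\<le>k*r+1. real (m choose s)) \<le> 2 ^ (k * r + 1)" if "m \<le> k * r + 1" for m
  proof -
    have "(\<Sum>s\<le>k*r+1. m choose s) = (\<Sum>s\<le>m. m choose s)"
      by (rule sum.mono_neutral_right) (use that in auto)
    also have "\<dots> = 2 ^ m" by (rule choose_row_sum)
    also have "\<dots> \<le> 2 ^ (k * r + 1)" using that by (intro power_increasing) auto
    finally have "real (\<Sum>s\<le>k*r+1. m choose s) \<le> real (2 ^ (k * r + 1))" by (rule of_nat_mono)
    then show ?thesis by simp
  qed
  have "\<bar>poly (pade_remainder k r) x\<bar> = \<bar>\<Sum>s\<in>{2*r+1..k*r+1}. pade_taylor k r s * (x - 1) ^ s\<bar>"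
  proof -
    have "poly [:-1, 1:] x = x - 1" by simp
    then show ?thesis unfolding pade_remainder_taylor[OF k] by (simp only: poly_sum poly_smult poly_power)
  qed
  also have "\<dots> \<le> (\<Sum>s\<in>{2*r+1..k*r+1}. \<bar>pade_taylor k r s\<bar> * \<bar>x - 1\<bar> ^ s)"
    by (rule order_trans[OF sum_abs]) (simp add: abs_mult power_abs)
  also have "\<dots> \<le> (\<Sum>s\<in>{2*r+1..k*r+1}. \<bar>pade_taylor k r s\<bar> * \<bar>x - 1\<bar> ^ (2 * r + 1))"
    using x by (intro sum_mono mult_left_mono power_decreasing) auto
  also have "\<dots> = (\<Sum>s\<in>{2*r+1..k*r+1}. \<bar>pade_taylor k r s\<bar>) * \<bar>x - 1\<bar> ^ (2 * r + 1)"
    by (simp only: sum_distrib_right)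
  also have "(\<Sum>s\<in>{2*r+1..k*r+1}. \<bar>pade_taylor k r s\<bar>) \<le> (\<Sum>s\<le>k*r+1. \<bar>pade_taylor k r s\<bar>)"
    by (rule sum_mono2) auto
  also have "\<dots> \<le> (\<Sum>s\<le>k*r+1. \<Sum>i\<le>r. ?u i s)"
  proof (rule sum_mono)
    fix s
    have "\<bar>pade_taylor k r s\<bar> \<le> (\<Sum>i\<le>r. \<bar>?t i s\<bar>)"
      unfolding pade_taylor_def by (rule sum_abs)
    also have "\<dots> \<le> (\<Sum>i\<le>r. ?u i s)"
    proof (rule sum_mono)
      fix i assume i: "i \<in> {..r}"
      note b = pade_coeff_bounds[OF k, of i r] pade_coeff_bounds[OF k, of "r - i" r]
      have "\<bar>pade_coeff k r (r - i)\<bar> \<le> M" "\<bar>pade_coeff k r i\<bar> \<le> M" using b i by (auto simp: M_def)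
      then have "\<bar>pade_coeff k r (r - i)\<bar> * real ((k * i + 1) choose s) + \<bar>pade_coeff k r i\<bar> * real ((k * i) choose s)
          \<le> ?u i s"
        by (intro add_mono mult_right_mono) auto
      then show "\<bar>?t i s\<bar>
        \<le> ?u i s"
        by (intro order_trans[OF abs_triangle_ineq4]) (simp add: abs_mult)
    qed
    finally show "\<bar>pade_taylor k r s\<bar> \<le> \<dots>" .
  qed
  also have "\<dots> = (\<Sum>i\<le>r. M * (\<Sum>s\<le>k*r+1. real ((k * i + 1) choose s)) + M * (\<Sum>s\<le>k*r+1. real ((k * i) choose s)))"
    by (subst sum.swap) (simp only: sum.distrib sum_distrib_left)
  also have "\<dots> \<le> (\<Sum>i\<le>r. M * 2 ^ (k * r + 1) + M * 2 ^ (k * r + 1))"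
    using M0 by (intro sum_mono add_mono mult_left_mono bin) (auto intro!: le_SucI mult_le_mono2)
  also have "\<dots> = 4 * real (r + 1) * (M * 2 ^ (k * r))" by simp
  also have "\<dots> \<le> (4 * 2) ^ r * (M * 2 ^ (k * r))"
  proof (rule mult_right_mono)
    have "r + 1 \<le> 2 ^ r" by (metis Suc_eq_plus1 Suc_leI less_exp)
    then have "real (r + 1) \<le> 2 ^ r" by (metis of_nat_mono of_nat_numeral of_nat_power)
    moreover have "(4::real) ^ 1 \<le> 4 ^ r" using r by (intro power_increasing) auto
    ultimately show "4 * real (r + 1) \<le> (4 * 2) ^ r"
      unfolding power_mult_distrib by (intro mult_mono) auto
  qed (use M0 in simp)
  also have "\<dots> = (32 * (real k + 1) ^ 3 * 2 ^ k) ^ r"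
    unfolding M_def power_mult power_mult_distrib[symmetric] by (rule arg_cong[where f="\<lambda>x. x ^ r"]) simp
  finally show ?thesis by (simp add: mult_right_mono)
qed

lemma pade_degrees:
  assumes "k \<ge> 2"
  shows "degree (pade_P k r) = r" "lead_coeff (pade_P k r) = pade_coeff k r r"
    "degree (pade_Q k r) = r" "lead_coeff (pade_Q k r) = pade_coeff k r 0"
proof -
  have cP: "coeff (pade_P k r) i = (if i \<le> r then pade_coeff k r i else 0)" for i
    by (simp add: pade_P_def coeff_sum)
  have cQ: "coeff (pade_Q k r) i = (if i \<le> r then pade_coeff k r (r - i) else 0)" for i
    by (simp add: pade_Q_def coeff_sum)
  have "pade_coeff k r r > 0" "pade_coeff k r 0 > 0" using pade_coeff_bounds[OF assms] by auto
  then show dP: "degree (pade_P k r) = r" and dQ: "degree (pade_Q k r) = r"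
    by (auto intro!: antisym degree_le le_degree simp: cP cQ)
  show "lead_coeff (pade_P k r) = pade_coeff k r r" "lead_coeff (pade_Q k r) = pade_coeff k r 0"
    by (simp_all add: dP dQ cP cQ)
qed

text \<open>This determinant decides whether two consecutive approximants can agree.\<close>

definition pade_det :: "nat \<Rightarrow> nat \<Rightarrow> real poly" where
  "pade_det k r = pade_P k r * pade_Q k (Suc r) - pade_P k (Suc r) * pade_Q k r"

lemma pade_remainder_eq:
  "pade_remainder k r = Polynomial.monom 1 1 * pcompose (pade_Q k r) (Polynomial.monom 1 k) - pcompose (pade_P k r) (Polynomial.monom 1 k)"
proof -
  have c: "pcompose (Polynomial.monom c i) (Polynomial.monom 1 k) = Polynomial.monom (c::real) (k * i)" for c i
    by (induction i) (simp_all add: monom_Suc monom_0 pcompose_pCons mult_monom add.commute)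
  show ?thesis
    by (simp add: pade_remainder_def pade_P_def pade_Q_def pcompose_sum c sum_subtractf sum_distrib_left mult_monom)
qed

text \<open>Substituting \<open>P(x\<^sup>k) = x Q(x\<^sup>k) - \<close> remainder cancels the product of the two \<open>Q\<close>'s, and every term
left contains a remainder.\<close>

lemma pade_det_dvd:
  assumes "k \<ge> 2"
  shows "[:-1, 1:] ^ (2 * r + 1) dvd pcompose (pade_det k r) (Polynomial.monom 1 k)"
proof -
  define X :: "real poly" where "X = Polynomial.monom 1 k"
  define x :: "real poly" where "x = Polynomial.monom 1 1"
  have P: "pcompose (pade_P k s) X = x * pcompose (pade_Q k s) X - pade_remainder k s" for s
    by (simp add: pade_remainder_eq X_def x_def)
  have "pcompose (pade_det k r) X = pade_remainder k (Suc r) * pcompose (pade_Q k r) X - pade_remainder k r * pcompose (pade_Q k (Suc r)) X"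
    by (simp add: pade_det_def pcompose_diff pcompose_mult P algebra_simps)
  moreover have "[:-1, 1:] ^ (2 * r + 1) dvd pade_remainder k (Suc r)"
    by (rule dvd_trans[OF le_imp_power_dvd pade_remainder_dvd[OF assms]]) simp
  ultimately show ?thesis using pade_remainder_dvd[OF assms, of r]
    by (simp add: X_def dvd_diff)
qed

text \<open>The leading coefficients of the two products have the ratio \<open>(k(r+1) - 1) / (k(r+1) + 1) \<noteq> 1\<close>, so they do
not cancel.\<close>

lemma pade_det_coeff:
  assumes k: "k \<ge> 2"
  shows "coeff (pade_det k r) (2 * r + 1) \<noteq> 0" "degree (pade_det k r) \<le> 2 * r + 1"
proof -
  note d = pade_degrees[OF k]
  have c1: "coeff (pade_P k r * pade_Q k (Suc r)) (2 * r + 1) = pade_coeff k r r * pade_coeff k (Suc r) 0"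
    using coeff_mult_degree_sum[of "pade_P k r" "pade_Q k (Suc r)"] d by (simp add: mult_2)
  have c2: "coeff (pade_P k (Suc r) * pade_Q k r) (2 * r + 1) = pade_coeff k (Suc r) (Suc r) * pade_coeff k r 0"
    using coeff_mult_degree_sum[of "pade_P k (Suc r)" "pade_Q k r"] d by (simp add: mult_2)
  have rec: "prog_quot \<sigma> k (Suc r) 0 = prog_quot \<sigma> k r 0 * (real k * real (Suc r) + of_int \<sigma>) / real (Suc r)" for \<sigma>
  proof -
    have "{0<..Suc r} = insert (Suc r) {0<..r}" by auto
    then show ?thesis by (simp add: prog_quot_def field_simps)
  qed
  have full: "prog_quot \<sigma> k s s = 1" for \<sigma> s by (simp add: prog_quot_def)
  have "coeff (pade_det k r) (2 * r + 1) = real k ^ r * real k ^ Suc r *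
     (prog_quot 1 k r 0 * prog_quot (-1) k (Suc r) 0 - prog_quot 1 k (Suc r) 0 * prog_quot (-1) k r 0)"
    unfolding pade_det_def coeff_diff c1 c2 by (simp add: pade_coeff_def full algebra_simps)
  also have "prog_quot 1 k r 0 * prog_quot (-1) k (Suc r) 0 - prog_quot 1 k (Suc r) 0 * prog_quot (-1) k r 0 =
     - 2 * prog_quot 1 k r 0 * prog_quot (-1) k r 0 / real (Suc r)"
  proof -
    have "a * (b * (c + - 1) / N) - a * (c + 1) / N * b = - 2 * a * b / N" for a b c N :: real
      by (simp add: algebra_simps add_divide_distrib diff_divide_distrib)
    then show ?thesis unfolding rec by simp
  qed
  finally have "coeff (pade_det k r) (2 * r + 1) = real k ^ r * real k ^ Suc r * (- 2 * prog_quot 1 k r 0 * prog_quot (-1) k r 0 / real (Suc r))" .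
  moreover have "prog_quot 1 k r 0 > 0" "prog_quot (-1) k r 0 > 0"
    using prog_quot_bounds(1)[OF k, of 1 0 r] prog_quot_bounds(1)[OF k, of "-1" 0 r] by auto
  ultimately show "coeff (pade_det k r) (2 * r + 1) \<noteq> 0" using k by simp
  show "degree (pade_det k r) \<le> 2 * r + 1" unfolding pade_det_def
    by (intro degree_diff_le order_trans[OF degree_mult_le]) (simp_all add: d)
qed

text \<open>Since \<open>x\<^sup>k - 1\<close> has a simple zero at \<open>1\<close>, substituting \<open>x\<^sup>k\<close> preserves the order of vanishing there.\<close>

lemma order_1_pcompose_power:
  fixes D :: "real poly"
  assumes "D \<noteq> 0" "k \<ge> 1" "[:-1, 1:] ^ n dvd pcompose D (Polynomial.monom 1 k)"
  shows "[:-1, 1:] ^ n dvd D"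
proof -
  define s where "s = Polynomial.order 1 D"
  obtain E where E: "D = [:-1, 1:] ^ s * E" "\<not> [:-1, 1:] dvd E"
    using order_decomp[OF assms(1), of 1] by (auto simp: s_def)
  define X :: "real poly" where "X = Polynomial.monom 1 k"
  define G :: "real poly" where "G = (\<Sum>i<k. Polynomial.monom 1 i)"
  have X1: "X - 1 = [:-1, 1:] * G"
  proof -
    have "[:0,1:] ^ k - 1 = ([:0, 1:] - 1) * (\<Sum>i<k. [:0, 1::real:] ^ i)"
      by (rule power_diff_1_eq)
    then show ?thesis by (simp add: X_def G_def monom_altdef one_pCons)
  qed
  have X2: "pcompose [:-1, 1:] X = X - 1" by (simp add: pcompose_pCons one_pCons)
  have c: "pcompose D X = [:-1, 1:] ^ s * (G ^ s * pcompose E X)"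
    unfolding E(1) pcompose_mult pcompose_power X2 X1 power_mult_distrib by (simp only: mult.assoc)
  have "poly (G ^ s * pcompose E X) 1 \<noteq> 0"
    using E(2) assms(2) by (simp add: G_def X_def poly_sum poly_monom poly_pcompose dvd_iff_poly_eq_0)
  then have nz: "G ^ s * pcompose E X \<noteq> 0" "Polynomial.order 1 (G ^ s * pcompose E X) = 0"
    by (auto simp: order_0I)
  then have "Polynomial.order 1 (pcompose D X) = s" unfolding c
    by (subst order_mult) (auto simp: order_power_n_n)
  moreover have "pcompose D X \<noteq> 0" using nz unfolding c by simp
  ultimately have "n \<le> s" using assms(3) unfolding X_def by (simp add: order_divides)
  then show ?thesis unfolding E(1) by (meson dvd_mult2 le_imp_power_dvd)
qed

text \<open>By its degree and its order of vanishing at \<open>1\<close> the determinant is a nonzero multiple of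
\<open>(t - 1)^(2r+1)\<close>.\<close>

lemma pade_det_nonzero:
  assumes k: "k \<ge> 2" and t: "t \<noteq> 1"
  shows "poly (pade_det k r) t \<noteq> 0"
proof -
  have nz: "pade_det k r \<noteq> 0" using pade_det_coeff(1)[OF k, of r] by auto
  have "[:-1, 1:] ^ (2 * r + 1) dvd pade_det k r"
    using order_1_pcompose_power[OF nz _ pade_det_dvd[OF k]] k by simp
  then obtain E where E: "pade_det k r = [:-1, 1:] ^ (2 * r + 1) * E" by (auto simp: dvd_def)
  have "E \<noteq> 0" using nz E by auto
  then have "degree (pade_det k r) = 2 * r + 1 + degree E"
  proof -
    have "degree ([:-1, 1::real:] ^ n) = n" for n by (simp add: degree_power_eq)
    then show ?thesis using \<open>E \<noteq> 0\<close> unfolding E by (subst degree_mult_eq) (simp_all only: power_eq_0_iff, auto)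
  qed
  then have "degree E = 0" using pade_det_coeff(2)[OF k, of r] by simp
  then obtain c where "E = [:c:]" "c \<noteq> 0" using \<open>E \<noteq> 0\<close> by (metis degree_0_id of_nat_0 pCons_eq_0_iff degree_eq_zeroE)
  then show ?thesis using t by (simp add: E)
qed

section \<open>An effective irrationality measure\<close>

text \<open>For equal signs \<open>u\<^sup>k - v\<^sup>k\<close> is \<open>u - v\<close> times a sum of terms of one sign that contains \<open>u^(k-1)\<close>. For opposite
signs and odd \<open>k\<close> nothing cancels in \<open>u\<^sup>k - v\<^sup>k\<close>, and \<open>|u - v| \<le> 2 max |u| |v|\<close>.\<close>

lemma abs_diff_mult_power_le:
  fixes u v :: real
  assumes "k \<ge> 1" "odd k \<or> (u \<ge> 0 \<and> v \<ge> 0)"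
  shows "\<bar>u - v\<bar> * \<bar>u\<bar> ^ (k - 1) \<le> 2 * \<bar>u ^ k - v ^ k\<bar>"
proof -
  have nonneg: "\<bar>u - v\<bar> * u ^ (k - 1) \<le> \<bar>u ^ k - v ^ k\<bar>" if "u \<ge> 0" "v \<ge> 0" for u v :: real
  proof -
    obtain j where j: "k = Suc j" using assms(1) by (cases k) auto
    have "u ^ j * v ^ (j - j) \<le> (\<Sum>i\<in>{..j}. u ^ i * v ^ (j - i))"
      using that by (intro member_le_sum) auto
    moreover have "u ^ k - v ^ k = (u - v) * (\<Sum>i\<in>{..j}. u ^ i * v ^ (j - i))"
      unfolding j by (subst diff_power_eq_sum) (simp add: lessThan_Suc_atMost)
    moreover have "0 \<le> (\<Sum>i\<in>{..j}. u ^ i * v ^ (j - i))" using that by (intro sum_nonneg) auto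
    ultimately show ?thesis by (simp add: abs_mult j mult_left_mono)
  qed
  have opp: "\<bar>u - v\<bar> * \<bar>u\<bar> ^ (k - 1) \<le> 2 * \<bar>u ^ k - v ^ k\<bar>" if "odd k" "u * v \<le> 0" for u v :: real
  proof -
    define M where "M = max \<bar>u\<bar> \<bar>v\<bar>"
    have "\<bar>u - v\<bar> * \<bar>u\<bar> ^ (k - 1) \<le> (2 * M) * M ^ (k - 1)"
      by (intro mult_mono power_mono) (auto simp: M_def)
    also have "\<dots> = 2 * M ^ k" using assms(1) by (cases k) auto
    also have "M ^ k \<le> \<bar>u\<bar> ^ k + \<bar>v\<bar> ^ k" by (auto simp: M_def max_def)
    also have "\<bar>u\<bar> ^ k + \<bar>v\<bar> ^ k = \<bar>u ^ k - v ^ k\<bar>"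
    proof -
      have "u ^ k * v ^ k \<le> 0" using that by (simp add: power_mult_distrib[symmetric] power_le_zero_eq odd_pos)
      moreover have "\<bar>a\<bar> + \<bar>b\<bar> = \<bar>a - b\<bar>" if "a * b \<le> 0" for a b :: real
        using that by (auto simp: mult_le_0_iff)
      ultimately show ?thesis by (simp only: power_abs[symmetric])
    qed
    finally show ?thesis by simp
  qed
  show ?thesis
  proof (cases "u \<ge> 0 \<and> v \<ge> 0")
    case True
    then have "\<bar>u - v\<bar> * u ^ (k - 1) \<le> \<bar>u ^ k - v ^ k\<bar>" and u: "\<bar>u\<bar> = u" using nonneg by auto
    from this(1) show ?thesis unfolding u by (rule order_trans) simp
  next
    case False
    then have odd: "odd k" using assms(2) by auto
    show ?thesis
    proof (cases "u * v \<le> 0")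
      case True
      then show ?thesis using opp odd by blast
    next
      case neg: False
      then have "u \<le> 0" "v \<le> 0" using False by (auto simp: not_le zero_less_mult_iff)
      then have "\<bar>- u - (- v)\<bar> * (- u) ^ (k - 1) \<le> \<bar>(- u) ^ k - (- v) ^ k\<bar>" by (intro nonneg) auto
      moreover have "\<bar>- u - (- v)\<bar> = \<bar>u - v\<bar>" "\<bar>(- u) ^ k - (- v) ^ k\<bar> = \<bar>u ^ k - v ^ k\<bar>" "- u = \<bar>u\<bar>"
        using odd \<open>u \<le> 0\<close> by auto
      ultimately have "\<bar>u - v\<bar> * \<bar>u\<bar> ^ (k - 1) \<le> \<bar>u ^ k - v ^ k\<bar>" by (simp only:)
      then show ?thesis by (rule order_trans) simp
    qed
  qed
qed

definition pade_E1 :: "nat \<Rightarrow> real" where "pade_E1 k = 16 * (real k + 1) ^ 3"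
definition pade_E2 :: "nat \<Rightarrow> real" where "pade_E2 k = 32 * (real k + 1) ^ 3 * 2 ^ k"

lemma pade_E_ge: "pade_E1 k \<ge> 16" "pade_E2 k \<ge> 32"
proof -
  have *: "1 \<le> (real k + 1) ^ 3" by (rule one_le_power) simp
  then show "pade_E1 k \<ge> 16" by (simp add: pade_E1_def)
  have "1 * 1 \<le> (real k + 1) ^ 3 * 2 ^ k" using * by (intro mult_mono) auto
  then show "pade_E2 k \<ge> 32" by (simp add: pade_E2_def)
qed

definition pade_num :: "nat \<Rightarrow> real \<Rightarrow> real \<Rightarrow> nat \<Rightarrow> real" where
  "pade_num k P Q r = Q ^ r * poly (pade_P k r) (P / Q)"
definition pade_den :: "nat \<Rightarrow> real \<Rightarrow> real \<Rightarrow> nat \<Rightarrow> real" where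
  "pade_den k P Q r = Q ^ r * poly (pade_Q k r) (P / Q)"

lemma scaled_poly_sum:
  fixes P Q :: real
  assumes "Q > 0"
  shows "Q ^ r * poly (\<Sum>i\<le>r. Polynomial.monom (c i) i) (P / Q) = (\<Sum>i\<le>r. c i * P ^ i * Q ^ (r - i))"
proof -
  have "Q ^ r * (c i * (P / Q) ^ i) = c i * P ^ i * Q ^ (r - i)" if "i \<le> r" for i
  proof -
    have "Q ^ r = Q ^ i * Q ^ (r - i)" using that by (simp flip: power_add)
    then show ?thesis using assms by (simp add: power_divide)
  qed
  then show ?thesis unfolding poly_sum poly_monom sum_distrib_left by (intro sum.cong refl) auto
qed

lemma pade_values_Ints:
  fixes P Q :: int
  assumes "k \<ge> 2" "Q > 0"
  shows "pade_num k P Q r \<in> \<int>" "pade_den k P Q r \<in> \<int>"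
  using assms unfolding pade_num_def pade_den_def pade_P_def pade_Q_def
  by (auto simp: scaled_poly_sum intro!: Ints_sum Ints_mult Ints_power pade_coeff_Ints)

lemma pade_den_bounds:
  fixes P Q :: real
  assumes "k \<ge> 2" "Q > 0" "P > 0" "P \<le> 2 * Q"
  shows "0 \<le> pade_den k P Q r" "pade_den k P Q r \<le> (pade_E1 k * Q) ^ r"
proof -
  have eq: "pade_den k P Q r = (\<Sum>i\<le>r. pade_coeff k r (r - i) * P ^ i * Q ^ (r - i))"
    unfolding pade_den_def pade_Q_def by (rule scaled_poly_sum[OF assms(2)])
  have b: "0 < pade_coeff k r (r - i)" "pade_coeff k r (r - i) \<le> (4 * (real k + 1) ^ 3) ^ r" for i
    using pade_coeff_bounds[OF assms(1), of "r - i" r] by auto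
  show "0 \<le> pade_den k P Q r" unfolding eq using b assms by (intro sum_nonneg mult_nonneg_nonneg) (auto intro: less_imp_le)
  have "pade_den k P Q r \<le> (\<Sum>i\<le>r. (4 * (real k + 1) ^ 3) ^ r * (2 * Q) ^ i * (2 * Q) ^ (r - i))"
    unfolding eq using b assms by (intro sum_mono mult_mono power_mono) (auto intro: less_imp_le)
  also have "\<dots> = (\<Sum>i\<le>r. (4 * (real k + 1) ^ 3) ^ r * (2 * Q) ^ r)"
    by (intro sum.cong refl) (simp only: mult.assoc power_add[symmetric] atMost_iff le_add_diff_inverse)
  also have "\<dots> = real (r + 1) * ((4 * (real k + 1) ^ 3) ^ r * (2 * Q) ^ r)" by simp
  also have "\<dots> \<le> 2 ^ r * ((4 * (real k + 1) ^ 3) ^ r * (2 * Q) ^ r)"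
  proof (rule mult_right_mono)
    have "r + 1 \<le> 2 ^ r" by (metis Suc_eq_plus1 Suc_leI less_exp)
    then show "real (r + 1) \<le> 2 ^ r" by (metis of_nat_mono of_nat_numeral of_nat_power)
  qed (use assms in simp)
  also have "\<dots> = (pade_E1 k * Q) ^ r"
    unfolding pade_E1_def power_mult_distrib[symmetric] by (rule arg_cong[where f="\<lambda>x. x ^ r"]) simp
  finally show "pade_den k P Q r \<le> (pade_E1 k * Q) ^ r" .
qed

text \<open>The remainder at \<open>\<theta>\<close> is of order \<open>|\<theta> - 1|^(2r+1)\<close>, and \<open>|\<theta> - 1| \<le> |P - Q| / Q\<close>.\<close>

lemma pade_approximation:
  fixes P Q \<theta> T :: real
  assumes k: "k \<ge> 2" and Q: "Q > 0" and \<theta>: "\<theta> > 0" "\<theta> ^ k = P / Q" and T: "\<bar>P - Q\<bar> \<le> T" "T \<le> Q"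
    and r: "r \<ge> 1"
  shows "\<bar>pade_den k P Q r * \<theta> - pade_num k P Q r\<bar> \<le> (pade_E2 k * T\<^sup>2 / Q) ^ r"
proof -
  have "\<bar>\<theta> - 1\<bar> \<le> \<bar>\<theta> ^ k - 1\<bar>"
  proof -
    have "\<theta> ^ k - 1 = (\<theta> - 1) * (\<Sum>i<k. \<theta> ^ i)" by (rule power_diff_1_eq)
    moreover have "(\<Sum>i<k. \<theta> ^ i) \<ge> 1"
    proof -
      have "\<theta> ^ 0 \<le> (\<Sum>i<k. \<theta> ^ i)" using \<theta> k by (intro member_le_sum) auto
      then show ?thesis by simp
    qed
    ultimately show ?thesis by (simp add: abs_mult mult_le_cancel_left1 mult_left_mono)
  qed
  also have "\<theta> ^ k - 1 = (P - Q) / Q" using Q \<theta> by (simp add: field_simps)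
  also have "\<bar>(P - Q) / Q\<bar> = \<bar>P - Q\<bar> / Q" using Q by simp
  also have "\<dots> \<le> T / Q" using T Q by (intro divide_right_mono) auto
  finally have d: "\<bar>\<theta> - 1\<bar> \<le> T / Q" .
  have TQ: "T / Q \<le> 1" "T / Q \<ge> 0" using T Q by auto
  have d1: "\<bar>\<theta> - 1\<bar> \<le> 1" using d TQ by linarith
  have "pade_den k P Q r * \<theta> - pade_num k P Q r = Q ^ r * poly (pade_remainder k r) \<theta>"
    by (simp add: pade_remainder_eq pade_den_def pade_num_def poly_pcompose poly_monom \<theta>(2) algebra_simps)
  then have "\<bar>pade_den k P Q r * \<theta> - pade_num k P Q r\<bar> = Q ^ r * \<bar>poly (pade_remainder k r) \<theta>\<bar>"
    using Q by (simp add: abs_mult)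
  also have "\<dots> \<le> Q ^ r * (pade_E2 k ^ r * \<bar>\<theta> - 1\<bar> ^ (2 * r + 1))"
    unfolding pade_E2_def using Q d1 by (intro mult_left_mono pade_remainder_bound k r) auto
  also have "\<dots> \<le> Q ^ r * (pade_E2 k ^ r * (T / Q) ^ (2 * r))"
  proof -
    have "\<bar>\<theta> - 1\<bar> ^ (2 * r + 1) \<le> \<bar>\<theta> - 1\<bar> ^ (2 * r)" using d1 by (intro power_decreasing) auto
    also have "\<dots> \<le> (T / Q) ^ (2 * r)" using d by (intro power_mono) auto
    finally show ?thesis using Q by (intro mult_left_mono) (auto simp: pade_E2_def)
  qed
  also have "\<dots> = (Q * (pade_E2 k * (T / Q)\<^sup>2)) ^ r"
    by (simp add: power_mult power_mult_distrib)
  also have "Q * (pade_E2 k * (T / Q)\<^sup>2) = pade_E2 k * T\<^sup>2 / Q"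
    using Q by (simp add: power2_eq_square field_simps)
  finally show ?thesis .
qed

text \<open>A fraction \<open>X/Y\<close> is compared with the approximants of index \<open>r\<close> and \<open>r + 1\<close>, where \<open>r\<close> is
minimal such that these approximate \<open>\<theta>\<close> well on the scale of \<open>1/Y\<close>. By the determinant above one of the
two differs from \<open>X/Y\<close>, hence by at least the reciprocal of the product of the denominators.
The hypothesis on \<open>Q\<close> makes the denominators grow at most like \<open>V^(3r/2)\<close> while the error decays like
\<open>V^(-r)\<close>, where \<open>V = Q / (pade_E2 k T\<^sup>2)\<close>; this is an irrationality exponent of at most \<open>5/2\<close>.\<close>

lemma effective_irrationality:
  fixes P Q X Y :: int and \<theta> T :: real
  assumes k: "k \<ge> 2" and pos: "P > 0" "Q > 0" "X > 0" "Y > 0" and ne: "P \<noteq> Q" and P2: "P \<le> 2 * Q"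
    and \<theta>: "\<theta> > 0" "\<theta> ^ k = P / Q" and T: "\<bar>P - Q\<bar> \<le> T"
    and big: "pade_E1 k ^ 2 * pade_E2 k ^ 3 * T ^ 6 \<le> Q"
  shows "1 \<le> 32 * (pade_E1 k * Q) ^ 4 * Y ^ 3 * (X - \<theta> * Y)\<^sup>2"
proof -
  define q where "q = pade_den k (real_of_int P) (real_of_int Q)"
  define p where "p = pade_num k (real_of_int P) (real_of_int Q)"
  define V where "V = Q / (pade_E2 k * T\<^sup>2)"
  define U where "U = pade_E1 k * Q"
  have T1: "T \<ge> 1" using T ne by linarith
  note E = pade_E_ge[of k]
  have U: "U \<ge> 16" unfolding U_def using E pos mult_mono[of 16 "pade_E1 k" 1 "real_of_int Q"] by simp
  have TQ: "T \<le> Q"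
  proof -
    have "1 * 1 * T ^ 1 \<le> pade_E1 k ^ 2 * pade_E2 k ^ 3 * T ^ 6"
      using E T1 by (intro mult_mono power_increasing one_le_power) auto
    then show ?thesis using big by simp
  qed
  have UV: "U\<^sup>2 \<le> V ^ 3"
  proof -
    have "U\<^sup>2 * (pade_E2 k * T\<^sup>2) ^ 3 = (pade_E1 k ^ 2 * pade_E2 k ^ 3 * T ^ 6) * real_of_int Q ^ 2"
      by (simp add: U_def power_mult_distrib flip: power_mult)
    also have "\<dots> \<le> real_of_int Q * real_of_int Q ^ 2" using big pos by (intro mult_right_mono) auto
    also have "\<dots> = real_of_int Q ^ 3" by (simp add: power3_eq_cube power2_eq_square)
    finally show ?thesis using E T1 unfolding V_def by (simp add: power_divide pos_le_divide_eq)
  qed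
  have V: "V > 2"
  proof (rule ccontr)
    assume "\<not> V > 2"
    moreover have "V \<ge> 0" using E T1 pos by (auto simp: V_def)
    ultimately have "V ^ 3 \<le> 2 ^ 3" by (intro power_mono) auto
    moreover have "16\<^sup>2 \<le> U\<^sup>2" using U by (intro power_mono) auto
    ultimately show False using UV by simp
  qed
  obtain N where N: "2 * real_of_int Y < V ^ N" using real_arch_pow[of V "2 * Y"] V by auto
  define r where "r = (LEAST r. 2 * real_of_int Y < V ^ r)"
  have r: "2 * real_of_int Y < V ^ r" unfolding r_def using N by (rule LeastI)
  have r1: "r \<ge> 1" using r pos by (cases r) auto
  have r': "V ^ (r - 1) \<le> 2 * Y"
  proof -
    have "r - 1 < r" using r1 by simp
    then have "\<not> 2 * real_of_int Y < V ^ (r - 1)" unfolding r_def by (rule not_less_Least)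
    then show ?thesis by simp
  qed
  have "\<exists>s\<in>{r, Suc r}. q s * X \<noteq> p s * Y"
  proof (rule ccontr)
    assume "\<not> ?thesis"
    then have e: "q r * X = p r * Y" "q (Suc r) * X = p (Suc r) * Y" by auto
    have "(p r * q (Suc r) - p (Suc r) * q r) * Y = q (Suc r) * (p r * Y) - q r * (p (Suc r) * Y)"
      by (simp add: algebra_simps)
    also have "\<dots> = 0" unfolding e[symmetric] by (simp only: mult.left_commute diff_self)
    finally have "(p r * q (Suc r) - p (Suc r) * q r) * Y = 0" .
    moreover have "p r * q (Suc r) - p (Suc r) * q r = Q ^ (2 * r + 1) * poly (pade_det k r) (P / Q)"
    proof -
      have "real_of_int Q ^ (2 * r + 1) = real_of_int Q ^ r * real_of_int Q ^ Suc r" by (simp add: mult_2 power_add)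
      then show ?thesis unfolding p_def q_def pade_num_def pade_den_def pade_det_def poly_diff poly_mult
        by (simp only: right_diff_distrib) (simp only: of_int_power mult_ac)
    qed
    moreover have "poly (pade_det k r) (P / Q) \<noteq> 0"
      using ne pos by (intro pade_det_nonzero k) auto
    ultimately show False using pos by simp
  qed
  then obtain s where s: "s = r \<or> s = Suc r" "q s * X \<noteq> p s * Y" by auto
  have "q s * X - p s * Y \<in> \<int>" unfolding q_def p_def
    using pade_values_Ints[OF k, of Q P s] pos by (intro Ints_diff Ints_mult) auto
  then have "1 \<le> \<bar>q s * X - p s * Y\<bar>" using s(2) by (intro Ints_nonzero_abs_ge1) auto
  also have "q s * X - p s * Y = q s * (X - \<theta> * Y) + Y * (q s * \<theta> - p s)" by (simp add: algebra_simps)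
  also have "\<bar>\<dots>\<bar> \<le> q s * \<bar>X - \<theta> * Y\<bar> + Y * \<bar>q s * \<theta> - p s\<bar>"
  proof -
    have "q s \<ge> 0" unfolding q_def using pos P2 by (intro pade_den_bounds(1) k) auto
    then show ?thesis using pos by (intro order_trans[OF abs_triangle_ineq]) (simp add: abs_mult)
  qed
  also have "\<dots> \<le> U ^ Suc r * \<bar>X - \<theta> * Y\<bar> + 1 / 2"
  proof (rule add_mono)
    have "q s \<le> U ^ s" unfolding q_def U_def using pos P2 by (intro pade_den_bounds(2) k) auto
    also have "\<dots> \<le> U ^ Suc r" using s(1) U by (intro power_increasing) auto
    finally show "q s * \<bar>X - \<theta> * Y\<bar> \<le> U ^ Suc r * \<bar>X - \<theta> * Y\<bar>" by (rule mult_right_mono) simp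
    have "\<bar>q s * \<theta> - p s\<bar> \<le> (pade_E2 k * T\<^sup>2 / Q) ^ s"
      unfolding q_def p_def using pos T \<theta> TQ s r1 by (intro pade_approximation k) auto
    also have "pade_E2 k * T\<^sup>2 / Q = 1 / V" by (simp add: V_def)
    also have "(1 / V) ^ s \<le> (1 / V) ^ r" using V s(1) by (intro power_decreasing) auto
    finally have "Y * \<bar>q s * \<theta> - p s\<bar> \<le> Y * (1 / V) ^ r" using pos by (intro mult_left_mono) auto
    also have "\<dots> \<le> 1 / 2" using r V by (simp add: power_divide field_simps)
    finally show "Y * \<bar>q s * \<theta> - p s\<bar> \<le> 1 / 2" .
  qed
  finally have h: "1 \<le> 2 * U ^ Suc r * \<bar>X - \<theta> * Y\<bar>" by simp
  have "1 \<le> (2 * U ^ Suc r * \<bar>X - \<theta> * Y\<bar>)\<^sup>2" using h by (rule one_le_power)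
  also have "\<dots> = 4 * (U\<^sup>2 * U\<^sup>2) * (U\<^sup>2) ^ (r - 1) * (X - \<theta> * Y)\<^sup>2"
  proof -
    have "U ^ Suc r = U\<^sup>2 * U ^ (r - 1)" using r1 by (cases r) (auto simp: power2_eq_square)
    moreover have "(2 * (A * B) * C)\<^sup>2 = 4 * (A * A) * B\<^sup>2 * C\<^sup>2" for A B C :: real
      by (simp add: power2_eq_square)
    moreover have "(U ^ (r - 1))\<^sup>2 = (U\<^sup>2) ^ (r - 1)" by (simp only: power_mult[symmetric] mult.commute)
    ultimately show ?thesis by (simp only: power2_abs)
  qed
  also have "\<dots> \<le> 4 * (U\<^sup>2 * U\<^sup>2) * (V ^ 3) ^ (r - 1) * (X - \<theta> * Y)\<^sup>2"
    using UV by (intro mult_right_mono mult_left_mono power_mono) auto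
  also have "(V ^ 3) ^ (r - 1) = (V ^ (r - 1)) ^ 3" by (simp add: mult.commute flip: power_mult)
  also have "4 * (U\<^sup>2 * U\<^sup>2) * (V ^ (r - 1)) ^ 3 * (X - \<theta> * Y)\<^sup>2 \<le> 4 * (U\<^sup>2 * U\<^sup>2) * (2 * real_of_int Y) ^ 3 * (X - \<theta> * Y)\<^sup>2"
    using r' V by (intro mult_right_mono mult_left_mono power_mono) auto
  also have "\<dots> = 32 * U ^ 4 * Y ^ 3 * (X - \<theta> * Y)\<^sup>2"
  proof -
    have "4 * (A\<^sup>2 * A\<^sup>2) * (2 * B) ^ 3 * C = 32 * A ^ 4 * B ^ 3 * C" for A B C :: real
      by (simp add: power4_eq_xxxx power2_eq_square power3_eq_cube)
    then show ?thesis by simp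
  qed
  finally show ?thesis by (simp add: U_def)
qed

text \<open>Large enough both for the hypothesis of \<open>effective_irrationality\<close> and to absorb the constants in the
proof of \<open>large_solution_bound\<close>.\<close>

definition thue_const :: "nat \<Rightarrow> real" where
  "thue_const k = 1024 * 2048 ^ k * pade_E1 k ^ (4 * k) * pade_E2 k ^ 3"

lemma thue_const_ge: "thue_const k \<ge> 1024"
proof -
  have "1024 * 1 * 1 * 1 \<le> thue_const k" unfolding thue_const_def
    using pade_E_ge[of k] by (intro mult_mono one_le_power) auto
  then show ?thesis by simp
qed

text \<open>The quotient of \<open>X = |x\<^sub>0 y|\<close> and \<open>Y = |x y\<^sub>0|\<close> is extremely close to the \<open>k\<close>-th root \<open>\<theta>\<close> of
\<open>P/Q\<close>, with an error proportional to \<open>1/b\<close>, while \<open>X\<close> and \<open>Y\<close> have size about \<open>b^(1/k)\<close>. For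
\<open>k \<ge> 3\<close> the exponent \<open>5/2\<close> is smaller than \<open>k\<close>, so the effective irrationality measure bounds \<open>b\<close>.\<close>

lemma large_solution_bound:
  fixes n a1 a2 b0 b x0 y0 x y :: int
  assumes k: "k \<ge> 3" and n: "n \<noteq> 0" and a: "0 < a1" "a1 < a2"
    and b0: "thue_const k * (\<bar>n\<bar> * a2) ^ 6 \<le> b0" and b: "b0 < b"
    and sol: "a1 * b0 + n = x0 ^ k" "a2 * b0 + n = y0 ^ k" "a1 * b + n = x ^ k" "a2 * b + n = y ^ k"
  shows "real_of_int b \<le> real_of_int b0 ^ (10 * k + 11)"
proof -
  define N where "N = real_of_int \<bar>n\<bar>"
  define A1 where "A1 = real_of_int a1"
  define A2 where "A2 = real_of_int a2"
  define B0 where "B0 = real_of_int b0"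
  define B where "B = real_of_int b"
  define P where "P = a2 * (a1 * b0 + n)"
  define Q where "Q = a1 * (a2 * b0 + n)"
  define X where "X = \<bar>x0\<bar> * \<bar>y\<bar>"
  define Y where "Y = \<bar>x\<bar> * \<bar>y0\<bar>"
  define T where "T = N * A2"
  have N1: "N \<ge> 1" and A: "A1 \<ge> 1" "A2 \<ge> 1" "A1 < A2" using n a by (auto simp: N_def A1_def A2_def)
  have T1: "T \<ge> 1" unfolding T_def using N1 A mult_mono[of 1 N 1 A2] by simp
  have TN: "N \<le> T" unfolding T_def using N1 A by simp
  have TA: "A2 \<le> T" unfolding T_def using N1 A by simp
  have b0': "thue_const k * T ^ 6 \<le> B0" using b0 by (simp add: T_def N_def A2_def B0_def)
  have pow6: "T ^ j \<le> T ^ 6" if "j \<le> 6" for j using T1 that by (intro power_increasing) auto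
  have big: "1024 * T ^ j \<le> B0" if "j \<le> 6" for j
  proof -
    have "1024 * T ^ j \<le> thue_const k * T ^ 6" using thue_const_ge[of k] pow6[OF that] T1 by (intro mult_mono) auto
    then show ?thesis using b0' by simp
  qed
  have B0N: "B0 \<ge> 4 * N" using big[of 1] TN T1 N1 by simp
  have B0A: "B0 \<ge> 2 * A2\<^sup>2"
  proof -
    have "A2\<^sup>2 \<le> T\<^sup>2" using TA A by (intro power_mono) auto
    moreover have "0 \<le> T\<^sup>2" by simp
    ultimately show ?thesis using big[of 2] by linarith
  qed
  have B01: "B0 \<ge> 1" "B > B0" using big[of 0] b by (auto simp: B_def B0_def)
  have nN: "- N \<le> real_of_int n" "real_of_int n \<le> N" by (auto simp: N_def)
  have posval: "A * C / 2 \<le> A * C + n \<and> A * C + n \<le> 2 * A * C"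
    if "A \<ge> 1" "C \<ge> B0" for A C :: real
  proof -
    have "2 * N \<le> 1 * C" using that B0N N1 by simp
    also have "\<dots> \<le> A * C" using that B01 by (intro mult_right_mono) auto
    finally show ?thesis using nN by auto
  qed
  have Pr: "real_of_int P = A2 * (A1 * B0 + n)" and Qr: "real_of_int Q = A1 * (A2 * B0 + n)"
    by (simp_all add: P_def Q_def A1_def A2_def B0_def)
  have AAB: "A1 * A2 * B0 \<ge> 1" using A B01 mult_mono[of 1 "A1 * A2" 1 B0] mult_mono[of 1 A1 1 A2] by simp
  have Qlow: "A1 * A2 * B0 / 2 \<le> Q" "Q \<le> 2 * (A1 * A2 * B0)"
  proof -
    have "A1 * (A2 * B0 / 2) \<le> A1 * (A2 * B0 + n)" "A1 * (A2 * B0 + n) \<le> A1 * (2 * A2 * B0)"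
      using posval[OF A(2), of B0] A by (auto intro!: mult_left_mono)
    then show "A1 * A2 * B0 / 2 \<le> Q" "Q \<le> 2 * (A1 * A2 * B0)" unfolding Qr by (auto simp: mult_ac)
  qed
  have Ppos: "0 < real_of_int P" unfolding Pr using posval[OF A(1), of B0] A B01
    by (intro mult_pos_pos) (auto intro: less_le_trans[of 0 "A1 * B0 / 2"])
  have Qpos: "0 < real_of_int Q" using Qlow AAB by linarith
  have PQ: "P - Q = n * (a2 - a1)" by (simp add: P_def Q_def algebra_simps)
  have PT: "\<bar>real_of_int P - real_of_int Q\<bar> \<le> T"
  proof -
    have "\<bar>P - Q\<bar> = \<bar>n\<bar> * (a2 - a1)" unfolding PQ using a by (simp add: abs_mult)
    also have "\<dots> \<le> \<bar>n\<bar> * a2" using a by (intro mult_left_mono) auto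
    finally have "real_of_int \<bar>P - Q\<bar> \<le> real_of_int (\<bar>n\<bar> * a2)" by (rule of_int_le_iff[THEN iffD2])
    then show ?thesis by (simp add: T_def N_def A2_def)
  qed
  have Qlow2: "B0 / 2 \<le> Q"
  proof -
    have "1 * B0 \<le> (A1 * A2) * B0" using A B01 mult_mono[of 1 A1 1 A2] by (intro mult_right_mono) auto
    then show ?thesis using Qlow by simp
  qed
  have P2: "real_of_int P \<le> 2 * Q"
  proof -
    have "2 * T \<le> B0" using big[of 1] T1 by simp
    then show ?thesis using PT Qlow2 by linarith
  qed
  have Qup: "Q \<le> B0\<^sup>2"
  proof -
    have "2 * (A1 * A2) \<le> 2 * (A2 * A2)" using A by (intro mult_left_mono mult_right_mono) auto
    also have "\<dots> \<le> B0" using B0A by (simp add: power2_eq_square)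
    finally have "2 * (A1 * A2) * B0 \<le> B0 * B0" using B01 by (intro mult_right_mono) auto
    then show ?thesis using Qlow by (simp add: power2_eq_square mult_ac)
  qed
  have irr_big: "pade_E1 k ^ 2 * pade_E2 k ^ 3 * T ^ 6 \<le> Q"
  proof -
    have "2 * (pade_E1 k ^ 2 * pade_E2 k ^ 3) \<le> thue_const k"
    proof -
      have "2 * 1 * pade_E1 k ^ 2 * pade_E2 k ^ 3 \<le> 1024 * 2048 ^ k * pade_E1 k ^ (4 * k) * pade_E2 k ^ 3"
        using pade_E_ge[of k] k by (intro mult_mono power_increasing one_le_power) auto
      then show ?thesis by (simp add: thue_const_def)
    qed
    then have "2 * (pade_E1 k ^ 2 * pade_E2 k ^ 3) * T ^ 6 \<le> thue_const k * T ^ 6"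
      using T1 by (intro mult_right_mono) auto
    then show ?thesis using b0' Qlow2 by linarith
  qed
  have v: "x0 ^ k > 0" "y0 ^ k > 0" "x ^ k > 0" "y ^ k > 0"
  proof -
    have p: "0 < A * C + n" if "A \<ge> 1" "C \<ge> B0" for A C :: real
    proof -
      have "0 < A * C" using that B01 by (intro mult_pos_pos) auto
      then show ?thesis using posval[OF that] by linarith
    qed
    have "0 < real_of_int (x0 ^ k)" "0 < real_of_int (y0 ^ k)" "0 < real_of_int (x ^ k)" "0 < real_of_int (y ^ k)"
      unfolding sol[symmetric] using p[of A1 B0] p[of A2 B0] p[of A1 B] p[of A2 B] A B01
      by (auto simp: A1_def A2_def B0_def B_def)
    then show "x0 ^ k > 0" "y0 ^ k > 0" "x ^ k > 0" "y ^ k > 0" by (auto simp only: of_int_0_less_iff)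
  qed
  have abspow: "\<bar>z\<bar> ^ k = z ^ k" if "z ^ k > 0" for z :: int using that by (simp flip: power_abs)
  have nz: "x0 \<noteq> 0" "y0 \<noteq> 0" "x \<noteq> 0" "y \<noteq> 0" using v k by (auto simp: power_0_left)
  have XY: "X > 0" "Y > 0" using nz by (auto simp: X_def Y_def)
  have Xk: "real_of_int X ^ k = P * (B + n / A2)"
  proof -
    have "X ^ k = (a1 * b0 + n) * (a2 * b + n)" by (simp add: X_def power_mult_distrib abspow v sol)
    then have "real_of_int (X ^ k) = real_of_int ((a1 * b0 + n) * (a2 * b + n))" by (simp only:)
    then have "real_of_int X ^ k = (A1 * B0 + n) * (A2 * B + n)" by (simp add: A1_def A2_def B_def B0_def)
    also have "\<dots> = P * (B + n / A2)" unfolding Pr using A by (simp add: field_simps)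
    finally show ?thesis .
  qed
  have Yk: "real_of_int Y ^ k = Q * (B + n / A1)"
  proof -
    have "Y ^ k = (a2 * b0 + n) * (a1 * b + n)" by (simp add: Y_def power_mult_distrib abspow v sol)
    then have "real_of_int (Y ^ k) = real_of_int ((a2 * b0 + n) * (a1 * b + n))" by (simp only:)
    then have "real_of_int Y ^ k = (A2 * B0 + n) * (A1 * B + n)" by (simp add: A1_def A2_def B_def B0_def)
    also have "\<dots> = Q * (B + n / A1)" unfolding Qr using A by (simp add: field_simps)
    finally show ?thesis .
  qed
  define \<theta> where "\<theta> = root k (P / Q)"
  have \<theta>: "\<theta> > 0" "\<theta> ^ k = P / Q" unfolding \<theta>_def using Ppos Qpos k by auto
  have \<theta>Y: "(\<theta> * Y) ^ k = P * (B + n / A1)" using Qpos by (simp add: power_mult_distrib \<theta>(2) Yk)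
  have nA: "\<bar>n / A\<bar> \<le> N" if "A \<ge> 1" for A :: real
  proof -
    have "\<bar>n / A\<bar> = N / A" using that by (simp add: N_def abs_divide)
    also have "\<dots> \<le> N / 1" using that N1 by (intro divide_left_mono) auto
    finally show ?thesis by simp
  qed
  have diff: "\<bar>real_of_int X ^ k - (\<theta> * Y) ^ k\<bar> \<le> P * (2 * N)"
  proof -
    have "real_of_int X ^ k - (\<theta> * Y) ^ k = P * (n / A2 - n / A1)" unfolding Xk \<theta>Y by (simp add: algebra_simps)
    then have "\<bar>real_of_int X ^ k - (\<theta> * Y) ^ k\<bar> = P * \<bar>n / A2 - n / A1\<bar>" using Ppos by (simp add: abs_mult)
    also have "\<bar>n / A2 - n / A1\<bar> \<le> 2 * N" using nA[OF A(1)] nA[OF A(2)] by linarith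
    then have "P * \<bar>n / A2 - n / A1\<bar> \<le> P * (2 * N)" using Ppos by (intro mult_left_mono) auto
    finally show ?thesis .
  qed
  define D where "D = \<bar>X - \<theta> * Y\<bar>"
  have DX: "D * real_of_int X ^ (k - 1) \<le> 4 * N * P"
  proof -
    have "\<bar>X - \<theta> * Y\<bar> * \<bar>real_of_int X\<bar> ^ (k - 1) \<le> 2 * \<bar>real_of_int X ^ k - (\<theta> * Y) ^ k\<bar>"
      using k XY \<theta> by (intro abs_diff_mult_power_le) auto
    moreover have "\<bar>real_of_int X\<bar> = X" using XY by simp
    ultimately have "D * real_of_int X ^ (k - 1) \<le> 2 * \<bar>real_of_int X ^ k - (\<theta> * Y) ^ k\<bar>" by (simp only: D_def)
    also have "\<dots> \<le> 2 * (P * (2 * N))" using diff by (rule mult_left_mono) simp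
    also have "\<dots> = 4 * N * P" by simp
    finally show ?thesis .
  qed
  \<comment> \<open>The relative error of \<open>X/Y\<close> as an approximation to \<open>\<theta>\<close> is \<open>O(N/b)\<close>.\<close>
  have DB: "D * B \<le> 8 * N * X"
  proof -
    have "B / 2 \<le> B + n / A2" using nA[OF A(2)] B0N B01 N1 by linarith
    then have "P * (B / 2) \<le> real_of_int X ^ k" unfolding Xk using Ppos by (intro mult_left_mono) auto
    then have "D * (P * (B / 2)) \<le> D * real_of_int X ^ k" by (intro mult_left_mono) (auto simp: D_def)
    also have "\<dots> = (D * real_of_int X ^ (k - 1)) * X" using k by (cases k) auto
    also have "\<dots> \<le> (4 * N * P) * X" using DX XY by (intro mult_right_mono) auto
    finally have "P * (D * B) \<le> P * (8 * N * X)" by (simp add: algebra_simps)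
    then show ?thesis using Ppos by simp
  qed
  define U where "U = pade_E1 k * Q"
  have U0: "U > 0" using pade_E_ge[of k] Qpos by (simp add: U_def)
  have "1 \<le> 32 * (pade_E1 k * Q) ^ 4 * Y ^ 3 * (X - \<theta> * Y)\<^sup>2"
    using k Ppos Qpos XY P2 \<theta> PT irr_big PQ n a by (intro effective_irrationality) auto
  then have irr: "1 \<le> 32 * U ^ 4 * real_of_int Y ^ 3 * D\<^sup>2" by (simp add: U_def D_def)
  \<comment> \<open>Multiplication by \<open>b\<^sup>2\<close> removes \<open>D\<close>, and passing to \<open>k\<close>-th powers leaves an inequality in \<open>b\<close>.\<close>
  have "B\<^sup>2 \<le> (32 * U ^ 4 * real_of_int Y ^ 3 * D\<^sup>2) * B\<^sup>2" using mult_right_mono[OF irr, of "B\<^sup>2"] by simp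
  also have "\<dots> = 32 * U ^ 4 * real_of_int Y ^ 3 * (D * B)\<^sup>2" by (simp add: power_mult_distrib)
  also have "\<dots> \<le> 32 * U ^ 4 * real_of_int Y ^ 3 * (8 * N * X)\<^sup>2"
    using DB U0 XY B01 by (intro mult_left_mono power_mono) (auto simp: D_def)
  also have "\<dots> = 2048 * N\<^sup>2 * U ^ 4 * (real_of_int X ^ 2 * real_of_int Y ^ 3)" by (simp add: power_mult_distrib)
  finally have main: "B\<^sup>2 \<le> 2048 * N\<^sup>2 * U ^ 4 * (real_of_int X ^ 2 * real_of_int Y ^ 3)" .
  have XYk: "real_of_int X ^ k \<le> 4 * Q * B" "real_of_int Y ^ k \<le> 4 * Q * B"
  proof -
    have *: "0 \<le> B + n / A \<and> B + n / A \<le> 2 * B" if "A \<ge> 1" for A :: real using nA[OF that] B0N B01 N1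
      by linarith
    have "P * (B + n / A2) \<le> (2 * Q) * (2 * B)" using P2 Qpos Ppos *[OF A(2)] by (intro mult_mono) auto
    then show "real_of_int X ^ k \<le> 4 * Q * B" unfolding Xk by simp
    have "Q * (B + n / A1) \<le> (2 * Q) * (2 * B)" using Qpos *[OF A(1)] by (intro mult_mono) auto
    then show "real_of_int Y ^ k \<le> 4 * Q * B" unfolding Yk by simp
  qed
  have "(B\<^sup>2) ^ k \<le> (2048 * N\<^sup>2 * U ^ 4 * (real_of_int X ^ 2 * real_of_int Y ^ 3)) ^ k"
    using main by (rule power_mono) simp
  also have "\<dots> = (2048 * N\<^sup>2 * U ^ 4) ^ k * ((real_of_int X ^ k) ^ 2 * (real_of_int Y ^ k) ^ 3)"
    by (simp add: power_mult_distrib mult.commute flip: power_mult)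
  also have "\<dots> \<le> (2048 * N\<^sup>2 * U ^ 4) ^ k * ((4 * real_of_int Q * B) ^ 2 * (4 * real_of_int Q * B) ^ 3)"
    using XYk XY U0 by (intro mult_left_mono mult_mono power_mono) auto
  also have "(2048 * N\<^sup>2 * U ^ 4) ^ k = 2048 ^ k * pade_E1 k ^ (4 * k) * N ^ (2 * k) * real_of_int Q ^ (4 * k)"
    by (simp add: U_def power_mult_distrib flip: power_mult)
  also have "(4 * real_of_int Q * B) ^ 2 * (4 * real_of_int Q * B) ^ 3 = 1024 * real_of_int Q ^ 5 * B ^ 5"
  proof -
    have "z ^ 2 * z ^ 3 = z ^ 5" for z :: real by (simp flip: power_add)
    moreover have "(4 * u * v) ^ 5 = 1024 * u ^ 5 * v ^ 5" for u v :: real by (simp add: power_mult_distrib)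
    ultimately show ?thesis by (simp only:)
  qed
  finally have E: "(B\<^sup>2) ^ k \<le> (1024 * 2048 ^ k * pade_E1 k ^ (4 * k)) * N ^ (2 * k) * real_of_int Q ^ (4 * k + 5) * B ^ 5"
    by (simp add: power_add mult_ac)
  have c1: "1024 * 2048 ^ k * pade_E1 k ^ (4 * k) \<le> B0"
  proof -
    have "1024 * 2048 ^ k * pade_E1 k ^ (4 * k) * 1 * 1 \<le> 1024 * 2048 ^ k * pade_E1 k ^ (4 * k) * pade_E2 k ^ 3 * T ^ 6"
      using pade_E_ge[of k] T1 by (intro mult_mono one_le_power) auto
    also have "\<dots> \<le> B0" using b0' by (simp only: thue_const_def)
    finally show ?thesis by (simp only: mult_1_right)
  qed
  have "B * B ^ 5 \<le> (B\<^sup>2) ^ k"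
  proof -
    have "B ^ 6 \<le> B ^ (2 * k)" using B01 k by (intro power_increasing) auto
    then show ?thesis by (simp add: power_mult flip: power_Suc)
  qed
  also note E
  also have "(1024 * 2048 ^ k * pade_E1 k ^ (4 * k)) * N ^ (2 * k) * real_of_int Q ^ (4 * k + 5) * B ^ 5
      \<le> B0 * B0 ^ (2 * k) * (B0\<^sup>2) ^ (4 * k + 5) * B ^ 5"
    using c1 B0N N1 Qup Qpos B01 pade_E_ge[of k] by (intro mult_mono power_mono mult_nonneg_nonneg) auto
  also have "B0 * B0 ^ (2 * k) * (B0\<^sup>2) ^ (4 * k + 5) = B0 ^ (10 * k + 11)"
    by (simp add: add.commute flip: power_mult power_add power_Suc)
  finally have "B * B ^ 5 \<le> B0 ^ (10 * k + 11) * B ^ 5" .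
  then show ?thesis using B01 unfolding B_def[symmetric] B0_def[symmetric] by simp
qed

section \<open>The gap principle for large solutions\<close>

text \<open>The integers \<open>X = |x\<^sub>1 y\<^sub>2|\<close> and \<open>Y = |x\<^sub>2 y\<^sub>1|\<close> are distinct, since the difference of their \<open>k\<close>-th powers is
\<open>n (a' - a) (b' - b)\<close>. Hence this difference is at least of size \<open>X^(k-1)\<close>.\<close>

lemma nth_powers_gap:
  fixes n a a' b b' x1 x2 y1 y2 :: int
  assumes k: "k \<ge> 1" and n: "n \<noteq> 0" and a: "0 < a" "a < a'" and b: "2 * \<bar>n\<bar> \<le> b" "b < b'"
    and sol: "a * b + n = x1 ^ k" "a' * b + n = y1 ^ k" "a * b' + n = x2 ^ k" "a' * b' + n = y2 ^ k"
  shows "(a * b) ^ (k - 1) \<le> (8 * \<bar>n\<bar>) ^ k * (a' * b')"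
proof -
  have half: "c * d \<le> 2 * (c * d + n) \<and> 0 < c * d + n" if "0 < c" "b \<le> d" for c d
  proof -
    have "1 * (2 * \<bar>n\<bar>) \<le> c * d" using that b by (intro mult_mono) auto
    moreover have "e \<le> 2 * (e + n) \<and> 0 < e + n" if "2 * \<bar>n\<bar> \<le> e" for e using that n by auto
    ultimately show ?thesis by simp
  qed
  define X where "X = \<bar>x1\<bar> * \<bar>y2\<bar>"
  define Y where "Y = \<bar>x2\<bar> * \<bar>y1\<bar>"
  have abspow: "\<bar>z\<bar> ^ k = z ^ k" if "z ^ k > 0" for z :: int using that by (simp flip: power_abs)
  have pos: "x1 ^ k > 0" "y1 ^ k > 0" "x2 ^ k > 0" "y2 ^ k > 0"
    unfolding sol[symmetric] using half a b by auto
  have Xk: "X ^ k = (a * b + n) * (a' * b' + n)" and Yk: "Y ^ k = (a * b' + n) * (a' * b + n)"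
    by (simp_all add: X_def Y_def power_mult_distrib abspow pos sol)
  have diff: "X ^ k - Y ^ k = n * (a' - a) * (b' - b)" unfolding Xk Yk by (simp add: algebra_simps)
  then have "X \<noteq> Y" using n a b by auto
  then have d1: "1 \<le> \<bar>X - Y\<bar>" by auto
  have XY0: "X \<ge> 0" "Y \<ge> 0" by (auto simp: X_def Y_def)
  have "real_of_int (X ^ (k - 1)) \<le> \<bar>real_of_int X - real_of_int Y\<bar> * \<bar>real_of_int X\<bar> ^ (k - 1)"
  proof -
    have "1 \<le> \<bar>real_of_int X - real_of_int Y\<bar>" using d1 by linarith
    then have "1 * \<bar>real_of_int X\<bar> ^ (k - 1) \<le> \<bar>real_of_int X - real_of_int Y\<bar> * \<bar>real_of_int X\<bar> ^ (k - 1)"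
      by (intro mult_right_mono) auto
    then show ?thesis using XY0 by simp
  qed
  also have "\<dots> \<le> 2 * \<bar>real_of_int X ^ k - real_of_int Y ^ k\<bar>"
    using XY0 k by (intro abs_diff_mult_power_le) auto
  also have "\<dots> = real_of_int (2 * \<bar>X ^ k - Y ^ k\<bar>)" by simp
  finally have "X ^ (k - 1) \<le> 2 * \<bar>X ^ k - Y ^ k\<bar>" by (simp only: of_int_le_iff)
  also have "\<bar>X ^ k - Y ^ k\<bar> = \<bar>n\<bar> * ((a' - a) * (b' - b))" unfolding diff using a b by (simp add: abs_mult mult.assoc)
  also have "2 * (\<bar>n\<bar> * ((a' - a) * (b' - b))) \<le> 2 * (\<bar>n\<bar> * (a' * b'))"
    using a b by (intro mult_left_mono mult_mono) auto
  finally have up: "X ^ (k - 1) \<le> 2 * (\<bar>n\<bar> * (a' * b'))" .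
  have "(a * b) * (a' * b') \<le> (2 * (a * b + n)) * (2 * (a' * b' + n))"
  proof (rule mult_mono)
    have "0 \<le> a' * b'" using a b n by auto
    then show "0 \<le> a' * b'" .
  qed (use half[of a b] half[of a' b'] a b in auto)
  also have "\<dots> = 4 * X ^ k" by (simp add: Xk algebra_simps)
  finally have low: "(a * b) * (a' * b') \<le> 4 * X ^ k" .
  have ab0: "0 \<le> a * b" "0 < a' * b'" using a b n by auto
  have "(a * b) ^ (k - 1) * (a' * b') ^ (k - 1) = ((a * b) * (a' * b')) ^ (k - 1)" by (simp add: power_mult_distrib)
  also have "\<dots> \<le> (4 * X ^ k) ^ (k - 1)" using low ab0 by (intro power_mono) auto
  also have "\<dots> = 4 ^ (k - 1) * (X ^ (k - 1)) ^ k" by (simp add: power_mult_distrib mult.commute flip: power_mult)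
  also have "\<dots> \<le> 4 ^ k * (2 * (\<bar>n\<bar> * (a' * b'))) ^ k"
    using up XY0 by (intro mult_mono power_mono power_increasing) auto
  also have "\<dots> = ((8 * \<bar>n\<bar>) ^ k * (a' * b')) * (a' * b') ^ (k - 1)"
  proof -
    have "4 ^ k * (2 * (\<bar>n\<bar> * (a' * b'))) ^ k = (4 * (2 * (\<bar>n\<bar> * (a' * b')))) ^ k" by (simp only: power_mult_distrib)
    also have "4 * (2 * (\<bar>n\<bar> * (a' * b'))) = (8 * \<bar>n\<bar>) * (a' * b')" by simp
    also have "\<dots> ^ k = (8 * \<bar>n\<bar>) ^ k * (a' * b') ^ k" by (simp only: power_mult_distrib)
    also have "(a' * b') ^ k = (a' * b') * (a' * b') ^ (k - 1)" using k by (cases k) auto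
    finally show ?thesis by (simp only: mult.assoc)
  qed
  finally show ?thesis using ab0(2) by (simp add: mult_le_cancel_right)
qed

lemma mult_power_2_less_power_3: "j * 2 ^ j < (3::nat) ^ j"
proof (induction j)
  case (Suc j)
  show ?case
  proof (cases "j < 2")
    case True
    then have "j = 0 \<or> j = 1" by auto
    then show ?thesis by auto
  next
    case False
    have "Suc j * 2 ^ Suc j = (2 * j + 2) * 2 ^ j" by simp
    also have "\<dots> \<le> (3 * j) * 2 ^ j" using False by (intro mult_right_mono) auto
    also have "\<dots> < 3 * 3 ^ j" using Suc by simp
    finally show ?thesis by simp
  qed
qed auto

lemma growth_chain:
  fixes b :: "nat \<Rightarrow> int"
  assumes "\<And>i. i \<le> L \<Longrightarrow> b i \<ge> 0" "\<And>i. i < L \<Longrightarrow> b i ^ 3 \<le> b (Suc i) ^ 2" "i \<le> L"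
  shows "b 0 ^ (3 ^ i) \<le> b i ^ (2 ^ i)"
  using assms(3)
proof (induction i)
  case (Suc i)
  have "b 0 ^ (3 ^ Suc i) = (b 0 ^ (3 ^ i)) ^ 3" by (simp add: mult.commute flip: power_mult)
  also have "\<dots> \<le> (b i ^ (2 ^ i)) ^ 3" using Suc assms(1)[of 0] by (intro power_mono) auto
  also have "\<dots> = (b i ^ 3) ^ (2 ^ i)" by (simp add: mult.commute flip: power_mult)
  also have "\<dots> \<le> (b (Suc i) ^ 2) ^ (2 ^ i)" using Suc.prems assms(1)[of i] assms(2)[of i] by (intro power_mono) auto
  also have "\<dots> = b (Suc i) ^ (2 ^ Suc i)" by (simp flip: power_mult)
  finally show ?case .
qed auto

text \<open>After seven steps the growth makes \<open>b 7 \<ge> b 0 ^ 13\<close>, large enough to serve as the solution \<open>b\<^sub>0\<close> in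
\<open>large_solution_bound\<close>. After \<open>j = 10 k + 11\<close> further steps the growth exponent \<open>(3/2)^j\<close> exceeds the
exponent \<open>j\<close> allowed there.\<close>

lemma no_long_growth_chain:
  fixes n a1 a2 :: int and b :: "nat \<Rightarrow> int"
  assumes k: "k \<ge> 3" and n: "n \<noteq> 0" and a: "0 < a1" "a1 < a2"
    and sol: "\<And>i. i \<le> 10 * k + 18 \<Longrightarrow> is_nth_power k (a1 * b i + n)" "\<And>i. i \<le> 10 * k + 18 \<Longrightarrow> is_nth_power k (a2 * b i + n)"
    and mono: "\<And>i j. i < j \<Longrightarrow> j \<le> 10 * k + 18 \<Longrightarrow> b i < b j"
    and b0: "a2 \<le> b 0" "thue_const k \<le> b 0" "\<bar>n\<bar> \<le> b 0"
    and growth: "\<And>i. i < 10 * k + 18 \<Longrightarrow> b i ^ 3 \<le> b (Suc i) ^ 2"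
  shows False
proof -
  define L where "L = 10 * k + 18"
  have b0': "b 0 \<ge> 2" using b0(2) thue_const_ge[of k] by linarith
  have bpos: "b i \<ge> 2" if "i \<le> L" for i using mono[of 0 i] that b0' by (cases "i = 0") (auto simp: L_def)
  \<comment> \<open>Seven steps suffice for the exponent \<open>13\<close> because \<open>(3/2)^7 > 17\<close>.\<close>
  have "b 0 ^ (3 ^ 7) \<le> b 7 ^ (2 ^ 7)"
    using bpos growth by (intro growth_chain[of L]) (auto simp: L_def order_trans[of 0 2])
  moreover have "b 0 ^ (13 * 2 ^ 7) \<le> b 0 ^ (3 ^ 7)" using b0' by (intro power_increasing) auto
  ultimately have "(b 0 ^ 13) ^ (2 ^ 7) \<le> b 7 ^ (2 ^ 7)" by (simp only: power_mult[symmetric])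
  then have b7: "b 0 ^ 13 \<le> b 7" using bpos[of 7] by (subst (asm) power_mono_iff) (auto simp: L_def b0' order_trans[OF _ b0'])
  have t7: "thue_const k * (\<bar>n\<bar> * a2) ^ 6 \<le> b 7"
  proof -
    have "thue_const k * real_of_int ((\<bar>n\<bar> * a2) ^ 6) \<le> real_of_int (b 0) * real_of_int ((b 0 * b 0) ^ 6)"
      using b0 b0' a thue_const_ge[of k]
      by (intro mult_mono of_int_le_iff[THEN iffD2] power_mono) auto
    also have "\<dots> = real_of_int (b 0 ^ 13)"
    proof -
      have "b 0 * (b 0 * b 0) ^ 6 = b 0 ^ 13" by (simp add: power_mult_distrib flip: power_add power_Suc)
      then show ?thesis by (metis of_int_mult)
    qed
    also have "\<dots> \<le> real_of_int (b 7)" using b7 by (simp only: of_int_le_iff)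
    finally show ?thesis by simp
  qed
  define j where "j = 10 * k + 11"
  obtain x0 y0 x y where p: "a1 * b 7 + n = x0 ^ k" "a2 * b 7 + n = y0 ^ k" "a1 * b (7 + j) + n = x ^ k" "a2 * b (7 + j) + n = y ^ k"
    using sol(1)[of 7] sol(2)[of 7] sol(1)[of "7 + j"] sol(2)[of "7 + j"] unfolding is_nth_power_def j_def by auto
  have "real_of_int (b (7 + j)) \<le> real_of_int (b 7) ^ j" unfolding j_def
    using mono[of 7 "7 + j"] t7 p[unfolded j_def] unfolding j_def by (intro large_solution_bound[OF k n a]) auto
  then have up: "b (7 + j) \<le> b 7 ^ j" by (metis of_int_le_iff of_int_power)
  have "b (7 + 0) ^ (3 ^ j) \<le> b (7 + j) ^ (2 ^ j)"
  proof (rule growth_chain[where L = j and b = "\<lambda>i. b (7 + i)"])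
    show "0 \<le> b (7 + i)" if "i \<le> j" for i using bpos[of "7 + i"] that by (simp add: L_def j_def)
    show "b (7 + i) ^ 3 \<le> b (7 + Suc i) ^ 2" if "i < j" for i using growth[of "7 + i"] that by (simp add: j_def)
  qed simp
  also have "\<dots> \<le> (b 7 ^ j) ^ (2 ^ j)" using up bpos[of "7 + j"] by (intro power_mono) (auto simp: L_def j_def)
  finally have "b 7 ^ (3 ^ j) \<le> b 7 ^ (j * 2 ^ j)" by (simp add: power_mult)
  moreover have "b 7 ^ (j * 2 ^ j) < b 7 ^ (3 ^ j)"
    using mult_power_2_less_power_3[of j] bpos[of 7] by (intro power_strict_increasing) (auto simp: L_def)
  ultimately show False by simp
qed

section \<open>Few residue classes of coprime solutions\<close>

text \<open>A form of Hensel's lemma: if \<open>z\<close> and \<open>w\<close> are close enough \<open>p\<close>-adically, then \<open>(z\<^sup>k - w\<^sup>k)/(z - w)\<close> has the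
same \<open>p\<close>-adic valuation as \<open>k z^(k-1)\<close>.\<close>

lemma lifting_difference_of_powers:
  fixes p z w :: int
  assumes p: "prime p" and k: "k \<ge> 1" and z: "\<not> p dvd z"
    and close: "p ^ (multiplicity p (int k) + 1) dvd z - w" and m: "p ^ m dvd z ^ k - w ^ k"
  shows "p ^ m dvd int k * (z - w)"
proof -
  define v where "v = multiplicity p (int k)"
  obtain k' where k': "int k = p ^ v * k'" "\<not> p dvd k'"
  proof -
    have "\<not> is_unit p" using p not_prime_unit by blast
    then show ?thesis using multiplicity_decompose'[of "int k" p] k that unfolding v_def by fastforce
  qed
  define S where "S = (\<Sum>i<k. w ^ (k - Suc i) * z ^ i)"
  have fact: "z ^ k - w ^ k = (z - w) * S" unfolding S_def by (rule power_diff_sumr2)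
  have "[S = (\<Sum>i<k. z ^ (k - Suc i) * z ^ i)] (mod p ^ (v + 1))"
    unfolding S_def using close
    by (intro cong_sum cong_mult cong_pow cong_refl) (simp add: v_def cong_iff_dvd_diff dvd_diff_commute)
  also have "(\<Sum>i<k. z ^ (k - Suc i) * z ^ i) = (\<Sum>i<k. z ^ (k - 1))"
    by (intro sum.cong refl) (simp flip: power_add)
  also have "\<dots> = p ^ v * (k' * z ^ (k - 1))" using k' by simp
  finally have "p ^ (v + 1) dvd S - p ^ v * (k' * z ^ (k - 1))" by (simp only: cong_iff_dvd_diff)
  then obtain t where "S - p ^ v * (k' * z ^ (k - 1)) = p ^ (v + 1) * t" by (rule dvdE)
  then have t: "S = p ^ v * (k' * z ^ (k - 1)) + p ^ (v + 1) * t" by (simp only: diff_eq_eq add.commute)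
  define S' where "S' = k' * z ^ (k - 1) + p * t"
  have S: "S = p ^ v * S'" unfolding t S'_def by (simp add: algebra_simps)
  have "\<not> p dvd S'"
    unfolding S'_def using p k'(2) z by (auto simp: dvd_add_left_iff prime_dvd_mult_iff dest: prime_dvd_power)
  then have cop: "coprime (p ^ m) S'" using p by (simp add: prime_imp_coprime)
  have "p ^ m dvd ((z - w) * p ^ v) * S'" using m unfolding fact S by (simp add: mult.assoc)
  then have "p ^ m dvd (z - w) * p ^ v" using cop by (simp add: coprime_dvd_mult_left_iff)
  also have "\<dots> dvd (z - w) * int k" by (rule mult_dvd_mono) (auto simp: k')
  finally show ?thesis by (simp add: mult.commute)
qed

lemma prime_power_dvd_power:
  fixes p y :: int
  assumes p: "prime p" and k: "k \<ge> 1" and "p ^ e dvd y ^ k"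
  shows "p ^ ((e + k - 1) div k) dvd y"
proof (cases "y = 0")
  case False
  have "e \<le> multiplicity p (y ^ k)" using assms False by (intro multiplicity_geI) (auto simp: not_prime_unit)
  also have "\<dots> = k * multiplicity p y" by (rule prime_elem_multiplicity_power_distrib[OF prime_imp_prime_elem[OF p] False])
  finally have "(e + k - 1) div k \<le> (k * multiplicity p y + (k - 1)) div k" using k by (intro div_le_mono) auto
  also have "\<dots> = multiplicity p y" by (rule div_nat_eqI) (use k in auto)
  finally show ?thesis by (rule multiplicity_dvd')
qed auto

text \<open>Let \<open>p\<^sup>\<alpha>\<close> be the exact power of \<open>p\<close> in \<open>A\<close>. If \<open>\<alpha> \<ge> e\<close>, then \<open>y\<close> is so divisible by \<open>p\<close> that one class
suffices. Otherwise \<open>\<alpha> = k v\<close> and \<open>y = p\<^sup>v y'\<close> with \<open>y'\<close> prime to \<open>p\<close>, and the class records the ratio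
\<open>y'/x\<close> modulo \<open>p^(v\<^sub>p(k) + 1)\<close>. For \<open>p\<close> not dividing \<open>k\<close> this ratio is a root of a
binomial equation modulo \<open>p\<close>; for \<open>p\<close> dividing \<open>k\<close> there are at most \<open>k\<^sup>2\<close> residues in any case. Equal
ratios lift to a congruence modulo \<open>p^(e - \<alpha>)\<close>, up to the factor \<open>k\<close>. What is lost with respect to \<open>p^e\<close> is
covered by the power of \<open>A\<close>.\<close>

lemma root_classes_at_prime:
  fixes p :: nat and A B :: int
  assumes p: "prime p" and k: "k \<ge> 1" and A: "A \<noteq> 0" and B: "\<not> int p dvd B" and e: "e \<ge> 1"
  obtains f :: "int \<times> int \<Rightarrow> nat" and W where "finite W" "card W \<le> k\<^sup>2"
    "\<And>x y. \<not> int p dvd x \<Longrightarrow> int p ^ e dvd A * x ^ k - B * y ^ k \<Longrightarrow> f (x, y) \<in> W"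
    "\<And>x y x' y'. \<not> int p dvd x \<Longrightarrow> int p ^ e dvd A * x ^ k - B * y ^ k \<Longrightarrow>
       \<not> int p dvd x' \<Longrightarrow> int p ^ e dvd A * x' ^ k - B * y' ^ k \<Longrightarrow> f (x, y) = f (x', y') \<Longrightarrow>
       int p ^ (k * e) dvd A ^ (k - 1) * int k ^ k * (x * y' - x' * y) ^ k"
proof -
  define P where "P = int p"
  have P: "prime P" using p by (simp add: P_def)
  have P0: "P \<noteq> 0" "\<not> is_unit P" using P by (auto simp: not_prime_unit)
  have copB: "coprime (P ^ m) B" for m using P B by (simp add: P_def prime_imp_coprime)
  show ?thesis
  proof (cases "P ^ e dvd A")
    case True
    have k2: "1 \<le> k\<^sup>2" using k by simp
    show ?thesis
    proof (rule that[of "{0}" "\<lambda>_. 0"])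
      fix x y x' y'
      assume h: "int p ^ e dvd A * x ^ k - B * y ^ k" "int p ^ e dvd A * x' ^ k - B * y' ^ k"
      define s where "s = (e + k - 1) div k"
      have div_y: "P ^ s dvd y" if "P ^ e dvd A * x ^ k - B * y ^ k" for x y
      proof -
        have "P ^ e dvd A * x ^ k" using True by simp
        then have "P ^ e dvd B * y ^ k" using that by (metis dvd_diff_right_iff)
        then have "P ^ e dvd y ^ k" using copB[of e] by (simp add: coprime_dvd_mult_right_iff)
        then show ?thesis unfolding s_def by (rule prime_power_dvd_power[OF P k])
      qed
      have "P ^ s dvd x * y' - x' * y" using div_y h by (simp add: P_def)
      then have "P ^ (s * k) dvd (x * y' - x' * y) ^ k" by (simp add: power_mult dvd_power_same)
      moreover have "e \<le> s * k"
      proof -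
        have "e + k - 1 < k + k * s" unfolding s_def using k by (intro dividend_less_times_div) auto
        then show ?thesis using k by (simp add: mult.commute)
      qed
      ultimately have "P ^ e dvd (x * y' - x' * y) ^ k" by (meson dvd_trans le_imp_power_dvd)
      moreover have "P ^ (e * (k - 1)) dvd A ^ (k - 1)" using True by (simp add: power_mult dvd_power_same)
      ultimately have "P ^ (e * (k - 1)) * P ^ e dvd (A ^ (k - 1) * int k ^ k) * (x * y' - x' * y) ^ k"
        by (intro mult_dvd_mono dvd_mult2)
      moreover have "P ^ (e * (k - 1)) * P ^ e = P ^ (k * e)"
        using k by (cases k) (simp_all add: power_add[symmetric] algebra_simps)
      ultimately show "int p ^ (k * e) dvd A ^ (k - 1) * int k ^ k * (x * y' - x' * y) ^ k" by (simp add: P_def)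
    qed (use k2 in auto)
  next
    case False
    define \<alpha> where "\<alpha> = multiplicity P A"
    have \<alpha>e: "\<alpha> < e" using False P0 A unfolding \<alpha>_def by (meson multiplicity_geI multiplicity_dvd' not_le)
    obtain A' where A': "A = P ^ \<alpha> * A'" "\<not> P dvd A'"
      using multiplicity_decompose'[of A P] A P0 unfolding \<alpha>_def by auto
    define v where "v = \<alpha> div k"
    define c where "c = multiplicity P (int k) + 1"
    \<comment> \<open>The power of \<open>p\<close> in \<open>A x\<^sup>k\<close> is smaller than \<open>p^e\<close>, so \<open>B y\<^sup>k\<close> has to match it exactly.\<close>
    have reduce: "\<exists>y'. y = P ^ v * y' \<and> \<not> P dvd y' \<and> \<alpha> = k * v \<and> P ^ (e - \<alpha>) dvd A' * x ^ k - B * y' ^ k"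
      if x: "\<not> P dvd x" and h: "P ^ e dvd A * x ^ k - B * y ^ k" for x y
    proof -
      have "P ^ \<alpha> dvd A * x ^ k - B * y ^ k" using h \<alpha>e by (meson dvd_trans le_imp_power_dvd less_imp_le)
      then have "P ^ \<alpha> dvd B * y ^ k" using A' by (metis dvd_diff_right_iff dvd_mult2 dvd_triv_left)
      then have 1: "P ^ \<alpha> dvd y ^ k" using copB by (simp add: coprime_dvd_mult_right_iff)
      have 2: "\<not> P ^ Suc \<alpha> dvd y ^ k"
      proof
        assume "P ^ Suc \<alpha> dvd y ^ k"
        moreover have "P ^ Suc \<alpha> dvd A * x ^ k - B * y ^ k" using h \<alpha>e by (meson dvd_trans le_imp_power_dvd Suc_leI)
        ultimately have "P ^ Suc \<alpha> dvd A * x ^ k" by (metis dvd_diff_left_iff dvd_mult)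
        then have "P ^ \<alpha> * P dvd P ^ \<alpha> * (A' * x ^ k)" by (simp add: A' mult_ac)
        then have "P dvd A' * x ^ k" using P0 by (simp only: dvd_mult_cancel_left power_eq_0_iff) simp
        then show False using A'(2) x P by (auto simp: prime_dvd_mult_iff dest: prime_dvd_power)
      qed
      then have y0: "y \<noteq> 0" using k by (auto simp: power_0_left)
      have "multiplicity P (y ^ k) = \<alpha>" using 1 2 by (rule multiplicity_eqI)
      then have \<alpha>k: "\<alpha> = k * multiplicity P y" using prime_elem_multiplicity_power_distrib[OF prime_imp_prime_elem[OF P] y0, of k] by simp
      then have mv: "multiplicity P y = v" using k by (simp add: v_def)
      obtain y' where y': "y = P ^ v * y'" "\<not> P dvd y'"
        using multiplicity_decompose'[of y P] y0 P0 mv by auto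
      have \<alpha>v: "\<alpha> = k * v" using \<alpha>k mv by simp
      have "y ^ k = P ^ \<alpha> * y' ^ k" unfolding y' \<alpha>v by (simp add: power_mult_distrib mult.commute flip: power_mult)
      then have "A * x ^ k - B * y ^ k = P ^ \<alpha> * (A' * x ^ k - B * y' ^ k)" by (simp add: A'(1) algebra_simps)
      moreover have "P ^ e = P ^ \<alpha> * P ^ (e - \<alpha>)" using \<alpha>e by (simp flip: power_add)
      ultimately have "P ^ \<alpha> * P ^ (e - \<alpha>) dvd P ^ \<alpha> * (A' * x ^ k - B * y' ^ k)" using h by simp
      then have "P ^ (e - \<alpha>) dvd A' * x ^ k - B * y' ^ k" using P0 by simp
      then show ?thesis using y' \<alpha>v by blast
    qed
    \<comment> \<open>The class is the residue of \<open>y'/x\<close>.\<close>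
    define R where "R x y r \<longleftrightarrow> r < p ^ c \<and> [int r * x = y div P ^ v] (mod P ^ c)" for x y r
    define f where "f = (\<lambda>(x, y). SOME r. R x y r)"
    have fR: "R x y (f (x, y))" if x: "\<not> P dvd x" for x y
    proof -
      have "coprime x (P ^ c)" using P x by (metis coprime_commute coprime_power_left_iff prime_imp_coprime)
      then obtain x' where x': "[x * x' = 1] (mod P ^ c)" using cong_solve_coprime_int by blast
      define r where "r = nat ((y div P ^ v) * x' mod P ^ c)"
      have Pc: "P ^ c > 0" using P by (simp add: prime_gt_0_int)
      have ir: "int r = (y div P ^ v) * x' mod P ^ c" using Pc by (simp add: r_def)
      have "int r < P ^ c" using Pc by (simp add: ir)
      then have "r < p ^ c" by (simp add: P_def flip: of_nat_power)
      moreover have "[int r * x = y div P ^ v] (mod P ^ c)"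
      proof -
        have "[int r * x = (y div P ^ v) * x' * x] (mod P ^ c)" unfolding ir
          by (intro cong_mult cong_refl) simp
        also have "(y div P ^ v) * x' * x = (y div P ^ v) * (x * x')" by (simp only: mult_ac)
        also have "[(y div P ^ v) * (x * x') = (y div P ^ v) * 1] (mod P ^ c)" using x' by (intro cong_mult cong_refl)
        finally show ?thesis by (simp only: mult_1_right)
      qed
      ultimately have "R x y r" unfolding R_def by blast
      then show ?thesis unfolding f_def by (auto intro: someI)
    qed
    obtain w where w: "[int w * B = A'] (mod P)"
    proof -
      obtain B' where B': "[B * B' = 1] (mod P)" using cong_solve_coprime_int[of B P] copB[of 1] by (auto simp: coprime_commute)
      have P1: "P > 0" using P by (simp add: prime_gt_0_int)
      have "[int (nat (A' * B' mod P)) * B = (A' * B') * B] (mod P)" using P1 by (intro cong_mult cong_refl) simp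
      also have "A' * B' * B = A' * (B * B')" by (simp only: mult_ac)
      also have "[A' * (B * B') = A' * 1] (mod P)" using B' by (intro cong_mult cong_refl)
      finally have "[int (nat (A' * B' mod P)) * B = A'] (mod P)" by (simp only: mult_1_right)
      then show ?thesis by (rule that)
    qed
    define W where "W = (if p dvd k then {..<p ^ c} else {r\<in>{..<p}. [r ^ k = w] (mod p)})"
    have Wfin: "finite W" by (simp add: W_def)
    have Wcard: "card W \<le> k\<^sup>2"
    proof (cases "p dvd k")
      case True
      have "P ^ multiplicity P (int k) dvd int k" by (rule multiplicity_dvd)
      then have "p ^ multiplicity P (int k) dvd k" by (simp add: P_def flip: of_nat_power)
      then have "p ^ multiplicity P (int k) \<le> k" using k by (intro dvd_imp_le) auto
      moreover have "p \<le> k" using True k by (intro dvd_imp_le) auto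
      ultimately have "p ^ c \<le> k * k" unfolding c_def by (simp add: mult_mono)
      then show ?thesis using True by (simp add: W_def power2_eq_square)
    next
      case False
      then have "card W \<le> k" using roots_mod_prime_bound[OF p, of k w] k by (simp add: W_def)
      also have "\<dots> \<le> k\<^sup>2" using k by (simp add: power2_eq_square)
      finally show ?thesis .
    qed
    show ?thesis
    proof (rule that[OF Wfin Wcard, of f])
      fix x y assume x: "\<not> int p dvd x" and h: "int p ^ e dvd A * x ^ k - B * y ^ k"
      have x': "\<not> P dvd x" using x by (simp add: P_def)
      obtain y' where y': "y = P ^ v * y'" "\<not> P dvd y'" "\<alpha> = k * v" "P ^ (e - \<alpha>) dvd A' * x ^ k - B * y' ^ k"
        using reduce[of x y] x h by (auto simp: P_def)
      define r where "r = f (x, y)"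
      have r: "r < p ^ c" "[int r * x = y'] (mod P ^ c)" using fR[OF x', of y] P0 y' unfolding R_def r_def by auto
      show "f (x, y) \<in> W"
      proof (cases "p dvd k")
        case True
        then show ?thesis using r by (simp add: W_def r_def)
      next
        case pk: False
        then have "multiplicity P (int k) = 0" by (intro not_dvd_imp_multiplicity_0) (simp add: P_def)
        then have c1: "c = 1" by (simp add: c_def)
        have "P dvd P ^ (e - \<alpha>)" using \<alpha>e by simp
        then have "[A' * x ^ k = B * y' ^ k] (mod P)" using y'(4) by (meson cong_iff_dvd_diff dvd_trans)
        moreover have "[B * (int r * x) ^ k = B * y' ^ k] (mod P)" using r c1 by (intro cong_mult cong_pow cong_refl) simp
        ultimately have "[A' * x ^ k = B * int r ^ k * x ^ k] (mod P)"
          by (metis cong_sym cong_trans mult.assoc power_mult_distrib)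
        moreover have "coprime (x ^ k) P" using P x' by (metis coprime_commute coprime_power_right_iff prime_imp_coprime)
        ultimately have "[A' = B * int r ^ k] (mod P)" using cong_mult_rcancel by blast
        then have "[int w * B = int r ^ k * B] (mod P)" using w by (metis cong_trans mult.commute)
        moreover have "coprime B P" using copB[of 1] by (simp add: coprime_commute)
        ultimately have "[int w = int r ^ k] (mod P)" using cong_mult_rcancel by blast
        then have "[w = r ^ k] (mod p)" by (simp add: P_def cong_int_iff flip: of_nat_power)
        then show ?thesis using r pk c1 by (simp add: W_def r_def cong_sym_eq)
      qed
    next
      fix x y x2 y2
      assume x: "\<not> int p dvd x" and h: "int p ^ e dvd A * x ^ k - B * y ^ k"
        and x2: "\<not> int p dvd x2" and h2: "int p ^ e dvd A * x2 ^ k - B * y2 ^ k"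
        and same: "f (x, y) = f (x2, y2)"
      obtain y' where y': "y = P ^ v * y'" "\<not> P dvd y'" "\<alpha> = k * v" "P ^ (e - \<alpha>) dvd A' * x ^ k - B * y' ^ k"
        using reduce[of x y] x h by (auto simp: P_def)
      obtain y2' where y2': "y2 = P ^ v * y2'" "\<not> P dvd y2'" "P ^ (e - \<alpha>) dvd A' * x2 ^ k - B * y2' ^ k"
        using reduce[of x2 y2] x2 h2 by (auto simp: P_def)
      define r where "r = f (x, y)"
      have r: "[int r * x = y'] (mod P ^ c)" using fR[of x y] x P0 y' unfolding R_def r_def P_def[symmetric] by auto
      have r2: "[int r * x2 = y2'] (mod P ^ c)" using fR[of x2 y2] x2 P0 y2' same unfolding R_def r_def P_def[symmetric] by auto
      define z1 where "z1 = x * y2'"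
      define z2 where "z2 = x2 * y'"
      have "[z1 = x * (int r * x2)] (mod P ^ c)" unfolding z1_def using r2 by (intro cong_mult cong_refl) (simp add: cong_sym)
      moreover have "[z2 = x2 * (int r * x)] (mod P ^ c)" unfolding z2_def using r by (intro cong_mult cong_refl) (simp add: cong_sym)
      ultimately have "[z1 = z2] (mod P ^ c)" by (metis cong_sym cong_trans mult.commute mult.left_commute)
      then have close: "P ^ c dvd z1 - z2" by (simp add: cong_iff_dvd_diff)
      have "[A' * x ^ k = B * y' ^ k] (mod P ^ (e - \<alpha>))" "[A' * x2 ^ k = B * y2' ^ k] (mod P ^ (e - \<alpha>))"
        using y'(4) y2'(3) by (auto simp: cong_iff_dvd_diff)
      then have "[(A' * x ^ k) * (B * y2' ^ k) = (B * y' ^ k) * (A' * x2 ^ k)] (mod P ^ (e - \<alpha>))"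
        by (rule cong_mult[OF _ cong_sym])
      moreover have "(A' * x ^ k) * (B * y2' ^ k) = (A' * B) * z1 ^ k" "(B * y' ^ k) * (A' * x2 ^ k) = (A' * B) * z2 ^ k"
        by (simp_all only: z1_def z2_def power_mult_distrib mult_ac)
      ultimately have "[(A' * B) * z1 ^ k = (A' * B) * z2 ^ k] (mod P ^ (e - \<alpha>))" by (simp only:)
      moreover have "coprime (A' * B) (P ^ (e - \<alpha>))"
      proof -
        have "coprime A' P" using prime_imp_coprime[OF P A'(2)] by (simp add: coprime_commute)
        moreover have "coprime B P" using copB[of 1] by (simp add: coprime_commute)
        ultimately show ?thesis by simp
      qed
      ultimately have "[z1 ^ k = z2 ^ k] (mod P ^ (e - \<alpha>))" using cong_mult_lcancel by blast
      then have "P ^ (e - \<alpha>) dvd z1 ^ k - z2 ^ k" by (simp add: cong_iff_dvd_diff)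
      moreover have "\<not> P dvd z1" using x y2' P by (simp add: z1_def P_def prime_dvd_mult_iff)
      ultimately have "P ^ (e - \<alpha>) dvd int k * (z1 - z2)"
        using lifting_difference_of_powers[OF P k] close unfolding c_def by blast
      then have "P ^ v * P ^ (e - \<alpha>) dvd P ^ v * (int k * (z1 - z2))" by (rule mult_dvd_mono[OF dvd_refl])
      also have "P ^ v * (int k * (z1 - z2)) = int k * (x * y2 - x2 * y)"
        by (simp add: z1_def z2_def y' y2' algebra_simps)
      finally have "(P ^ v * P ^ (e - \<alpha>)) ^ k dvd (int k * (x * y2 - x2 * y)) ^ k" by (rule dvd_power_same)
      moreover have "(P ^ \<alpha>) ^ (k - 1) dvd A ^ (k - 1)" using A'(1) by (intro dvd_power_same) simp
      ultimately have "(P ^ \<alpha>) ^ (k - 1) * (P ^ v * P ^ (e - \<alpha>)) ^ k dvd A ^ (k - 1) * (int k * (x * y2 - x2 * y)) ^ k"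
        by (intro mult_dvd_mono)
      moreover have "(P ^ \<alpha>) ^ (k - 1) * (P ^ v * P ^ (e - \<alpha>)) ^ k = P ^ (k * e)"
      proof -
        obtain d where d: "e = \<alpha> + d" using \<alpha>e less_imp_add_positive by blast
        obtain j where j: "k = Suc j" using k by (cases k) auto
        have "\<alpha> * (k - 1) + (v + (e - \<alpha>)) * k = k * e" unfolding d y'(3) j by (simp add: algebra_simps)
        then show ?thesis by (simp flip: power_mult power_add)
      qed
      ultimately show "int p ^ (k * e) dvd A ^ (k - 1) * int k ^ k * (x * y2 - x2 * y) ^ k"
        by (simp add: P_def power_mult_distrib mult_ac)
    qed
  qed
qed

text \<open>If \<open>p\<close> divides \<open>H\<close> and \<open>x\<close>, it divides \<open>B y\<^sup>k\<close>, hence \<open>y\<close>. So \<open>p\<close> is prime to \<open>x\<close>.\<close>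

lemma coprime_root_classes_at_prime:
  fixes p :: nat and A B H :: int
  assumes p: "prime p" and k: "k \<ge> 1" and A: "A \<noteq> 0" and B: "\<not> int p dvd B"
    and e: "e \<ge> 1" and H: "int p ^ e dvd H"
  shows "\<exists>(f :: int \<times> int \<Rightarrow> nat) W. finite W \<and> card W \<le> k\<^sup>2 \<and>
    (\<forall>x y. coprime x y \<longrightarrow> A * x ^ k - B * y ^ k = H \<longrightarrow> f (x, y) \<in> W) \<and>
    (\<forall>x y x' y'. coprime x y \<longrightarrow> A * x ^ k - B * y ^ k = H \<longrightarrow> coprime x' y' \<longrightarrow> A * x' ^ k - B * y' ^ k = H \<longrightarrow>
       f (x, y) = f (x', y') \<longrightarrow> int p ^ (k * e) dvd A ^ (k - 1) * int k ^ k * (x * y' - x' * y) ^ k)"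
proof -
  have P: "prime (int p)" using p by simp
  obtain f :: "int \<times> int \<Rightarrow> nat" and W where f: "finite W" "card W \<le> k\<^sup>2"
    "\<And>x y. \<not> int p dvd x \<Longrightarrow> int p ^ e dvd A * x ^ k - B * y ^ k \<Longrightarrow> f (x, y) \<in> W"
    "\<And>x y x' y'. \<not> int p dvd x \<Longrightarrow> int p ^ e dvd A * x ^ k - B * y ^ k \<Longrightarrow>
       \<not> int p dvd x' \<Longrightarrow> int p ^ e dvd A * x' ^ k - B * y' ^ k \<Longrightarrow> f (x, y) = f (x', y') \<Longrightarrow>
       int p ^ (k * e) dvd A ^ (k - 1) * int k ^ k * (x * y' - x' * y) ^ k"
    using root_classes_at_prime[OF p k A B e] by metis
  have nd: "\<not> int p dvd x" if xy: "coprime x y" "A * x ^ k - B * y ^ k = H" for x y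
  proof
    assume d: "int p dvd x"
    have pH: "int p dvd H" using e H by (auto intro: dvd_trans[OF dvd_power])
    have "int p dvd A * x ^ k" using d k by (simp add: dvd_mult dvd_trans[OF _ dvd_power])
    then have "int p dvd B * y ^ k" using xy pH by (metis dvd_diff_right_iff)
    then have "int p dvd y" using B P by (metis prime_dvd_mult_iff prime_dvd_power)
    then show False using d xy P by (meson coprime_common_divisor not_prime_unit)
  qed
  show ?thesis using f nd H by (intro exI[of _ f] exI[of _ W]) auto
qed

text \<open>A prime dividing \<open>H\<close> cannot divide both \<open>A\<close> and \<open>B\<close>, and exchanging the roles of \<open>(A, x)\<close> and \<open>(B, y)\<close>
reduces to the case that it does not divide \<open>B\<close>. The classes at the individual primes are then
combined.\<close>

lemma root_classes:
  fixes A B H :: int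
  assumes k: "k \<ge> 1" and A: "A \<noteq> 0" "B \<noteq> 0" "coprime A B" and H: "H \<noteq> 0"
  obtains F :: "int \<times> int \<Rightarrow> nat \<Rightarrow> nat" and \<W> where "finite \<W>" "card \<W> \<le> (k\<^sup>2) ^ card (prime_factors (nat \<bar>H\<bar>))"
    "\<And>x y. coprime x y \<Longrightarrow> A * x ^ k - B * y ^ k = H \<Longrightarrow> F (x, y) \<in> \<W>"
    "\<And>x y x' y'. coprime x y \<Longrightarrow> A * x ^ k - B * y ^ k = H \<Longrightarrow> coprime x' y' \<Longrightarrow> A * x' ^ k - B * y' ^ k = H \<Longrightarrow>
       F (x, y) = F (x', y') \<Longrightarrow> H ^ k dvd (A * B) ^ (k - 1) * int k ^ k * (x * y' - x' * y) ^ k"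
proof -
  define PF where "PF = prime_factors (nat \<bar>H\<bar>)"
  define e where "e p = multiplicity p (nat \<bar>H\<bar>)" for p
  define Sol where "Sol x y \<longleftrightarrow> coprime x y \<and> A * x ^ k - B * y ^ k = H" for x y
  define good where "good p f W \<longleftrightarrow> finite W \<and> card W \<le> k\<^sup>2 \<and> (\<forall>x y. Sol x y \<longrightarrow> f (x, y) \<in> W) \<and>
     (\<forall>x y x' y'. Sol x y \<longrightarrow> Sol x' y' \<longrightarrow> f (x, y) = f (x', y') \<longrightarrow>
        int p ^ (k * e p) dvd (A * B) ^ (k - 1) * int k ^ k * (x * y' - x' * y) ^ k)"
    for p and f :: "int \<times> int \<Rightarrow> nat" and W :: "nat set"
  have "\<exists>f W. good p f W" if p: "p \<in> PF" for p
  proof -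
    have pp: "prime p" and pH: "int p dvd H" using p H by (auto simp: PF_def prime_factors_dvd)
    have P: "prime (int p)" using pp by simp
    have e1: "e p \<ge> 1" unfolding e_def using p pp H
      by (intro multiplicity_geI) (auto simp: PF_def prime_factors_dvd)
    have "p ^ e p dvd nat \<bar>H\<bar>" unfolding e_def by (rule multiplicity_dvd)
    then have peH: "int p ^ e p dvd H" by (metis abs_dvd_iff dvd_abs_iff int_dvd_int_iff nat_0_le abs_ge_zero of_nat_power)
    show ?thesis
    proof (cases "int p dvd B")
      case False
      obtain f :: "int \<times> int \<Rightarrow> nat" and W where f: "finite W" "card W \<le> k\<^sup>2" "\<forall>x y. Sol x y \<longrightarrow> f (x, y) \<in> W"
        "\<forall>x y x' y'. Sol x y \<longrightarrow> Sol x' y' \<longrightarrow> f (x, y) = f (x', y') \<longrightarrow>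
          int p ^ (k * e p) dvd A ^ (k - 1) * int k ^ k * (x * y' - x' * y) ^ k"
        using coprime_root_classes_at_prime[OF pp k A(1) False e1 peH] unfolding Sol_def by blast
      have "A ^ (k - 1) * int k ^ k * D dvd (A * B) ^ (k - 1) * int k ^ k * D" for D
        by (intro mult_dvd_mono dvd_power_same dvd_refl) simp
      then have "good p f W" unfolding good_def using f by (blast intro: dvd_trans)
      then show ?thesis by blast
    next
      case True
      then have False': "\<not> int p dvd A" using A(3) P by (meson coprime_common_divisor not_prime_unit)
      have swap: "Sol x y \<longleftrightarrow> coprime y x \<and> B * y ^ k - A * x ^ k = - H" for x y
        by (auto simp: Sol_def coprime_commute)
      obtain f :: "int \<times> int \<Rightarrow> nat" and W where f: "finite W" "card W \<le> k\<^sup>2" "\<forall>y x. Sol x y \<longrightarrow> f (y, x) \<in> W"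
        "\<forall>y x y' x'. Sol x y \<longrightarrow> Sol x' y' \<longrightarrow> f (y, x) = f (y', x') \<longrightarrow>
          int p ^ (k * e p) dvd B ^ (k - 1) * int k ^ k * (y * x' - y' * x) ^ k"
        using coprime_root_classes_at_prime[OF pp k A(2) False' e1, of "- H"] peH unfolding swap dvd_minus_iff by blast
      have up: "B ^ (k - 1) * int k ^ k * (y * x' - y' * x) ^ k dvd (A * B) ^ (k - 1) * int k ^ k * (x * y' - x' * y) ^ k"
        for x y x' y'
      proof (intro mult_dvd_mono dvd_power_same)
        have "y * x' - y' * x = - (x * y' - x' * y)" by (simp add: algebra_simps)
        then show "y * x' - y' * x dvd x * y' - x' * y" by (simp only: minus_dvd_iff dvd_refl)
      qed auto
      have "good p (\<lambda>(x, y). f (y, x)) W" unfolding good_def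
      proof (intro conjI allI impI)
        fix x y x' y' assume "Sol x y" "Sol x' y'" "(case (x, y) of (x, y) \<Rightarrow> f (y, x)) = (case (x', y') of (x, y) \<Rightarrow> f (y, x))"
        then have "int p ^ (k * e p) dvd B ^ (k - 1) * int k ^ k * (y * x' - y' * x) ^ k" using f(4) by simp
        then show "int p ^ (k * e p) dvd (A * B) ^ (k - 1) * int k ^ k * (x * y' - x' * y) ^ k"
          using up by (rule dvd_trans)
      qed (use f in auto)
      then show ?thesis by blast
    qed
  qed
  then obtain f W where fW: "\<And>p. p \<in> PF \<Longrightarrow> good p (f p) (W p)" by metis
  define F where "F z = restrict (\<lambda>p. f p z) PF" for z
  have finPF: "finite PF" by (simp add: PF_def)
  show ?thesis
  proof (rule that[of "PiE PF W" F])
    show "finite (PiE PF W)" using fW finPF by (intro finite_PiE) (auto simp: good_def)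
    have "card (PiE PF W) = (\<Prod>p\<in>PF. card (W p))" by (rule card_PiE[OF finPF])
    also have "\<dots> \<le> (\<Prod>p\<in>PF. k\<^sup>2)" using fW by (intro prod_mono) (auto simp: good_def)
    also have "\<dots> = (k\<^sup>2) ^ card PF" by simp
    finally show "card (PiE PF W) \<le> (k\<^sup>2) ^ card (prime_factors (nat \<bar>H\<bar>))" by (simp add: PF_def)
    show "F (x, y) \<in> PiE PF W" if "coprime x y" "A * x ^ k - B * y ^ k = H" for x y
      using fW that by (auto simp: F_def good_def Sol_def)
    fix x y x' y'
    assume h: "coprime x y" "A * x ^ k - B * y ^ k = H" "coprime x' y'" "A * x' ^ k - B * y' ^ k = H" "F (x, y) = F (x', y')"
    define N where "N = (A * B) ^ (k - 1) * int k ^ k * (x * y' - x' * y) ^ k"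
    have dvd: "int p ^ (k * e p) dvd N" if "p \<in> PF" for p
    proof -
      have "f p (x, y) = f p (x', y')" using fun_cong[OF h(5), of p] that by (simp add: F_def)
      then show ?thesis using fW[OF that] h unfolding good_def Sol_def N_def by blast
    qed
    have "H ^ k dvd N"
    proof (cases "N = 0")
      case False
      show ?thesis
      proof (rule multiplicity_le_imp_dvd)
        fix P :: int assume P: "prime P"
        define m where "m = multiplicity P H"
        have mk: "multiplicity P (H ^ k) = k * m" unfolding m_def
          by (rule prime_elem_multiplicity_power_distrib[OF prime_imp_prime_elem[OF P] H])
        have unit: "\<not> is_unit P" using P not_prime_unit by blast
        obtain q where q: "P = int q" using P prime_ge_0_int zero_le_imp_eq_int by blast
        have pq: "prime q" using P q by simp
        have "P ^ (k * m) dvd N"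
        proof (cases "m = 0")
          case False
          have "P ^ m dvd H" unfolding m_def by (rule multiplicity_dvd)
          then have qm: "q ^ m dvd nat \<bar>H\<bar>" unfolding q
            by (metis abs_ge_zero dvd_abs_iff int_dvd_int_iff nat_0_le of_nat_power)
          then have "q dvd nat \<bar>H\<bar>" using False by (meson dvd_power dvd_trans not_gr_zero)
          then have qPF: "q \<in> PF" using pq H by (auto simp: PF_def prime_factors_dvd)
          have "m \<le> e q" unfolding e_def using qm pq H by (intro multiplicity_geI) auto
          then have "P ^ (k * m) dvd P ^ (k * e q)" by (intro le_imp_power_dvd) simp
          then show ?thesis using dvd[OF qPF] unfolding q by (rule dvd_trans)
        qed auto
        then show "multiplicity P (H ^ k) \<le> multiplicity P N" unfolding mk
          using False unit by (intro multiplicity_geI) auto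
      qed (use H in simp)
    qed auto
    then show "H ^ k dvd (A * B) ^ (k - 1) * int k ^ k * (x * y' - x' * y) ^ k" by (simp add: N_def)
  qed
qed

section \<open>Solutions in one class grow quickly\<close>

text \<open>Write \<open>s = |x|\<^sup>k / B\<close> and \<open>t = |y|\<^sup>k / A\<close> and let
\<open>\<delta>\<close> be the common increment of \<open>x\<^sup>k / B\<close> and \<open>y\<^sup>k / A\<close>. Then \<open>(x\<^sub>1 y\<^sub>2)\<^sup>k - (x\<^sub>2 y\<^sub>1)\<^sup>k = H \<delta>\<close>, and the
lower bound for the determinant cancels \<open>H\<close>, leaving \<open>max(s\<^sub>1 t\<^sub>2, s\<^sub>2 t\<^sub>1)^(k-1) \<lesssim> |\<delta>|^k\<close>. Since
\<open>|\<delta>| \<le> 2 s\<^sub>2\<close> and \<open>|\<delta>| \<le> 2 max(t\<^sub>1, t\<^sub>2)\<close>, the gap follows whichever of \<open>t\<^sub>1\<close> and \<open>t\<^sub>2\<close> is larger.\<close>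

lemma same_class_gap:
  fixes A B H x1 y1 x2 y2 :: int
  assumes k: "k \<ge> 2" and A: "A > 0" "B > 0" and H: "H \<noteq> 0"
    and sol: "A * x1 ^ k - B * y1 ^ k = H" "A * x2 ^ k - B * y2 ^ k = H"
    and sgn: "odd k \<or> (x1 \<ge> 0 \<and> y1 \<ge> 0 \<and> x2 \<ge> 0 \<and> y2 \<ge> 0)"
    and D: "x1 * y2 - x2 * y1 \<noteq> 0"
    and dvd: "H ^ k dvd (A * B) ^ (k - 1) * int k ^ k * (x1 * y2 - x2 * y1) ^ k"
    and le: "\<bar>x1\<bar> ^ k \<le> \<bar>x2\<bar> ^ k"
  shows "(real_of_int (\<bar>x1\<bar> ^ k) / B) ^ (k - 1) \<le> (4 * real k) ^ k * (real_of_int (\<bar>x2\<bar> ^ k) / B)"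
proof -
  define a where "a = real_of_int A"
  define b where "b = real_of_int B"
  define h where "h = real_of_int H"
  define u1 where "u1 = real_of_int x1"
  define v1 where "v1 = real_of_int y1"
  define u2 where "u2 = real_of_int x2"
  define v2 where "v2 = real_of_int y2"
  define d where "d = u1 * v2 - u2 * v1"
  define s1 where "s1 = \<bar>u1\<bar> ^ k / b"
  define s2 where "s2 = \<bar>u2\<bar> ^ k / b"
  define t1 where "t1 = \<bar>v1\<bar> ^ k / a"
  define t2 where "t2 = \<bar>v2\<bar> ^ k / a"
  define \<delta> where "\<delta> = (u2 ^ k - u1 ^ k) / b"
  have ab: "a > 0" "b > 0" using A by (auto simp: a_def b_def)
  have s0: "s1 \<ge> 0" "s2 \<ge> 0" "t1 \<ge> 0" "t2 \<ge> 0" using ab by (auto simp: s1_def s2_def t1_def t2_def)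
  have rs: "a * u1 ^ k - b * v1 ^ k = h" "a * u2 ^ k - b * v2 ^ k = h"
    unfolding a_def b_def u1_def u2_def v1_def v2_def h_def
    using arg_cong[OF sol(1), of real_of_int] arg_cong[OF sol(2), of real_of_int] by simp_all
  have \<delta>': "\<delta> = (v2 ^ k - v1 ^ k) / a"
  proof -
    have "a * (u2 ^ k - u1 ^ k) = b * (v2 ^ k - v1 ^ k)" using rs by (simp add: algebra_simps)
    then show ?thesis using ab by (simp add: \<delta>_def field_simps)
  qed
  have XY: "(u1 * v2) ^ k - (u2 * v1) ^ k = h * \<delta>"
  proof -
    have "a * ((u1 * v2) ^ k - (u2 * v1) ^ k) = (a * u1 ^ k) * v2 ^ k - (a * u2 ^ k) * v1 ^ k"
      by (simp add: power_mult_distrib algebra_simps)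
    also have "\<dots> = (h + b * v1 ^ k) * v2 ^ k - (h + b * v2 ^ k) * v1 ^ k"
      using rs by (simp add: algebra_simps)
    also have "\<dots> = h * (v2 ^ k - v1 ^ k)" by (simp add: algebra_simps)
    finally show ?thesis unfolding \<delta>' using ab by (simp add: field_simps)
  qed
  have hd: "\<bar>h\<bar> ^ k \<le> (a * b) ^ (k - 1) * real k ^ k * \<bar>d\<bar> ^ k"
  proof -
    have "(A * B) ^ (k - 1) * int k ^ k * (x1 * y2 - x2 * y1) ^ k \<noteq> 0" using A k D by simp
    then have "\<bar>H ^ k\<bar> \<le> \<bar>(A * B) ^ (k - 1) * int k ^ k * (x1 * y2 - x2 * y1) ^ k\<bar>"
      using dvd by (rule dvd_imp_le_int)
    then have "real_of_int \<bar>H ^ k\<bar> \<le> real_of_int \<bar>(A * B) ^ (k - 1) * int k ^ k * (x1 * y2 - x2 * y1) ^ k\<bar>"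
      by (simp only: of_int_le_iff)
    then show ?thesis using A
      by (simp add: a_def b_def h_def d_def u1_def u2_def v1_def v2_def abs_mult power_abs)
  qed
  have d0: "\<bar>d\<bar> > 0"
  proof -
    have "d = real_of_int (x1 * y2 - x2 * y1)" by (simp add: d_def u1_def u2_def v1_def v2_def)
    then show ?thesis using D by (simp only: of_int_eq_0_iff zero_less_abs_iff) simp
  qed
  have pos: "odd k \<or> (u1 * v2 \<ge> 0 \<and> u2 * v1 \<ge> 0)"
    using sgn by (auto simp: u1_def u2_def v1_def v2_def)
  have up1: "\<bar>d\<bar> * \<bar>u1 * v2\<bar> ^ (k - 1) \<le> 2 * (\<bar>h\<bar> * \<bar>\<delta>\<bar>)"
    using abs_diff_mult_power_le[of k "u1 * v2" "u2 * v1"] k pos unfolding XY d_def by (simp add: abs_mult)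
  have up2: "\<bar>d\<bar> * \<bar>u2 * v1\<bar> ^ (k - 1) \<le> 2 * (\<bar>h\<bar> * \<bar>\<delta>\<bar>)"
  proof -
    have "\<bar>u2 * v1 - u1 * v2\<bar> * \<bar>u2 * v1\<bar> ^ (k - 1) \<le> 2 * \<bar>(u2 * v1) ^ k - (u1 * v2) ^ k\<bar>"
      using k pos by (intro abs_diff_mult_power_le) auto
    also have "\<bar>(u2 * v1) ^ k - (u1 * v2) ^ k\<bar> = \<bar>h\<bar> * \<bar>\<delta>\<bar>"
      using XY by (metis abs_minus_commute abs_mult)
    finally show ?thesis by (simp add: d_def abs_minus_commute)
  qed
  \<comment> \<open>The \<open>k\<close>-th power of the bound is compared with the lower bound for \<open>|d|\<^sup>k\<close>; this removes \<open>h\<close> and \<open>d\<close>.\<close>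
  have raise: "(s * t) ^ (k - 1) \<le> (2 * real k) ^ k * \<bar>\<delta>\<bar> ^ k"
    if up: "\<bar>d\<bar> * \<bar>w\<bar> ^ (k - 1) \<le> 2 * (\<bar>h\<bar> * \<bar>\<delta>\<bar>)" and w: "\<bar>w\<bar> ^ k = (a * b) * (s * t)" for w s t :: real
  proof -
    have "\<bar>d\<bar> ^ k * ((a * b) ^ (k - 1) * (s * t) ^ (k - 1)) = (\<bar>d\<bar> * \<bar>w\<bar> ^ (k - 1)) ^ k"
    proof -
      have "(\<bar>w\<bar> ^ (k - 1)) ^ k = (\<bar>w\<bar> ^ k) ^ (k - 1)" by (simp only: power_mult[symmetric] mult.commute)
      then show ?thesis by (simp only: power_mult_distrib w)
    qed
    also have "\<dots> \<le> (2 * (\<bar>h\<bar> * \<bar>\<delta>\<bar>)) ^ k" using up by (intro power_mono) auto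
    also have "\<dots> = 2 ^ k * \<bar>\<delta>\<bar> ^ k * \<bar>h\<bar> ^ k" by (simp add: power_mult_distrib)
    also have "\<dots> \<le> 2 ^ k * \<bar>\<delta>\<bar> ^ k * ((a * b) ^ (k - 1) * real k ^ k * \<bar>d\<bar> ^ k)"
      using hd by (intro mult_left_mono) auto
    also have "\<dots> = \<bar>d\<bar> ^ k * ((a * b) ^ (k - 1) * ((2 * real k) ^ k * \<bar>\<delta>\<bar> ^ k))"
      by (simp only: power_mult_distrib mult_ac)
    finally show ?thesis using d0 ab by simp
  qed
  have w1: "\<bar>u1 * v2\<bar> ^ k = (a * b) * (s1 * t2)" and w2: "\<bar>u2 * v1\<bar> ^ k = (a * b) * (s2 * t1)"
    using ab by (simp_all add: s1_def s2_def t1_def t2_def abs_mult power_mult_distrib)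
  have r1: "(s1 * t2) ^ (k - 1) \<le> (2 * real k) ^ k * \<bar>\<delta>\<bar> ^ k" using raise[OF up1 w1] .
  have r2: "(s2 * t1) ^ (k - 1) \<le> (2 * real k) ^ k * \<bar>\<delta>\<bar> ^ k" using raise[OF up2 w2] .
  have s12: "s1 \<le> s2"
  proof -
    have "\<bar>u1\<bar> ^ k \<le> \<bar>u2\<bar> ^ k"
    proof -
      have "real_of_int (\<bar>x1\<bar> ^ k) \<le> real_of_int (\<bar>x2\<bar> ^ k)" using le by (simp only: of_int_le_iff)
      then show ?thesis by (simp add: u1_def u2_def)
    qed
    then show ?thesis unfolding s1_def s2_def using ab by (intro divide_right_mono) auto
  qed
  have tri: "\<bar>(p ^ k - q ^ k) / c\<bar> \<le> \<bar>q\<bar> ^ k / c + \<bar>p\<bar> ^ k / c" if c: "c > 0" for p q c :: real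
  proof -
    have "\<bar>p ^ k - q ^ k\<bar> \<le> \<bar>q\<bar> ^ k + \<bar>p\<bar> ^ k"
      using abs_triangle_ineq4[of "p ^ k" "q ^ k"] by (simp add: power_abs)
    then have "\<bar>p ^ k - q ^ k\<bar> / c \<le> (\<bar>q\<bar> ^ k + \<bar>p\<bar> ^ k) / c" using c by (intro divide_right_mono) auto
    then show ?thesis using c by (simp add: abs_divide add_divide_distrib)
  qed
  have \<delta>s: "\<bar>\<delta>\<bar> \<le> 2 * s2"
  proof -
    have "\<bar>\<delta>\<bar> \<le> s1 + s2" unfolding \<delta>_def s1_def s2_def by (rule tri[OF ab(2)])
    then show ?thesis using s12 by simp
  qed
  have \<delta>t: "\<bar>\<delta>\<bar> \<le> 2 * max t1 t2"
  proof -
    have "\<bar>\<delta>\<bar> \<le> t1 + t2" unfolding \<delta>' t1_def t2_def by (rule tri[OF ab(1)])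
    then show ?thesis by simp
  qed
  have \<delta>0: "\<bar>\<delta>\<bar> > 0"
  proof (rule ccontr)
    assume "\<not> \<bar>\<delta>\<bar> > 0"
    then have "\<bar>d\<bar> * \<bar>u1 * v2\<bar> ^ (k - 1) \<le> 0" "\<bar>d\<bar> * \<bar>u2 * v1\<bar> ^ (k - 1) \<le> 0" using up1 up2 by auto
    moreover have "w = 0" if "\<bar>d\<bar> * \<bar>w\<bar> ^ (k - 1) \<le> 0" for w
    proof (rule ccontr)
      assume "w \<noteq> 0"
      then have "0 < \<bar>d\<bar> * \<bar>w\<bar> ^ (k - 1)" using d0 by (intro mult_pos_pos zero_less_power) auto
      then show False using that by simp
    qed
    ultimately have "u1 * v2 = 0" "u2 * v1 = 0" by blast+
    then have "d = 0" unfolding d_def by (simp only: diff_self)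
    then show False using d0 by simp
  qed
  have \<delta>k: "\<bar>\<delta>\<bar> ^ k \<le> (2 * s2) * (2 * t) ^ (k - 1)" if "max t1 t2 = t" for t
  proof -
    have "\<bar>\<delta>\<bar> ^ k = \<bar>\<delta>\<bar> * \<bar>\<delta>\<bar> ^ (k - 1)" using k by (cases k) auto
    also have "\<dots> \<le> (2 * s2) * (2 * t) ^ (k - 1)" using \<delta>s \<delta>t that s0 by (intro mult_mono power_mono) auto
    finally show ?thesis .
  qed
  have fin: "s ^ (k - 1) \<le> (4 * real k) ^ k * s2"
    if r: "(s * t) ^ (k - 1) \<le> (2 * real k) ^ k * \<bar>\<delta>\<bar> ^ k" and t: "max t1 t2 = t" for s t
  proof -
    have t0: "t > 0" using \<delta>0 \<delta>t t by linarith
    have "s ^ (k - 1) * t ^ (k - 1) = (s * t) ^ (k - 1)" by (simp only: power_mult_distrib)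
    also note r
    also have "(2 * real k) ^ k * \<bar>\<delta>\<bar> ^ k \<le> (2 * real k) ^ k * ((2 * s2) * (2 * t) ^ (k - 1))"
      by (intro mult_left_mono \<delta>k[OF t]) simp
    also have "\<dots> = ((4 * real k) ^ k * s2) * t ^ (k - 1)"
    proof -
      have q: "(4 * real k) ^ k = (2 * real k) ^ k * (2 * 2 ^ (k - 1))"
      proof -
        have "2 * (2::real) ^ (k - 1) = 2 ^ k" using k by (cases k) auto
        moreover have "4 * real k = (2 * real k) * 2" by simp
        ultimately show ?thesis by (simp only: power_mult_distrib)
      qed
      show ?thesis unfolding q power_mult_distrib[of 2 t] by (simp only: mult_ac)
    qed
    finally show ?thesis using t0 by simp
  qed
  have "s1 ^ (k - 1) \<le> (4 * real k) ^ k * s2"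
  proof (cases "t1 \<le> t2")
    case True
    then show ?thesis using fin[OF r1] by (simp add: max_def)
  next
    case False
    then have "s2 ^ (k - 1) \<le> (4 * real k) ^ k * s2" using fin[OF r2] by (simp add: max_def)
    moreover have "s1 ^ (k - 1) \<le> s2 ^ (k - 1)" using s12 s0 by (intro power_mono) auto
    ultimately show ?thesis by simp
  qed
  then show ?thesis by (simp add: s1_def s2_def u1_def u2_def b_def)
qed

lemma coprime_solutions_not_proportional:
  fixes A B H x1 y1 x2 y2 :: int
  assumes H: "H \<noteq> 0"
    and sol: "A * x1 ^ k - B * y1 ^ k = H" "A * x2 ^ k - B * y2 ^ k = H"
    and sgn: "odd k \<or> (x1 \<ge> 0 \<and> y1 \<ge> 0 \<and> x2 \<ge> 0 \<and> y2 \<ge> 0)"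
    and cop: "coprime x1 y1" "coprime x2 y2" and ne: "(x1, y1) \<noteq> (x2, y2)"
  shows "x1 * y2 - x2 * y1 \<noteq> 0"
proof
  assume "x1 * y2 - x2 * y1 = 0"
  then have e: "x1 * y2 = x2 * y1" by simp
  have "x1 dvd x2 * y1" "x2 dvd x1 * y2" "y1 dvd x1 * y2" "y2 dvd x2 * y1"
    by (simp_all add: e) (simp_all flip: e)
  then have "x1 dvd x2" "x2 dvd x1" "y1 dvd y2" "y2 dvd y1"
    using cop by (simp_all add: coprime_dvd_mult_left_iff coprime_dvd_mult_right_iff coprime_commute)
  then have ax: "\<bar>x1\<bar> = \<bar>x2\<bar>" and ay: "\<bar>y1\<bar> = \<bar>y2\<bar>" by (auto intro: zdvd_antisym_abs)
  have cases: "(x2 = x1 \<or> x2 = - x1) \<and> (y2 = y1 \<or> y2 = - y1)" using ax ay by (auto simp: abs_eq_iff)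
  show False
  proof (cases "odd k")
    case True
    have neg: False if "x2 = - x1" "y2 = - y1" using sol True H that by auto
    have "x1 = 0 \<or> y1 = 0 \<or> (x2 = x1 \<and> y2 = y1) \<or> (x2 = - x1 \<and> y2 = - y1)" using cases e by auto
    then show False using cases neg ne by auto
  next
    case False
    then show False using sgn ax ay ne by auto
  qed
qed

lemma card_le_log_if_doubling:
  fixes f :: "'a \<Rightarrow> real"
  assumes range: "\<And>x. x \<in> S \<Longrightarrow> 1 \<le> f x \<and> f x \<le> R"
    and dbl: "\<And>x y. x \<in> S \<Longrightarrow> y \<in> S \<Longrightarrow> x \<noteq> y \<Longrightarrow> f x \<le> f y \<Longrightarrow> 2 * f x \<le> f y" and R: "R \<ge> 1"
  shows "real (card S) \<le> log 2 R + 1"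
proof -
  define g where "g x = nat \<lfloor>log 2 (f x)\<rfloor>" for x
  have lg: "0 \<le> log 2 (f x)" if "x \<in> S" for x using range[OF that] by simp
  have ne: "g x \<noteq> g y" if xy: "x \<in> S" "y \<in> S" "x \<noteq> y" "f x \<le> f y" for x y
  proof -
    have "log 2 (f x) + 1 = log 2 (2 * f x)" using range[OF xy(1)] by (simp add: log_mult)
    also have "\<dots> \<le> log 2 (f y)" using dbl[OF xy] range[OF xy(1)] by simp
    finally have "\<lfloor>log 2 (f x)\<rfloor> + 1 \<le> \<lfloor>log 2 (f y)\<rfloor>" by linarith
    moreover have "0 \<le> \<lfloor>log 2 (f x)\<rfloor>" "0 \<le> \<lfloor>log 2 (f y)\<rfloor>" using lg[OF xy(1)] lg[OF xy(2)] by auto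
    ultimately show ?thesis unfolding g_def by (simp add: eq_nat_nat_iff)
  qed
  have "inj_on g S"
  proof (rule inj_onI, rule ccontr)
    fix x y assume h: "x \<in> S" "y \<in> S" "g x = g y" "x \<noteq> y"
    show False using ne[of x y] ne[of y x] h by (cases "f x \<le> f y") auto
  qed
  then have "card S = card (g ` S)" by (simp add: card_image)
  also have "\<dots> \<le> card {..nat \<lfloor>log 2 R\<rfloor>}"
  proof (rule card_mono)
    have "log 2 (f x) \<le> log 2 R" if "x \<in> S" for x
      using range[OF that] R by (subst log_le_cancel_iff) auto
    then show "g ` S \<subseteq> {..nat \<lfloor>log 2 R\<rfloor>}" by (auto simp: g_def intro!: nat_mono floor_mono)
  qed simp
  finally have "card S \<le> nat \<lfloor>log 2 R\<rfloor> + 1" by simp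
  moreover have "real (nat \<lfloor>log 2 R\<rfloor>) \<le> log 2 R" using R by simp
  ultimately show ?thesis by linarith
qed

lemma power_inj_of_sign:
  fixes u v :: int
  assumes "k \<ge> 1" "odd k \<or> (u \<ge> 0 \<and> v \<ge> 0)" "u ^ k = v ^ k"
  shows "u = v"
proof -
  have "\<bar>real_of_int u - real_of_int v\<bar> * \<bar>real_of_int u\<bar> ^ (k - 1) \<le> 2 * \<bar>real_of_int u ^ k - real_of_int v ^ k\<bar>"
    using assms by (intro abs_diff_mult_power_le) auto
  also have "real_of_int u ^ k = real_of_int v ^ k" using assms(3) by (metis of_int_power)
  finally have "\<bar>real_of_int u - real_of_int v\<bar> * \<bar>real_of_int u\<bar> ^ (k - 1) \<le> 0" by simp
  then have "\<bar>real_of_int u - real_of_int v\<bar> * \<bar>real_of_int u\<bar> ^ (k - 1) = 0"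
    by (intro antisym) auto
  then have "u = v \<or> u = 0" by auto
  then show ?thesis using assms by (auto simp: power_0_left)
qed

text \<open>Solutions with \<open>|x|\<^sup>k / B\<close> below a constant are few because all \<open>x\<^sup>k\<close> agree modulo \<open>B\<close>. Beyond that
constant, \<open>|x|\<^sup>k / B\<close> at least doubles from one solution of a class to the next.\<close>

lemma coprime_solution_count:
  fixes A B H :: int and Z :: "(int \<times> int) set" and R :: real
  assumes k: "k \<ge> 3" and A: "A > 0" "B > 0" "coprime A B" and H: "H \<noteq> 0" and R: "R \<ge> 1" and fin: "finite Z"
    and Z: "\<And>x y. (x, y) \<in> Z \<Longrightarrow> coprime x y \<and> A * x ^ k - B * y ^ k = H \<and> (odd k \<or> (x \<ge> 0 \<and> y \<ge> 0)) \<and> real_of_int (\<bar>x\<bar> ^ k) \<le> R"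
  shows "real (card Z) \<le> 4 * (4 * real k) ^ k + real ((k\<^sup>2) ^ card (prime_factors (nat \<bar>H\<bar>))) * (log 2 R + 1)"
proof -
  define K where "K = (4 * k) ^ k"
  have K1: "K \<ge> 1" using k by (simp add: K_def)
  define f where "f = (\<lambda>(x, y::int). real_of_int (\<bar>x\<bar> ^ k) / real_of_int B)"
  define Zs where "Zs = {z\<in>Z. f z < 2 * real K}"
  define Zl where "Zl = {z\<in>Z. 2 * real K \<le> f z}"
  have k1: "k \<ge> 1" and A0: "A \<noteq> 0" "B \<noteq> 0" using k A by auto
  obtain \<W> and F :: "int \<times> int \<Rightarrow> nat \<Rightarrow> nat" where F: "finite \<W>" "card \<W> \<le> (k\<^sup>2) ^ card (prime_factors (nat \<bar>H\<bar>))"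
    "\<And>x y. coprime x y \<Longrightarrow> A * x ^ k - B * y ^ k = H \<Longrightarrow> F (x, y) \<in> \<W>"
    "\<And>x y x' y'. coprime x y \<Longrightarrow> A * x ^ k - B * y ^ k = H \<Longrightarrow> coprime x' y' \<Longrightarrow> A * x' ^ k - B * y' ^ k = H \<Longrightarrow>
       F (x, y) = F (x', y') \<Longrightarrow> H ^ k dvd (A * B) ^ (k - 1) * int k ^ k * (x * y' - x' * y) ^ k"
    by (rule root_classes[OF k1 A0 A(3) H]) (rule that)
  have cs: "real (card Zs) \<le> 4 * real K"
  proof -
    define g where "g = (\<lambda>(x::int, y::int). x ^ k div B)"
    have "inj_on g Zs"
    proof (rule inj_onI, safe)
      fix x1 y1 x2 y2 assume "(x1, y1) \<in> Zs" "(x2, y2) \<in> Zs" and g: "g (x1, y1) = g (x2, y2)"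
      then have z: "A * x1 ^ k - B * y1 ^ k = H" "A * x2 ^ k - B * y2 ^ k = H"
        and sgn: "odd k \<or> (x1 \<ge> 0 \<and> y1 \<ge> 0)" "odd k \<or> (x2 \<ge> 0 \<and> y2 \<ge> 0)" using Z by (auto simp: Zs_def)
      have "A * (x1 ^ k - x2 ^ k) = B * (y1 ^ k - y2 ^ k)" using z by (simp add: algebra_simps)
      then have "B dvd A * (x1 ^ k - x2 ^ k)" by simp
      then have "B dvd x1 ^ k - x2 ^ k" using A(3) by (simp add: coprime_dvd_mult_right_iff coprime_commute)
      then have "x1 ^ k mod B = x2 ^ k mod B" by (simp add: mod_eq_dvd_iff)
      then have xk: "x1 ^ k = x2 ^ k" using g by (metis (mono_tags, lifting) case_prod_conv div_mult_mod_eq g_def)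
      then have "y1 ^ k = y2 ^ k" using z A by auto
      then show "x1 = x2" "y1 = y2" using xk sgn k by (auto intro: power_inj_of_sign[of k])
    qed
    moreover have "g ` Zs \<subseteq> {- (2 * int K)..<2 * int K}"
    proof safe
      fix x y assume "(x, y) \<in> Zs"
      then have "real_of_int (\<bar>x\<bar> ^ k) < 2 * real K * real_of_int B" using A by (simp add: Zs_def f_def pos_divide_less_eq)
      then have "real_of_int (\<bar>x\<bar> ^ k) < real_of_int (2 * int K * B)" by simp
      then have "\<bar>x ^ k\<bar> < 2 * int K * B" by (simp only: of_int_less_iff power_abs)
      then have "x ^ k < (2 * int K) * B" "- (2 * int K) * B \<le> x ^ k" by linarith+
      then have low: "- (2 * int K) * B \<le> x ^ k" and up: "x ^ k < (2 * int K) * B" by auto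
      have "- (2 * int K) = (- (2 * int K) * B) div B"
        using A by (intro nonzero_mult_div_cancel_right[symmetric]) simp
      also have "\<dots> \<le> x ^ k div B" using low A by (intro zdiv_mono1) auto
      finally have "- (2 * int K) \<le> x ^ k div B" .
      moreover have "x ^ k div B * B \<le> x ^ k"
        using div_mult_mod_eq[of "x ^ k" B] pos_mod_sign[of B "x ^ k"] A by linarith
      then have "x ^ k div B * B < (2 * int K) * B" using up by linarith
      then have "x ^ k div B < 2 * int K" using A by (simp add: mult_less_cancel_right)
      ultimately show "g (x, y) \<in> {- (2 * int K)..<2 * int K}" by (simp add: g_def)
    qed
    ultimately have "card Zs \<le> card {- (2 * int K)..<2 * int K}" by (intro card_inj_on_le[of g]) auto
    then show ?thesis by simp
  qed
  have cl: "real (card {z\<in>Zl. F z = c}) \<le> log 2 R + 1" for c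
  proof (rule card_le_log_if_doubling[where f = f, OF _ _ R])
    fix z assume z: "z \<in> {z\<in>Zl. F z = c}"
    obtain x y where xy: "z = (x, y)" by (cases z)
    have "1 \<le> f z" using z K1 by (auto simp: Zl_def)
    moreover have "f z \<le> real_of_int (\<bar>x\<bar> ^ k) / 1" unfolding f_def xy using A by (simp only: case_prod_conv) (intro divide_left_mono, auto)
    moreover have "real_of_int (\<bar>x\<bar> ^ k) \<le> R" using z Z[of x y] by (auto simp: Zl_def xy)
    ultimately show "1 \<le> f z \<and> f z \<le> R" by linarith
  next
    fix z w assume h: "z \<in> {z\<in>Zl. F z = c}" "w \<in> {z\<in>Zl. F z = c}" "z \<noteq> w" "f z \<le> f w"
    obtain x1 y1 where z: "z = (x1, y1)" by (cases z)
    obtain x2 y2 where w: "w = (x2, y2)" by (cases w)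
    have Z1: "coprime x1 y1" "A * x1 ^ k - B * y1 ^ k = H" "odd k \<or> (x1 \<ge> 0 \<and> y1 \<ge> 0)"
      and Z2: "coprime x2 y2" "A * x2 ^ k - B * y2 ^ k = H" "odd k \<or> (x2 \<ge> 0 \<and> y2 \<ge> 0)"
      using h Z[of x1 y1] Z[of x2 y2] by (auto simp: Zl_def z w)
    have sgn: "odd k \<or> (x1 \<ge> 0 \<and> y1 \<ge> 0 \<and> x2 \<ge> 0 \<and> y2 \<ge> 0)" using Z1(3) Z2(3) by auto
    have D: "x1 * y2 - x2 * y1 \<noteq> 0"
      using coprime_solutions_not_proportional[OF H Z1(2) Z2(2) sgn Z1(1) Z2(1)] h(3) z w by auto
    have "F (x1, y1) = F (x2, y2)" using h z w by auto
    then have dvd: "H ^ k dvd (A * B) ^ (k - 1) * int k ^ k * (x1 * y2 - x2 * y1) ^ k"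
      using F(4) Z1 Z2 by blast
    have "real_of_int (\<bar>x1\<bar> ^ k) \<le> real_of_int (\<bar>x2\<bar> ^ k)"
      using h(4) A by (simp add: f_def z w divide_le_cancel)
    then have "\<bar>x1\<bar> ^ k \<le> \<bar>x2\<bar> ^ k" by (simp only: of_int_le_iff)
    then have gap: "f z ^ (k - 1) \<le> real K * f w"
      using same_class_gap[OF _ A(1,2) H Z1(2) Z2(2) sgn D dvd] k by (simp add: f_def z w K_def)
    have big: "2 * real K \<le> f z" using h by (auto simp: Zl_def)
    have "(2 * real K) * f z \<le> f z * f z" using big K1 by (intro mult_right_mono) auto
    also have "\<dots> = f z ^ 2" by (simp add: power2_eq_square)
    also have "\<dots> \<le> f z ^ (k - 1)" using k big K1 by (intro power_increasing) auto
    finally have "real K * (2 * f z) \<le> real K * f w" using gap by simp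
    then show "2 * f z \<le> f w" using K1 by simp
  qed
  have "Zl = (\<Union>c\<in>\<W>. {z\<in>Zl. F z = c})" using F(3) Z by (auto simp: Zl_def)
  then have "card Zl \<le> (\<Sum>c\<in>\<W>. card {z\<in>Zl. F z = c})" using card_UN_le[OF F(1), of "\<lambda>c. {z\<in>Zl. F z = c}"] by simp
  then have "real (card Zl) \<le> (\<Sum>c\<in>\<W>. real (card {z\<in>Zl. F z = c}))" by (simp flip: of_nat_sum)
  also have "\<dots> \<le> (\<Sum>c\<in>\<W>. log 2 R + 1)" by (intro sum_mono cl)
  also have "\<dots> = real (card \<W>) * (log 2 R + 1)" by simp
  also have "\<dots> \<le> real ((k\<^sup>2) ^ card (prime_factors (nat \<bar>H\<bar>))) * (log 2 R + 1)"
    using F(2) R by (intro mult_right_mono of_nat_mono) auto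
  finally have "real (card Zl) \<le> \<dots>" .
  moreover have "card Z \<le> card Zs + card Zl"
  proof -
    have "Z = Zs \<union> Zl" by (auto simp: Zs_def Zl_def)
    then show ?thesis using card_Un_le[of Zs Zl] by simp
  qed
  ultimately show ?thesis using cs by (simp add: K_def)
qed

section \<open>Divisor bounds\<close>

text \<open>If \<open>p^e\<close> exactly divides \<open>h\<close>, the factor at \<open>p\<close> is at most \<open>p^(\<delta> e)\<close> for all but finitely many primes \<open>p\<close>, and at most a constant
times that for the others.\<close>

lemma prime_multiplicity_prod_bound:
  fixes c \<delta> :: real
  assumes c: "c \<ge> 1" and \<delta>: "\<delta> > 0"
  obtains C where "C \<ge> 1"
    "\<And>h :: nat. h > 0 \<Longrightarrow> (\<Prod>p\<in>prime_factors h. c * (real (multiplicity p h) + 1)) \<le> C * real h powr \<delta>"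
proof -
  define K where "K = c * (1 / (\<delta> * ln 2) + 1)"
  define P0 where "P0 = (2 * c) powr (1 / \<delta>)"
  define N where "N = nat \<lceil>P0\<rceil>"
  have ln2: "ln (2::real) > 0" by simp
  have K1: "K \<ge> 1"
  proof -
    have "1 * 1 \<le> c * (1 / (\<delta> * ln 2) + 1)" using c \<delta> ln2 by (intro mult_mono) auto
    then show ?thesis by (simp add: K_def)
  qed
  have small: "c * (real e + 1) \<le> K * real p powr (\<delta> * real e)" if p: "p \<ge> 2" for p e :: nat
  proof -
    have "1 + \<delta> * real e * ln 2 \<le> exp (\<delta> * real e * ln 2)" by (rule exp_ge_add_one_self)
    also have "\<dots> = 2 powr (\<delta> * real e)" by (simp add: powr_def)
    also have "\<dots> \<le> real p powr (\<delta> * real e)" using p \<delta> by (intro powr_mono2) auto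
    finally have 1: "1 + \<delta> * real e * ln 2 \<le> real p powr (\<delta> * real e)" .
    have "real e + 1 \<le> (1 / (\<delta> * ln 2) + 1) * (1 + \<delta> * real e * ln 2)"
      using \<delta> ln2 by (simp add: field_simps)
    also have "\<dots> \<le> (1 / (\<delta> * ln 2) + 1) * real p powr (\<delta> * real e)"
      using 1 \<delta> ln2 by (intro mult_left_mono) auto
    finally have "c * (real e + 1) \<le> c * ((1 / (\<delta> * ln 2) + 1) * real p powr (\<delta> * real e))"
      using c by (intro mult_left_mono) auto
    then show ?thesis by (simp add: K_def mult.assoc)
  qed
  have large: "c * (real e + 1) \<le> real p powr (\<delta> * real e)" if p: "N \<le> p" and e: "e \<ge> 1" for p e :: nat
  proof -
    have "P0 \<le> real p" using p unfolding N_def by linarith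
    then have "P0 powr \<delta> \<le> real p powr \<delta>" using \<delta> by (intro powr_mono2) (auto simp: P0_def)
    moreover have "P0 powr \<delta> = 2 * c" unfolding P0_def using \<delta> c by (simp add: powr_powr)
    ultimately have pd: "2 * c \<le> real p powr \<delta>" by simp
    have "real e + 1 \<le> 2 ^ e"
    proof -
      have "e + 1 \<le> 2 ^ e" by (metis Suc_eq_plus1 Suc_leI less_exp)
      then show ?thesis by (metis of_nat_Suc of_nat_le_iff of_nat_numeral of_nat_power Suc_eq_plus1 add.commute)
    qed
    moreover have "c ^ 1 \<le> c ^ e" using c e by (intro power_increasing) auto
    ultimately have "c * (real e + 1) \<le> c ^ e * 2 ^ e" using c by (intro mult_mono) auto
    also have "\<dots> = (2 * c) ^ e" by (simp add: power_mult_distrib)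
    also have "\<dots> \<le> (real p powr \<delta>) ^ e" using pd c by (intro power_mono) auto
    also have "\<dots> = real p powr (\<delta> * real e)"
      by (cases "p = 0") (use e in \<open>auto simp: powr_powr powr_realpow[symmetric]\<close>)
    finally show ?thesis .
  qed
  show ?thesis
  proof (rule that[of "K ^ N"])
    show "K ^ N \<ge> 1" using K1 by (rule one_le_power)
    fix h :: nat assume h: "h > 0"
    define PF where "PF = prime_factors h"
    have "(\<Prod>p\<in>PF. c * (real (multiplicity p h) + 1)) \<le> (\<Prod>p\<in>PF. (if p < N then K else 1) * real p powr (\<delta> * real (multiplicity p h)))"
    proof (rule prod_mono, safe)
      fix p assume p: "p \<in> PF"
      then have "prime p" "p dvd h" by (auto simp: PF_def)
      then have "p \<ge> 2" "multiplicity p h \<ge> 1" using h by (auto simp: prime_ge_2_nat intro!: multiplicity_geI)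
      then show "c * (real (multiplicity p h) + 1) \<le> (if p < N then K else 1) * real p powr (\<delta> * real (multiplicity p h))"
        using small[of p "multiplicity p h"] large[of p "multiplicity p h"] by auto
    qed (use c in auto)
    also have "\<dots> = (\<Prod>p\<in>PF. if p < N then K else 1) * (\<Prod>p\<in>PF. real p powr (\<delta> * real (multiplicity p h)))"
      by (rule prod.distrib)
    also have "\<dots> \<le> K ^ N * (\<Prod>p\<in>PF. real p powr (\<delta> * real (multiplicity p h)))"
    proof (rule mult_right_mono)
      have "(\<Prod>p\<in>PF. if p < N then K else 1) = (\<Prod>p\<in>PF \<inter> {..<N}. K)"
        by (subst prod.inter_restrict) (auto simp: PF_def)
      also have "\<dots> = K ^ card (PF \<inter> {..<N})" by simp
      also have "\<dots> \<le> K ^ N"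
      proof (rule power_increasing[OF _ K1])
        have "card (PF \<inter> {..<N}) \<le> card {..<N}" by (intro card_mono) auto
        then show "card (PF \<inter> {..<N}) \<le> N" by simp
      qed
      finally show "(\<Prod>p\<in>PF. if p < N then K else 1) \<le> K ^ N" .
    qed (auto intro: prod_nonneg)
    also have "(\<Prod>p\<in>PF. real p powr (\<delta> * real (multiplicity p h))) = real h powr \<delta>"
    proof -
      have "(\<Prod>p\<in>PF. real p powr (\<delta> * real (multiplicity p h))) = (\<Prod>p\<in>PF. (real p ^ multiplicity p h) powr \<delta>)"
      proof (rule prod.cong[OF refl])
        fix p assume "p \<in> PF"
        then have "prime p" by (auto simp: PF_def)
        then have "p > 0" by (rule prime_gt_0_nat)
        then show "real p powr (\<delta> * real (multiplicity p h)) = (real p ^ multiplicity p h) powr \<delta>"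
          by (simp add: powr_powr mult.commute flip: powr_realpow)
      qed
      also have "\<dots> = (\<Prod>p\<in>PF. real p ^ multiplicity p h) powr \<delta>"
        by (subst prod_powr_distrib) auto
      also have "(\<Prod>p\<in>PF. real p ^ multiplicity p h) = real (\<Prod>p\<in>PF. p ^ multiplicity p h)" by simp
      also have "(\<Prod>p\<in>PF. p ^ multiplicity p h) = h" using prod_prime_factors[of h] h by (simp add: PF_def)
      finally show ?thesis .
    qed
    finally show "(\<Prod>p\<in>prime_factors h. c * (real (multiplicity p h) + 1)) \<le> K ^ N * real h powr \<delta>"
      by (simp add: PF_def)
  qed
qed

lemma card_divisors_le_prod:
  fixes h :: nat
  assumes h: "h > 0"
  shows "real (card {d. d dvd h}) \<le> (\<Prod>p\<in>prime_factors h. real (multiplicity p h) + 1)"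
proof -
  define PF where "PF = prime_factors h"
  define g where "g d = restrict (\<lambda>p. multiplicity p d) PF" for d :: nat
  have "inj_on g {d. d dvd h}"
  proof (rule inj_onI)
    fix d1 d2 assume d: "d1 \<in> {d. d dvd h}" "d2 \<in> {d. d dvd h}" "g d1 = g d2"
    then have d0: "d1 \<noteq> 0" "d2 \<noteq> 0" using h by auto
    have "multiplicity p d1 = multiplicity p d2" if p: "prime p" for p
    proof (cases "p \<in> PF")
      case True
      then show ?thesis using fun_cong[OF d(3), of p] by (simp add: g_def)
    next
      case False
      then have "\<not> p dvd h" using p h by (auto simp: PF_def prime_factors_dvd)
      then have "\<not> p dvd d1" "\<not> p dvd d2" using d by (auto dest: dvd_trans)
      then show ?thesis by (simp add: not_dvd_imp_multiplicity_0)
    qed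
    then show "d1 = d2" using d0 multiplicity_eq_imp_eq[of d1 d2] by simp
  qed
  moreover have "g ` {d. d dvd h} \<subseteq> PiE PF (\<lambda>p. {..multiplicity p h})"
    using h by (auto simp: g_def intro!: dvd_imp_multiplicity_le)
  ultimately have "card {d. d dvd h} \<le> card (PiE PF (\<lambda>p. {..multiplicity p h}))"
    by (intro card_inj_on_le[of g] finite_PiE) (auto simp: PF_def)
  also have "\<dots> = (\<Prod>p\<in>PF. multiplicity p h + 1)" by (subst card_PiE) (auto simp: PF_def)
  finally have "real (card {d. d dvd h}) \<le> real (\<Prod>p\<in>PF. multiplicity p h + 1)" by (rule of_nat_mono)
  then show ?thesis by (simp add: PF_def add.commute)
qed

lemma divisor_bounds:
  fixes \<delta> :: real and c :: nat
  assumes \<delta>: "\<delta> > 0" and c: "c \<ge> 1"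
  obtains C where "C \<ge> 1" "\<And>h :: nat. h > 0 \<Longrightarrow> real (card {d. d dvd h}) \<le> C * real h powr \<delta>"
    "\<And>h :: nat. h > 0 \<Longrightarrow> real (c ^ card (prime_factors h)) \<le> C * real h powr \<delta>"
proof -
  obtain C where C: "C \<ge> 1"
    "\<And>h :: nat. h > 0 \<Longrightarrow> (\<Prod>p\<in>prime_factors h. real c * (real (multiplicity p h) + 1)) \<le> C * real h powr \<delta>"
    using prime_multiplicity_prod_bound[of "real c" \<delta>] c \<delta> by auto
  show ?thesis
  proof (rule that[OF C(1)])
    fix h :: nat assume h: "h > 0"
    have "(\<Prod>p\<in>prime_factors h. 1 * (real (multiplicity p h) + 1)) \<le> (\<Prod>p\<in>prime_factors h. real c * (real (multiplicity p h) + 1))"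
      using c by (intro prod_mono conjI mult_right_mono) auto
    then show "real (card {d. d dvd h}) \<le> C * real h powr \<delta>"
      using card_divisors_le_prod[OF h] C(2)[OF h] by simp
    have "real (c ^ card (prime_factors h)) = (\<Prod>p\<in>prime_factors h. real c * 1)" by simp
    also have "\<dots> \<le> (\<Prod>p\<in>prime_factors h. real c * (real (multiplicity p h) + 1))"
      by (intro prod_mono conjI mult_left_mono) auto
    finally show "real (c ^ card (prime_factors h)) \<le> C * real h powr \<delta>" using C(2)[OF h] by simp
  qed
qed

section \<open>Counting the numbers b\<close>

text \<open>The \<open>b\<close> are sorted by \<open>d = gcd(x, y)\<close>, a divisor of \<open>h = n (A - B)\<close>, where
\<open>A\<close> and \<open>B\<close> are \<open>a\<^sub>2\<close> and \<open>a\<^sub>1\<close> divided by their greatest common divisor; for fixed \<open>d\<close> the pairs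
\<open>(x/d, y/d)\<close> are coprime solutions of one Thue equation.\<close>

lemma count_up_to_bound:
  fixes k :: nat and \<delta> :: real
  assumes k: "k \<ge> 3" and \<delta>: "\<delta> > 0"
  shows "\<exists>C\<ge>1. \<forall>(n::int) a1 a2 S (Z::real). n \<noteq> 0 \<longrightarrow> 0 < a1 \<longrightarrow> a1 < a2 \<longrightarrow> finite S \<longrightarrow>
      (\<forall>b\<in>S. 0 < b \<and> is_nth_power k (a1 * b + n) \<and> is_nth_power k (a2 * b + n) \<and> real_of_int (a1 * b + \<bar>n\<bar>) \<le> Z) \<longrightarrow>
      real_of_int (\<bar>n\<bar> * a2) \<le> Z \<longrightarrow> real (card S) \<le> C * Z powr (3 * \<delta>)"
proof -
  have k1: "k\<^sup>2 \<ge> 1" using k by simp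
  obtain C1 where C1: "C1 \<ge> 1" "\<And>h :: nat. h > 0 \<Longrightarrow> real (card {d. d dvd h}) \<le> C1 * real h powr \<delta>"
    "\<And>h :: nat. h > 0 \<Longrightarrow> real ((k\<^sup>2) ^ card (prime_factors h)) \<le> C1 * real h powr \<delta>"
    using divisor_bounds[OF \<delta> k1] by blast
  define C3 where "C3 = 1 / (\<delta> * ln 2) + 1"
  define K where "K = 4 * (4 * real k) ^ k"
  have C3: "C3 \<ge> 1" using \<delta> by (simp add: C3_def)
  have K: "K \<ge> 0" by (simp add: K_def)
  show ?thesis
  proof (intro exI[of _ "C1 * (K + C1 * C3)"] conjI allI impI)
    have "1 * 1 \<le> C1 * C3" using C1 C3 by (intro mult_mono) auto
    then have "1 * 1 \<le> C1 * (K + C1 * C3)" using C1 K by (intro mult_mono) auto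
    then show "C1 * (K + C1 * C3) \<ge> 1" by simp
    fix n a1 a2 :: int and S :: "int set" and Z :: real
    assume n: "n \<noteq> 0" and a: "0 < a1" "a1 < a2" and S: "finite S"
      and bS: "\<forall>b\<in>S. 0 < b \<and> is_nth_power k (a1 * b + n) \<and> is_nth_power k (a2 * b + n) \<and> real_of_int (a1 * b + \<bar>n\<bar>) \<le> Z"
      and na: "real_of_int (\<bar>n\<bar> * a2) \<le> Z"
    note b = bspec[OF bS]
    have "\<bar>n\<bar> * a2 \<ge> 1 * 1" using n a by (intro mult_mono) auto
    then have "real_of_int (\<bar>n\<bar> * a2) \<ge> 1" by linarith
    then have Z1: "Z \<ge> 1" using na by linarith
    have "\<exists>x y. a1 * b + n = x ^ k \<and> a2 * b + n = y ^ k \<and> (odd k \<or> (x \<ge> 0 \<and> y \<ge> 0))" if bS: "b \<in> S" for b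
    proof -
      obtain x y where xy: "a1 * b + n = x ^ k" "a2 * b + n = y ^ k"
        using b[OF bS] by (auto simp: is_nth_power_def)
      show ?thesis
      proof (cases "odd k")
        case False
        then have "a1 * b + n = \<bar>x\<bar> ^ k" "a2 * b + n = \<bar>y\<bar> ^ k" using xy by (simp_all add: power_even_abs)
        then show ?thesis by (metis abs_ge_zero)
      qed (use xy in blast)
    qed
    then obtain X Y where XY: "\<And>b. b \<in> S \<Longrightarrow> a1 * b + n = X b ^ k" "\<And>b. b \<in> S \<Longrightarrow> a2 * b + n = Y b ^ k"
      "\<And>b. b \<in> S \<Longrightarrow> odd k \<or> (X b \<ge> 0 \<and> Y b \<ge> 0)" by metis
    define g where "g = gcd a1 a2"
    have g0: "g > 0" using a by (simp add: g_def)
    define A where "A = a2 div g"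
    define B where "B = a1 div g"
    have gA: "a2 = A * g" and gB: "a1 = B * g" by (simp_all add: A_def B_def g_def)
    have AB: "A > 0" "B > 0" "B < A"
      using a g0 unfolding gA gB by (auto simp: zero_less_mult_iff mult_less_cancel_right)
    have cop: "coprime A B"
      using a by (simp add: A_def B_def g_def coprime_commute div_gcd_coprime)
    define h where "h = n * (A - B)"
    have h0: "h \<noteq> 0" using n AB by (simp add: h_def)
    have hZ: "real (nat \<bar>h\<bar>) \<le> Z"
    proof -
      have "A \<le> a2" using AB g0 gA mult_left_mono[of 1 g A] by simp
      have "\<bar>h\<bar> = \<bar>n\<bar> * (A - B)" using AB by (simp add: h_def abs_mult)
      also have "\<dots> \<le> \<bar>n\<bar> * a2" using AB \<open>A \<le> a2\<close> by (intro mult_left_mono) auto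
      finally have "real_of_int \<bar>h\<bar> \<le> real_of_int (\<bar>n\<bar> * a2)" by (simp only: of_int_le_iff)
      then show ?thesis using na by simp
    qed
    have eq: "A * X b ^ k - B * Y b ^ k = h" if "b \<in> S" for b
      unfolding XY(1)[OF that, symmetric] XY(2)[OF that, symmetric] h_def by (simp add: gA gB algebra_simps)
    define d where "d b = nat (gcd (X b) (Y b))" for b
    have id: "int (d b) = gcd (X b) (Y b)" for b by (simp add: d_def)
    have dk: "int (d b) ^ k dvd h" if "b \<in> S" for b
    proof -
      have "int (d b) ^ k dvd X b ^ k" "int (d b) ^ k dvd Y b ^ k" by (auto simp: id intro: dvd_power_same)
      then show ?thesis unfolding eq[OF that, symmetric] by (intro dvd_diff dvd_mult)
    qed
    have dh: "d b dvd nat \<bar>h\<bar>" if "b \<in> S" for b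
    proof -
      have "int (d b) dvd int (d b) ^ k" using k by simp
      then have "int (d b) dvd h" using dk[OF that] by (rule dvd_trans)
      then show ?thesis by (simp add: nat_dvd_iff int_dvd_int_iff[symmetric] del: int_dvd_int_iff)
    qed
    define bound where "bound = K + C1 * Z powr \<delta> * (C3 * Z powr \<delta>)"
    have Zd: "Z powr \<delta> \<ge> 1" using Z1 \<delta> by (simp add: ge_one_powr_ge_zero)
    have logZ: "log 2 Z + 1 \<le> C3 * Z powr \<delta>"
    proof -
      have "ln Z \<le> Z powr \<delta> / \<delta>" using Z1 \<delta> by (rule ln_powr_bound)
      then have "ln Z / ln 2 \<le> (Z powr \<delta> / \<delta>) / ln 2" by (intro divide_right_mono) auto
      then have "log 2 Z \<le> 1 / (\<delta> * ln 2) * Z powr \<delta>" by (simp add: log_def)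
      then show ?thesis using Zd by (simp add: C3_def distrib_right)
    qed
    have fiber: "real (card {b\<in>S. d b = e}) \<le> bound" for e
    proof (cases "{b\<in>S. d b = e} = {}")
      case True
      have "bound \<ge> 0" unfolding bound_def using K C1(1) C3 by (intro add_nonneg_nonneg mult_nonneg_nonneg) auto
      then show ?thesis by (simp only: True card.empty of_nat_0)
    next
      case False
      then obtain b0 where b0: "b0 \<in> S" "d b0 = e" by auto
      obtain H where H: "h = int e ^ k * H" using dk[OF b0(1)] b0(2) by (auto simp: dvd_def)
      have H0: "H \<noteq> 0" and e0: "e \<noteq> 0" using H h0 k by (auto simp: power_0_left)
      define \<phi> where "\<phi> b = (X b div int e, Y b div int e)" for b
      have split: "X b = int e * (X b div int e)" "Y b = int e * (Y b div int e)" if "d b = e" for b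
        using that id[of b] by auto
      have inj: "inj_on \<phi> {b\<in>S. d b = e}"
      proof (rule inj_onI)
        fix b c assume bc: "b \<in> {b\<in>S. d b = e}" "c \<in> {b\<in>S. d b = e}" "\<phi> b = \<phi> c"
        then have "X b div int e = X c div int e" by (simp add: \<phi>_def)
        then have "X b = X c" using split[of b] split[of c] bc by simp
        then have "a1 * b + n = a1 * c + n" using XY(1) bc by auto
        then show "b = c" using a by simp
      qed
      have hH: "nat \<bar>H\<bar> \<le> nat \<bar>h\<bar>" using h0 unfolding H by (auto simp: abs_mult nat_le_iff mult_le_cancel_right1)
      have "real (card (\<phi> ` {b\<in>S. d b = e})) \<le> 4 * (4 * real k) ^ k + real ((k\<^sup>2) ^ card (prime_factors (nat \<bar>H\<bar>))) * (log 2 Z + 1)"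
      proof (rule coprime_solution_count[OF k AB(1,2) cop H0 Z1])
        show "finite (\<phi> ` {b\<in>S. d b = e})" using S by simp
        fix x y assume "(x, y) \<in> \<phi> ` {b\<in>S. d b = e}"
        then obtain b1 where b1: "b1 \<in> S" "d b1 = e" "x = X b1 div int e" "y = Y b1 div int e" by (auto simp: \<phi>_def)
        have xy: "X b1 = int e * x" "Y b1 = int e * y" using split[OF b1(2)] b1 by auto
        have "coprime x y"
        proof -
          have "X b1 \<noteq> 0 \<or> Y b1 \<noteq> 0" using id[of b1] b1(2) e0 by auto
          then show ?thesis using div_gcd_coprime[of "X b1" "Y b1"] id[of b1] b1 by simp
        qed
        moreover have "int e ^ k * (A * x ^ k - B * y ^ k) = int e ^ k * H"
          using eq[OF b1(1)] unfolding H xy by (simp add: power_mult_distrib algebra_simps)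
        then have "A * x ^ k - B * y ^ k = H" using e0 by simp
        moreover have "odd k \<or> (x \<ge> 0 \<and> y \<ge> 0)" using XY(3)[OF b1(1)] unfolding xy using e0 by (auto simp: zero_le_mult_iff)
        moreover have "real_of_int (\<bar>x\<bar> ^ k) \<le> Z"
        proof -
          have "\<bar>x\<bar> \<le> \<bar>X b1\<bar>" unfolding xy using e0 by (simp add: abs_mult mult_le_cancel_right1)
          then have "\<bar>x\<bar> ^ k \<le> \<bar>X b1\<bar> ^ k" by (intro power_mono) auto
          also have "\<dots> = \<bar>a1 * b1 + n\<bar>" by (simp add: XY(1)[OF b1(1)] power_abs)
          also have "\<dots> \<le> a1 * b1 + \<bar>n\<bar>"
          proof -
            have "0 < a1 * b1" using b[OF b1(1)] a by simp
            then show ?thesis by linarith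
          qed
          finally have "real_of_int (\<bar>x\<bar> ^ k) \<le> real_of_int (a1 * b1 + \<bar>n\<bar>)" by (simp only: of_int_le_iff)
          then show ?thesis using b[OF b1(1)] by linarith
        qed
        ultimately show "coprime x y \<and> A * x ^ k - B * y ^ k = H \<and> (odd k \<or> (x \<ge> 0 \<and> y \<ge> 0)) \<and> real_of_int (\<bar>x\<bar> ^ k) \<le> Z"
          by blast
      qed
      also have "card (\<phi> ` {b\<in>S. d b = e}) = card {b\<in>S. d b = e}" by (rule card_image[OF inj])
      also have "4 * (4 * real k) ^ k + real ((k\<^sup>2) ^ card (prime_factors (nat \<bar>H\<bar>))) * (log 2 Z + 1)
          \<le> K + (C1 * Z powr \<delta>) * (C3 * Z powr \<delta>)"
      proof (intro add_mono mult_mono logZ)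
        have "real ((k\<^sup>2) ^ card (prime_factors (nat \<bar>H\<bar>))) \<le> C1 * real (nat \<bar>H\<bar>) powr \<delta>" using H0 by (intro C1(3)) simp
        also have "\<dots> \<le> C1 * Z powr \<delta>" using C1(1) \<delta> hH hZ by (intro mult_left_mono powr_mono2) auto
        finally show "real ((k\<^sup>2) ^ card (prime_factors (nat \<bar>H\<bar>))) \<le> C1 * Z powr \<delta>" .
      qed (use Z1 C1 in \<open>auto simp: K_def\<close>)
      finally show ?thesis by (simp add: bound_def)
    qed
    have "S = (\<Union>e\<in>{e. e dvd nat \<bar>h\<bar>}. {b\<in>S. d b = e})" using dh by auto
    moreover have "finite {e. e dvd nat \<bar>h\<bar>}" using h0 by (intro finite_divisors_nat) simp
    ultimately have "card S \<le> (\<Sum>e\<in>{e. e dvd nat \<bar>h\<bar>}. card {b\<in>S. d b = e})"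
      using card_UN_le[of "{e. e dvd nat \<bar>h\<bar>}" "\<lambda>e. {b\<in>S. d b = e}"] by metis
    then have "real (card S) \<le> (\<Sum>e\<in>{e. e dvd nat \<bar>h\<bar>}. real (card {b\<in>S. d b = e}))" by (simp flip: of_nat_sum)
    also have "\<dots> \<le> (\<Sum>e\<in>{e. e dvd nat \<bar>h\<bar>}. bound)" by (intro sum_mono fiber)
    also have "\<dots> = real (card {e. e dvd nat \<bar>h\<bar>}) * bound" by simp
    also have "\<dots> \<le> (C1 * Z powr \<delta>) * ((K + C1 * C3) * (Z powr \<delta> * Z powr \<delta>))"
    proof (intro mult_mono)
      have "real (card {e. e dvd nat \<bar>h\<bar>}) \<le> C1 * real (nat \<bar>h\<bar>) powr \<delta>" using h0 by (intro C1(2)) simp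
      also have "\<dots> \<le> C1 * Z powr \<delta>" using C1(1) \<delta> hZ by (intro mult_left_mono powr_mono2) auto
      finally show "real (card {e. e dvd nat \<bar>h\<bar>}) \<le> C1 * Z powr \<delta>" .
      have "1 * 1 \<le> Z powr \<delta> * Z powr \<delta>" using Zd by (intro mult_mono) auto
      then have "K * 1 \<le> K * (Z powr \<delta> * Z powr \<delta>)" using K by (intro mult_left_mono) auto
      then show "bound \<le> (K + C1 * C3) * (Z powr \<delta> * Z powr \<delta>)" by (simp add: bound_def algebra_simps)
    qed (use K C1 C3 in \<open>auto simp: bound_def\<close>)
    also have "\<dots> = (C1 * (K + C1 * C3)) * (Z powr \<delta> * Z powr \<delta> * Z powr \<delta>)" by (simp only: mult_ac)
    also have "Z powr \<delta> * Z powr \<delta> * Z powr \<delta> = Z powr (3 * \<delta>)" by (simp flip: powr_add)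
    finally show "real (card S) \<le> C1 * (K + C1 * C3) * Z powr (3 * \<delta>)" .
  qed
qed

text \<open>Above this multiple of \<open>|n|^(6k)\<close> the gap principle yields growth, and the constant of
\<open>large_solution_bound\<close> is exceeded as well.\<close>

definition growth_threshold :: "nat \<Rightarrow> int" where
  "growth_threshold k = 8 ^ (6 * k) * \<lceil>thue_const k\<rceil>"

lemma growth_threshold_ge:
  assumes k: "k \<ge> 1" and n: "n \<noteq> 0" and b: "growth_threshold k * \<bar>n\<bar> ^ (6 * k) < b"
  shows "thue_const k \<le> b" "(8 * \<bar>n\<bar>) ^ (6 * k) \<le> b" "2 * \<bar>n\<bar> \<le> b"
proof -
  define c where "c = \<lceil>thue_const k\<rceil>"
  have c1: "c \<ge> 1" using thue_const_ge[of k] unfolding c_def by linarith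
  have e: "(8 * \<bar>n\<bar>) ^ (6 * k) * c < b" using b by (simp add: growth_threshold_def c_def power_mult_distrib mult_ac)
  have p1: "1 \<le> (8 * \<bar>n\<bar>) ^ (6 * k)" using n by (intro one_le_power) auto
  have "(8 * \<bar>n\<bar>) ^ (6 * k) * 1 \<le> (8 * \<bar>n\<bar>) ^ (6 * k) * c" using c1 p1 by (intro mult_left_mono) auto
  then show 1: "(8 * \<bar>n\<bar>) ^ (6 * k) \<le> b" using e unfolding mult_1_right by (rule order_trans[OF _ less_imp_le])
  have "1 * c \<le> (8 * \<bar>n\<bar>) ^ (6 * k) * c" using c1 p1 by (intro mult_right_mono) auto
  then have "c \<le> b" using e by simp
  then show "thue_const k \<le> b" unfolding c_def by linarith
  have "(8 * \<bar>n\<bar>) ^ 1 \<le> (8 * \<bar>n\<bar>) ^ (6 * k)" using n k by (intro power_increasing) auto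
  then show "2 * \<bar>n\<bar> \<le> b" using 1 by simp
qed

definition large_growth :: "nat \<Rightarrow> int \<Rightarrow> nat \<Rightarrow> (nat \<Rightarrow> int) \<Rightarrow> bool" where
  "large_growth k n m b \<longleftrightarrow>
    (\<forall>i\<in>{1..m}. \<forall>j\<in>{1..m}. i < j \<longrightarrow> (8 * \<bar>n\<bar>) ^ (6 * k) \<le> b i \<longrightarrow> 2 * \<bar>n\<bar> \<le> b i \<longrightarrow> b i ^ 3 \<le> b j ^ 2)"

text \<open>If \<open>m\<close> is larger than \<open>L = 10 k + 18\<close>, then the last \<open>L + 1\<close> of the \<open>b\<close> cannot all exceed the threshold,
because they would form a long growth chain. Thus all but \<open>L\<close> of them are bounded by a power of
\<open>|n|\<close>.\<close>

lemma count_if_growth: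
  fixes k :: nat and \<epsilon> :: real
  assumes k: "k \<ge> 3" and \<epsilon>: "\<epsilon> > 0"
  shows "\<exists>C>0. \<forall>(n::int) a1 a2 m (b :: nat \<Rightarrow> int). n \<noteq> 0 \<longrightarrow> 0 < a1 \<longrightarrow> a1 < a2 \<longrightarrow> a2 \<le> b 1 \<longrightarrow> strict_mono_on {1..m} b \<longrightarrow>
      (\<forall>j\<in>{1..m}. is_nth_power k (a1 * b j + n) \<and> is_nth_power k (a2 * b j + n)) \<longrightarrow>
      large_growth k n m b \<longrightarrow>
      real m \<le> C * real_of_int \<bar>n\<bar> powr \<epsilon>"
proof -
  \<comment> \<open>The quantity \<open>Z\<close> below has size \<open>|n|^(12k)\<close> and enters with the exponent \<open>3 \<delta>\<close>.\<close>
  define \<delta> where "\<delta> = \<epsilon> / (36 * real k)"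
  have \<delta>: "\<delta> > 0" using \<epsilon> k by (simp add: \<delta>_def)
  obtain C where C: "C \<ge> 1"
    and count: "\<forall>(n::int) a1 a2 S (Z::real). n \<noteq> 0 \<longrightarrow> 0 < a1 \<longrightarrow> a1 < a2 \<longrightarrow> finite S \<longrightarrow>
      (\<forall>b\<in>S. 0 < b \<and> is_nth_power k (a1 * b + n) \<and> is_nth_power k (a2 * b + n) \<and> real_of_int (a1 * b + \<bar>n\<bar>) \<le> Z) \<longrightarrow>
      real_of_int (\<bar>n\<bar> * a2) \<le> Z \<longrightarrow> real (card S) \<le> C * Z powr (3 * \<delta>)"
    using count_up_to_bound[OF k \<delta>] by blast
  define \<theta> where "\<theta> = growth_threshold k"
  have \<theta>1: "\<theta> \<ge> 1"
  proof -
    have "1 \<le> \<lceil>thue_const k\<rceil>" using thue_const_ge[of k] by linarith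
    then have "1 * 1 \<le> 8 ^ (6 * k) * \<lceil>thue_const k\<rceil>" by (intro mult_mono) auto
    then show ?thesis by (simp add: \<theta>_def growth_threshold_def)
  qed
  define L where "L = 10 * k + 18"
  define C' where "C' = C * (2 * real_of_int \<theta> ^ 2) powr (3 * \<delta>)"
  have C'0: "C' \<ge> 0" using C by (simp add: C'_def)
  show ?thesis
  proof (intro exI[of _ "C' + real L"] conjI allI impI)
    show "C' + real L > 0" using C'0 by (simp add: L_def)
    fix n a1 a2 :: int and m :: nat and b :: "nat \<Rightarrow> int"
    assume n: "n \<noteq> 0" and a: "0 < a1" "a1 < a2" and ab: "a2 \<le> b 1" and mono: "strict_mono_on {1..m} b"
      and pw': "\<forall>j\<in>{1..m}. is_nth_power k (a1 * b j + n) \<and> is_nth_power k (a2 * b j + n)"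
      and gr: "large_growth k n m b"
    note pw = bspec[OF pw']
    have n1: "real_of_int \<bar>n\<bar> \<ge> 1" using n by linarith
    then have ne: "real_of_int \<bar>n\<bar> powr \<epsilon> \<ge> 1" using \<epsilon> by (simp add: ge_one_powr_ge_zero)
    have lt: "b i < b j" if "i \<in> {1..m}" "j \<in> {1..m}" "i < j" for i j
      using strict_mono_onD[OF mono that] .
    show "real m \<le> (C' + real L) * real_of_int \<bar>n\<bar> powr \<epsilon>"
    proof (cases "m \<le> L")
      case True
      have "real m \<le> real L * 1" using True by simp
      also have "\<dots> \<le> (C' + real L) * real_of_int \<bar>n\<bar> powr \<epsilon>" using ne C'0 by (intro mult_mono) auto
      finally show ?thesis .
    next
      case False
      define j0 where "j0 = m - L"
      define Bd where "Bd = \<theta> * \<bar>n\<bar> ^ (6 * k)"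
      have j0: "1 \<le> j0" "j0 \<in> {1..m}" "j0 + L = m" using False by (auto simp: j0_def L_def)
      have small: "b j0 \<le> Bd"
      proof (rule ccontr)
        assume "\<not> b j0 \<le> Bd"
        then have big: "growth_threshold k * \<bar>n\<bar> ^ (6 * k) < b j0" by (simp add: Bd_def \<theta>_def)
        have mono0: "b j0 \<le> b (j0 + i)" if "i \<le> L" for i using lt[of j0 "j0 + i"] j0 that by (cases "i = 0") auto
        have big_i: "growth_threshold k * \<bar>n\<bar> ^ (6 * k) < b (j0 + i)" if "i \<le> L" for i
          using big mono0[OF that] by linarith
        have k1: "k \<ge> 1" using k by simp
        note G = growth_threshold_ge[OF k1 n]
        show False
        proof (rule no_long_growth_chain[OF k n a, of "\<lambda>i. b (j0 + i)"])
          fix i assume "i \<le> 10 * k + 18"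
          then have "j0 + i \<in> {1..m}" using j0 by (auto simp: L_def)
          then show "is_nth_power k (a1 * b (j0 + i) + n)" "is_nth_power k (a2 * b (j0 + i) + n)" using pw by auto
        next
          fix i j :: nat assume "i < j" "j \<le> 10 * k + 18"
          then show "b (j0 + i) < b (j0 + j)" using j0 by (intro lt) (auto simp: L_def)
        next
          have "b 1 \<le> b j0" using lt[of 1 j0] j0 by (cases "j0 = 1") auto
          then show "a2 \<le> b (j0 + 0)" using ab by simp
          show "thue_const k \<le> real_of_int (b (j0 + 0))" using G(1)[OF big] by simp
          show "\<bar>n\<bar> \<le> b (j0 + 0)" using G(3)[OF big] by simp
        next
          fix i assume i: "i < 10 * k + 18"
          then have "i \<le> L" by (simp add: L_def)
          from big_i[OF this] show "b (j0 + i) ^ 3 \<le> b (j0 + Suc i) ^ 2"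
            using i j0 by (intro gr[unfolded large_growth_def, rule_format] G) (auto simp: L_def)
        qed
      qed
      define Z where "Z = 2 * real_of_int Bd ^ 2"
      define S where "S = b ` {1..j0}"
      have sub: "{1..j0} \<subseteq> {1..m}" using j0 by auto
      have Bd1: "\<bar>n\<bar> \<le> Bd" "1 \<le> Bd"
      proof -
        have "\<bar>n\<bar> ^ 1 \<le> \<bar>n\<bar> ^ (6 * k)" using n k by (intro power_increasing) auto
        then have "1 * \<bar>n\<bar> \<le> \<theta> * \<bar>n\<bar> ^ (6 * k)" using \<theta>1 by (intro mult_mono) auto
        then show "\<bar>n\<bar> \<le> Bd" by (simp add: Bd_def)
        then show "1 \<le> Bd" using n by linarith
      qed
      have bj: "b 1 \<le> b j \<and> b j \<le> Bd" if "j \<in> {1..j0}" for j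
      proof -
        have "b 1 \<le> b j" using lt[of 1 j] that sub by (cases "j = 1") auto
        moreover have "b j \<le> b j0" using lt[of j j0] that sub j0 by (cases "j = j0") auto
        ultimately show ?thesis using small by simp
      qed
      have aBd: "a1 \<le> Bd" "a2 \<le> Bd" using bj[of 1] ab a j0 by auto
      have le_Z: "real_of_int x \<le> Z" if "x \<le> 2 * (Bd * Bd)" for x
      proof -
        have "real_of_int x \<le> real_of_int (2 * (Bd * Bd))" using that by (simp only: of_int_le_iff)
        then show ?thesis by (simp add: Z_def power2_eq_square)
      qed
      have "real (card S) \<le> C * Z powr (3 * \<delta>)"
      proof (intro count[rule_format, OF n a])
        show "finite S" by (simp add: S_def)
        show "real_of_int (\<bar>n\<bar> * a2) \<le> Z"
        proof (rule le_Z)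
          have "\<bar>n\<bar> * a2 \<le> Bd * Bd" using Bd1 aBd a by (intro mult_mono) auto
          moreover have "0 \<le> Bd * Bd" using Bd1 by simp
          ultimately show "\<bar>n\<bar> * a2 \<le> 2 * (Bd * Bd)" by linarith
        qed
        fix c assume "c \<in> S"
        then obtain j where j: "j \<in> {1..j0}" "c = b j" by (auto simp: S_def)
        have c: "b 1 \<le> c" "c \<le> Bd" using bj[OF j(1)] j(2) by auto
        have c0: "0 < c" using c ab a by linarith
        have "real_of_int (a1 * c + \<bar>n\<bar>) \<le> Z"
        proof (rule le_Z)
          have "a1 * c \<le> Bd * Bd" using aBd c c0 a Bd1 by (intro mult_mono) auto
          moreover have "\<bar>n\<bar> * 1 \<le> Bd * Bd" using Bd1 by (intro mult_mono) auto
          ultimately show "a1 * c + \<bar>n\<bar> \<le> 2 * (Bd * Bd)" by linarith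
        qed
        then show "0 < c \<and> is_nth_power k (a1 * c + n) \<and> is_nth_power k (a2 * c + n) \<and> real_of_int (a1 * c + \<bar>n\<bar>) \<le> Z"
          using c0 pw[of j] j sub by auto
      qed
      moreover have "card S = j0"
      proof -
        have "inj_on b {1..j0}" using strict_mono_on_imp_inj_on[OF mono] sub by (rule inj_on_subset)
        then show ?thesis by (simp add: S_def card_image)
      qed
      moreover have "C * Z powr (3 * \<delta>) = C' * real_of_int \<bar>n\<bar> powr \<epsilon>"
      proof -
        have "Z = (2 * real_of_int \<theta> ^ 2) * real_of_int \<bar>n\<bar> ^ (12 * k)"
          by (simp add: Z_def Bd_def power_mult_distrib flip: power_mult)
        then have "Z powr (3 * \<delta>) = (2 * real_of_int \<theta> ^ 2) powr (3 * \<delta>) * (real_of_int \<bar>n\<bar> ^ (12 * k)) powr (3 * \<delta>)"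
          by (simp add: powr_mult)
        also have "(real_of_int \<bar>n\<bar> ^ (12 * k)) powr (3 * \<delta>) = real_of_int \<bar>n\<bar> powr (real (12 * k) * (3 * \<delta>))"
          using n1 by (simp add: powr_realpow[symmetric] powr_powr)
        also have "real (12 * k) * (3 * \<delta>) = \<epsilon>" using k by (simp add: \<delta>_def)
        finally show ?thesis by (simp add: C'_def)
      qed
      ultimately have "real j0 \<le> C' * real_of_int \<bar>n\<bar> powr \<epsilon>" by simp
      moreover have "real L \<le> real L * real_of_int \<bar>n\<bar> powr \<epsilon>" using ne by (simp add: mult_le_cancel_left1)
      moreover have "real m = real j0 + real L" using j0(3) by simp
      ultimately show ?thesis by (simp add: distrib_right)
    qed
  qed
qed

lemma is_nth_power_gap:
  fixes n a a' b b' :: int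
  assumes "k \<ge> 1" "n \<noteq> 0" "0 < a" "a < a'" "2 * \<bar>n\<bar> \<le> b" "b < b'"
    and pw: "is_nth_power k (a * b + n)" "is_nth_power k (a' * b + n)" "is_nth_power k (a * b' + n)" "is_nth_power k (a' * b' + n)"
  shows "(a * b) ^ (k - 1) \<le> (8 * \<bar>n\<bar>) ^ k * (a' * b')"
proof -
  obtain x1 y1 x2 y2 where "a * b + n = x1 ^ k" "a' * b + n = y1 ^ k" "a * b' + n = x2 ^ k" "a' * b' + n = y2 ^ k"
    using pw unfolding is_nth_power_def by blast
  then show ?thesis using assms by (intro nth_powers_gap)
qed

text \<open>The gap principle reads \<open>b^(k-1) \<lesssim> a\<^sub>2 b' \<le> b b'\<close>, hence \<open>b' \<greatersim> b^(k-2) \<ge> b\<^sup>2\<close>.\<close>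

lemma growth_two:
  fixes n a1 a2 b b' :: int
  assumes k: "k \<ge> 4" and n: "n \<noteq> 0" and a: "0 < a1" "a1 < a2" "a2 \<le> b" and b: "b < b'" "(8 * \<bar>n\<bar>) ^ (6 * k) \<le> b" "2 * \<bar>n\<bar> \<le> b"
    and pw: "is_nth_power k (a1 * b + n)" "is_nth_power k (a2 * b + n)" "is_nth_power k (a1 * b' + n)" "is_nth_power k (a2 * b' + n)"
  shows "b ^ 3 \<le> b' ^ 2"
proof -
  define M where "M = (8 * \<bar>n\<bar>) ^ k"
  have M1: "M \<ge> 1" unfolding M_def using n by (intro one_le_power) auto
  have b0: "b > 0" using a by linarith
  have M2: "M ^ 2 \<le> b"
  proof -
    have "M ^ 2 \<le> M ^ 6" using M1 by (intro power_increasing) auto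
    also have "\<dots> = (8 * \<bar>n\<bar>) ^ (6 * k)" unfolding M_def power_mult[symmetric] by (simp only: mult.commute)
    finally show ?thesis using b by simp
  qed
  have "(a1 * b) ^ (k - 1) \<le> M * (a2 * b')"
    unfolding M_def using pw k n a b by (intro is_nth_power_gap) auto
  moreover have "b ^ (k - 1) \<le> (a1 * b) ^ (k - 1)" using a b0 by (intro power_mono) auto
  moreover have "M * (a2 * b') \<le> M * (b * b')" using a b b0 M1 by (intro mult_left_mono mult_right_mono) auto
  ultimately have "b ^ (k - 1) \<le> b * (M * b')" by (simp add: mult_ac)
  moreover have "b ^ (k - 1) = b * b ^ (k - 2)" using k by (cases k; cases "k - 1") (auto simp: Suc_diff_le numeral_eq_Suc)
  ultimately have "b ^ (k - 2) \<le> M * b'" using b0 by simp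
  moreover have "b ^ 2 \<le> b ^ (k - 2)" using b0 k by (intro power_increasing) auto
  ultimately have "b ^ 2 \<le> M * b'" by simp
  then have "(b ^ 2) ^ 2 \<le> (M * b') ^ 2" by (intro power_mono) auto
  then have "b * b ^ 3 \<le> M ^ 2 * b' ^ 2" by (simp add: power_mult_distrib flip: power_mult power_Suc)
  also have "\<dots> \<le> b * b' ^ 2" using M2 by (intro mult_right_mono) auto
  finally show ?thesis using b0 by simp
qed

text \<open>The pair \<open>(a\<^sub>1, a\<^sub>2)\<close> gives \<open>b\<^sup>2 \<lesssim> a\<^sub>2 b'\<close>, which is good for small \<open>a\<^sub>2\<close>; the pair \<open>(a\<^sub>2, a\<^sub>3)\<close> gives
\<open>a\<^sub>2\<^sup>2 b \<lesssim> b'\<close>, which is good for large \<open>a\<^sub>2\<close>. The two balance at \<open>a\<^sub>2 = b^(1/3)\<close> and give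
\<open>b' \<greatersim> b^(5/3)\<close>.\<close>

lemma growth_three:
  fixes n a1 a2 a3 b b' :: int
  assumes n: "n \<noteq> 0" and a: "0 < a1" "a1 < a2" "a2 < a3" "a3 \<le> b" and b: "b < b'" "(8 * \<bar>n\<bar>) ^ (6 * 3) \<le> b" "2 * \<bar>n\<bar> \<le> b"
    and pw: "is_nth_power 3 (a1 * b + n)" "is_nth_power 3 (a2 * b + n)" "is_nth_power 3 (a3 * b + n)"
      "is_nth_power 3 (a1 * b' + n)" "is_nth_power 3 (a2 * b' + n)" "is_nth_power 3 (a3 * b' + n)"
  shows "b ^ 3 \<le> b' ^ 2"
proof -
  define M where "M = (8 * \<bar>n\<bar>) ^ 3"
  have M1: "M \<ge> 1" unfolding M_def using n by (intro one_le_power) auto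
  have b0: "b > 0" "b' > 0" using a b by linarith+
  have M6: "M ^ 6 \<le> b" using b by (simp add: M_def flip: power_mult)
  have gap12: "(a1 * b) ^ 2 \<le> M * (a2 * b')"
    using is_nth_power_gap[of 3 n a1 a2 b b'] pw n a b by (simp add: M_def)
  have gap23: "(a2 * b) ^ 2 \<le> M * (a3 * b')"
    using is_nth_power_gap[of 3 n a2 a3 b b'] pw n a b by (simp add: M_def)
  have "b ^ 5 \<le> M ^ 3 * b' ^ 3"
  proof (cases "a2 ^ 3 \<le> b")
    case True
    have "b ^ 2 \<le> (a1 * b) ^ 2" using a b0 by (intro power_mono) auto
    then have "b ^ 2 \<le> M * (a2 * b')" using gap12 by simp
    then have "(b ^ 2) ^ 3 \<le> (M * (a2 * b')) ^ 3" by (intro power_mono) auto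
    also have "\<dots> = M ^ 3 * b' ^ 3 * a2 ^ 3" by (simp add: power_mult_distrib)
    also have "\<dots> \<le> M ^ 3 * b' ^ 3 * b" using True M1 b0 by (intro mult_left_mono) auto
    finally have "b ^ 5 * b \<le> M ^ 3 * b' ^ 3 * b" by (simp add: mult.commute flip: power_mult power_Suc)
    then show ?thesis using b0 by simp
  next
    case False
    have "(a2 * b) ^ 2 \<le> M * (b * b')" using gap23 a b0 M1 mult_right_mono[of a3 b b'] mult_left_mono[of "a3 * b'" "b * b'" M] by linarith
    then have "b * (a2 ^ 2 * b) \<le> b * (M * b')" by (simp add: power2_eq_square mult_ac)
    then have "a2 ^ 2 * b \<le> M * b'" using b0 by simp
    then have "(a2 ^ 2 * b) ^ 3 \<le> (M * b') ^ 3" using b0 by (intro power_mono) auto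
    moreover have "b ^ 5 \<le> (a2 ^ 2 * b) ^ 3"
    proof -
      have "b ^ 5 = b ^ 2 * b ^ 3" by (simp flip: power_add)
      also have "\<dots> \<le> (a2 ^ 3) ^ 2 * b ^ 3" using False b0 by (intro mult_right_mono power_mono) auto
      also have "\<dots> = (a2 ^ 2 * b) ^ 3" by (simp add: power_mult_distrib flip: power_mult)
      finally show ?thesis .
    qed
    ultimately show ?thesis by (simp add: power_mult_distrib)
  qed
  then have "(b ^ 5) ^ 2 \<le> (M ^ 3 * b' ^ 3) ^ 2" using b0 by (intro power_mono) auto
  also have "\<dots> = M ^ 6 * (b' ^ 2) ^ 3" by (simp add: power_mult_distrib flip: power_mult)
  also have "\<dots> \<le> b * (b' ^ 2) ^ 3" using M6 by (intro mult_right_mono) auto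
  finally have "b * (b ^ 3) ^ 3 \<le> b * (b' ^ 2) ^ 3" by (simp flip: power_mult power_Suc)
  then have "(b ^ 3) ^ 3 \<le> (b' ^ 2) ^ 3" using b0 by simp
  then show ?thesis using b0 by (subst (asm) power_mono_iff) auto
qed

section \<open>The two bounds\<close>

lemma powr_bound_weaken:
  fixes n :: int and B C c \<epsilon> :: real
  assumes "B \<le> C * real_of_int \<bar>n\<bar> powr \<epsilon>" "C > 0" "n \<noteq> 0" "c \<ge> 0"
  shows "B \<le> C * real_of_int \<bar>n\<bar> powr (c + \<epsilon>)"
proof -
  have "1 \<le> real_of_int \<bar>n\<bar>" using assms(3) by linarith
  then have "real_of_int \<bar>n\<bar> powr \<epsilon> \<le> real_of_int \<bar>n\<bar> powr (c + \<epsilon>)" using assms(4) by (intro powr_mono) auto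
  then have "C * real_of_int \<bar>n\<bar> powr \<epsilon> \<le> C * real_of_int \<bar>n\<bar> powr (c + \<epsilon>)" using assms(2) by (intro mult_left_mono) auto
  then show ?thesis using assms(1) by linarith
qed

lemma strict_mono_on_first_le:
  fixes b :: "nat \<Rightarrow> int"
  assumes "strict_mono_on {1..m} b" "i \<in> {1..m}"
  shows "b 1 \<le> b i"
  using strict_mono_onD[OF assms(1), of 1 i] assms(2) by (cases "i = 1") auto

text \<open>The exponents claimed exceed \<open>\<epsilon>\<close> by a nonnegative amount, so the bounds with \<open>|n|\<^sup>\<epsilon>\<close> imply them. The only
difference between the two parts lies in the source of the growth of the large \<open>b\<close>.\<close>

theorem theorem1p2:
  fixes \<epsilon> :: real
  assumes "\<epsilon> > 0"
  shows
    "(\<forall>k::nat. k \<ge> 4 \<longrightarrow>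
       (\<exists>C1::real. C1 > 0 \<and>
         (\<forall>n::int. n \<noteq> 0 \<longrightarrow>
           (\<forall>(m::nat) (a::nat \<Rightarrow> int) (b::nat \<Rightarrow> int).
              (\<forall>i\<in>{1..2}. a i > 0) \<and> (\<forall>j\<in>{1..m}. b j > 0) \<and>
              strict_mono_on {1..2} a \<and> a 2 \<le> b 1 \<and> strict_mono_on {1..m} b \<and>
              (\<forall>i\<in>{1..2}. \<forall>j\<in>{1..m}. is_nth_power k (a i * b j + n))
              \<longrightarrow> real m \<le> C1 * real_of_int \<bar>n\<bar> powr
                              (real (totient k) / ((real k - 3) * real k) + \<epsilon>)))))
     \<and>
     (\<exists>C2::real. C2 > 0 \<and>
       (\<forall>n::int. n \<noteq> 0 \<longrightarrow>
         (\<forall>(m::nat) (a::nat \<Rightarrow> int) (b::nat \<Rightarrow> int).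
            (\<forall>i\<in>{1..3}. a i > 0) \<and> (\<forall>j\<in>{1..m}. b j > 0) \<and>
            strict_mono_on {1..3} a \<and> a 3 \<le> b 1 \<and> strict_mono_on {1..m} b \<and>
            (\<forall>i\<in>{1..3}. \<forall>j\<in>{1..m}. is_nth_power 3 (a i * b j + n))
            \<longrightarrow> real m \<le> C2 * real_of_int \<bar>n\<bar> powr (34 / 27 + \<epsilon>))))"
proof (intro conjI allI impI)
  fix k :: nat
  assume k: "k \<ge> 4"
  then have k3: "k \<ge> 3" by simp
  obtain C where C: "C > 0"
    and count: "\<forall>(n::int) a1 a2 m (b :: nat \<Rightarrow> int). n \<noteq> 0 \<longrightarrow> 0 < a1 \<longrightarrow> a1 < a2 \<longrightarrow> a2 \<le> b 1 \<longrightarrow> strict_mono_on {1..m} b \<longrightarrow>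
      (\<forall>j\<in>{1..m}. is_nth_power k (a1 * b j + n) \<and> is_nth_power k (a2 * b j + n)) \<longrightarrow>
      large_growth k n m b \<longrightarrow>
      real m \<le> C * real_of_int \<bar>n\<bar> powr \<epsilon>"
    using count_if_growth[OF k3 assms] by blast
  show "\<exists>C1::real. C1 > 0 \<and>
         (\<forall>n::int. n \<noteq> 0 \<longrightarrow>
           (\<forall>(m::nat) (a::nat \<Rightarrow> int) (b::nat \<Rightarrow> int).
              (\<forall>i\<in>{1..2}. a i > 0) \<and> (\<forall>j\<in>{1..m}. b j > 0) \<and>
              strict_mono_on {1..2} a \<and> a 2 \<le> b 1 \<and> strict_mono_on {1..m} b \<and>
              (\<forall>i\<in>{1..2}. \<forall>j\<in>{1..m}. is_nth_power k (a i * b j + n))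
              \<longrightarrow> real m \<le> C1 * real_of_int \<bar>n\<bar> powr
                              (real (totient k) / ((real k - 3) * real k) + \<epsilon>)))"
  proof (intro exI[of _ C] conjI allI impI C)
    fix n :: int and m :: nat and a b :: "nat \<Rightarrow> int"
    assume n: "n \<noteq> 0" and h: "(\<forall>i\<in>{1..2}. a i > 0) \<and> (\<forall>j\<in>{1..m}. b j > 0) \<and>
              strict_mono_on {1..2} a \<and> a 2 \<le> b 1 \<and> strict_mono_on {1..m} b \<and>
              (\<forall>i\<in>{1..2}. \<forall>j\<in>{1..m}. is_nth_power k (a i * b j + n))"
    then have mono: "strict_mono_on {1..m} b" and ab: "a 2 \<le> b 1" by blast+
    have a1: "0 < a 1" using h by auto
    have a12: "a 1 < a 2" using h strict_mono_onD[of "{1..2}" a 1 2] by simp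
    have pw: "is_nth_power k (a 1 * b j + n) \<and> is_nth_power k (a 2 * b j + n)" if "j \<in> {1..m}" for j
      using h that by auto
    have gr: "large_growth k n m b" unfolding large_growth_def
    proof (intro ballI impI)
      fix i j assume ij: "i \<in> {1..m}" "j \<in> {1..m}" "i < j" "(8 * \<bar>n\<bar>) ^ (6 * k) \<le> b i" "2 * \<bar>n\<bar> \<le> b i"
      have "a 2 \<le> b i" using ab strict_mono_on_first_le[OF mono ij(1)] by simp
      then show "b i ^ 3 \<le> b j ^ 2"
        using growth_two[OF k n a1 a12 _ strict_mono_onD[OF mono ij(1-3)] ij(4,5)] pw[OF ij(1)] pw[OF ij(2)] by blast
    qed
    have "real m \<le> C * real_of_int \<bar>n\<bar> powr \<epsilon>"
      using count n a1 a12 ab mono pw gr by blast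
    then show "real m \<le> C * real_of_int \<bar>n\<bar> powr (real (totient k) / ((real k - 3) * real k) + \<epsilon>)"
      using k by (intro powr_bound_weaken C n) auto
  qed
next
  obtain C where C: "C > 0"
    and count: "\<forall>(n::int) a1 a2 m (b :: nat \<Rightarrow> int). n \<noteq> 0 \<longrightarrow> 0 < a1 \<longrightarrow> a1 < a2 \<longrightarrow> a2 \<le> b 1 \<longrightarrow> strict_mono_on {1..m} b \<longrightarrow>
      (\<forall>j\<in>{1..m}. is_nth_power 3 (a1 * b j + n) \<and> is_nth_power 3 (a2 * b j + n)) \<longrightarrow>
      large_growth 3 n m b \<longrightarrow>
      real m \<le> C * real_of_int \<bar>n\<bar> powr \<epsilon>"
    using count_if_growth[OF order_refl assms] by blast
  show "\<exists>C2::real. C2 > 0 \<and>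
       (\<forall>n::int. n \<noteq> 0 \<longrightarrow>
         (\<forall>(m::nat) (a::nat \<Rightarrow> int) (b::nat \<Rightarrow> int).
            (\<forall>i\<in>{1..3}. a i > 0) \<and> (\<forall>j\<in>{1..m}. b j > 0) \<and>
            strict_mono_on {1..3} a \<and> a 3 \<le> b 1 \<and> strict_mono_on {1..m} b \<and>
            (\<forall>i\<in>{1..3}. \<forall>j\<in>{1..m}. is_nth_power 3 (a i * b j + n))
            \<longrightarrow> real m \<le> C2 * real_of_int \<bar>n\<bar> powr (34 / 27 + \<epsilon>)))"
  proof (intro exI[of _ C] conjI allI impI C)
    fix n :: int and m :: nat and a b :: "nat \<Rightarrow> int"
    assume n: "n \<noteq> 0" and h: "(\<forall>i\<in>{1..3}. a i > 0) \<and> (\<forall>j\<in>{1..m}. b j > 0) \<and>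
            strict_mono_on {1..3} a \<and> a 3 \<le> b 1 \<and> strict_mono_on {1..m} b \<and>
            (\<forall>i\<in>{1..3}. \<forall>j\<in>{1..m}. is_nth_power 3 (a i * b j + n))"
    then have mono: "strict_mono_on {1..m} b" and a3b: "a 3 \<le> b 1" by blast+
    have a1: "0 < a 1" using h by auto
    have a12: "a 1 < a 2" and a23: "a 2 < a 3"
      using h strict_mono_onD[of "{1..3}" a 1 2] strict_mono_onD[of "{1..3}" a 2 3] by simp_all
    have ab: "a 2 \<le> b 1" using a23 a3b by simp
    have pw: "is_nth_power 3 (a 1 * b j + n)" "is_nth_power 3 (a 2 * b j + n)" "is_nth_power 3 (a 3 * b j + n)"
      if "j \<in> {1..m}" for j using h that by auto
    have gr: "large_growth 3 n m b" unfolding large_growth_def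
    proof (intro ballI impI)
      fix i j assume ij: "i \<in> {1..m}" "j \<in> {1..m}" "i < j" "(8 * \<bar>n\<bar>) ^ (6 * 3) \<le> b i" "2 * \<bar>n\<bar> \<le> b i"
      have "a 3 \<le> b i" using a3b strict_mono_on_first_le[OF mono ij(1)] by simp
      then show "b i ^ 3 \<le> b j ^ 2"
        using growth_three[OF n a1 a12 a23 _ strict_mono_onD[OF mono ij(1-3)] ij(4,5)] pw[OF ij(1)] pw[OF ij(2)] by blast
    qed
    have "real m \<le> C * real_of_int \<bar>n\<bar> powr \<epsilon>"
      using count n a1 a12 ab mono pw gr by blast
    then show "real m \<le> C * real_of_int \<bar>n\<bar> powr (34 / 27 + \<epsilon>)"
      by (intro powr_bound_weaken C n) auto
  qed
qed

end
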